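(* Let $k\ge 1$ be an integer. Suppose that $\theta$ is in the interior of $\Theta$, that $\hat\theta_n$ satisfies $\sqrt n\,|\hat\theta_n-\theta|=O_P(1)$, and that $\lim_{x\to 0}x^{-\zeta}P\{|\varepsilon_0|\le x\}=0$ for some $\zeta>0$. If $E|\varepsilon_0|^k<\infty$, then, as $n\to\infty$, $$\sup_{0\le u\le 1}\left|\frac{1}{\sqrt n}\bigl(\hat S_n^{(k)}(u)-S_n^{(k)}(u)\bigr)+\frac{k u\mu_k}{2}\bigl\langle \psi(\theta),\sqrt n(\hat\theta_n-\theta)\bigr\rangle\right|=o_P(1),$$ where $\langle x,y\rangle$ is the inner product of the vectors $x$ and $y$.
   Context: Model. Let $p,q\ge 1$ be integers and $\theta=(\alpha_0,\alpha_1,\dots,\alpha_p,\beta_1,\dots,\beta_q)$ with $\alpha_0>0$, $\alpha_i\ge 0$, $\beta_j\ge 0$. Let $\{\varepsilon_t\}_{t\in\mathbb Z}$ be i.i.d. random variables with mean $0$ and variance $1$; when $\varepsilon_0$ has a finite $k$th moment write $\mu_k=E(\varepsilon_0^k)$ (so $\mu_1=0$, $\mu_2=1$). $\{X_t\}_{t\in\mathbb Z}$ is a GARCH$(p,q)$ sequence: $X_t=\sigma_t\varepsilon_t$, $\sigma_t^2=\alpha_0+\sum_{i=1}^p\alpha_iX_{t-i}^2+\sum_{j=1}^q\beta_j\sigma_{t-j}^2$. Standing assumption: the Bougerol–Picard conditions hold, under which these equations have a unique strictly stationary solution, with $\sigma_t$ a function of $\varepsilon_{t-1},\varepsilon_{t-2},\dots$;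 $\{X_t\}$ is this solution. Notation. $|\cdot|$ is the maximum norm of vectors or matrices. For $\mathbf u=(s_0,\dots,s_p,t_1,\dots,t_q)\in\mathbb R^{p+q+1}$ put $c_0(\mathbf u)=s_0/(1-(t_1+\cdots+t_q))$ and, recursively for $i\ge 1$, $c_i(\mathbf u)=s_i+\sum_{j=1}^{\min(i-1,q)}t_jc_{i-j}(\mathbf u)$ if $i\le p$, and $c_i(\mathbf u)=\sum_{j=1}^{\min(i-1,q)}t_jc_{i-j}(\mathbf u)$ if $i>p$. Fix $0<\underline u<\bar u$, $0<\rho_0<1$ with $q\underline u<\rho_0$, and let $\Theta$ be the set of $\mathbf u$ with $t_1+\cdots+t_q\le\rho_0$ and all coordinates of $\mathbf u$ in $[\underline u,\bar u]$. For $\mathbf u\in\Theta$ let $\sigma_t^2(\mathbf u)=c_0(\mathbf u)+\sum_{i=1}^\infty c_i(\mathbf u)X_{t-i}^2$ (a.s. finite); then $\sigma_t^2=\sigma_t^2(\theta)$. Write $\partial$ for the gradient with respect to $\mathbf u$, $\partial\log\sigma_t^2(\mathbf u)=\dfrac{\partial c_0(\mathbf u)+\sum_{i\ge1}\partial c_i(\mathbf u)X_{t-i}^2}{c_0(\mathbf u)+\sum_{i\ge1}c_i(\mathbf u)X_{t-i}^2}\in\mathbb R^{p+q+1}$, and $\psi(\theta)=E(\partial\log\sigma_0^2(\theta))$. Residuals. $\hat\theta_n$ is an estimator of $\theta$ based on $X_0,\dots,X_n$. For $1\le t\le n$, $\hat\sigma_t^2=c_0(\hat\theta_n)+\sum_{i=1}^tc_i(\hat\theta_n)X_{t-i}^2$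 and $\hat\varepsilon_t=X_t/\hat\sigma_t$. For $0\le u\le1$, $\hat S_n^{(k)}(u)=\sum_{t=1}^{[nu]}\hat\varepsilon_t^k$ and $S_n^{(k)}(u)=\sum_{t=1}^{[nu]}\varepsilon_t^k$. *)

theory Defs
  imports
    "HOL-Probability.Probability"
    "HOL-Analysis.Abstract_Euclidean_Space"
    "Jordan_Normal_Form.Matrix"
begin

text \<open>
  A parameter vector \<open>u = (s\<^sub>0, ..., s\<^sub>p, t\<^sub>1, ..., t\<^sub>q)\<close> is a point of
  \<^term>\<open>Euclidean_space (p + q + 1)\<close>, i.e. a function on the naturals that vanishes from
  \<open>p + q + 1\<close> on, with \<open>s\<^sub>i = u i\<close> for \<open>i \<le> p\<close> and \<open>t\<^sub>j = u (p + j)\<close> for \<open>1 \<le> j \<le> q\<close>.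
  Likewise \<open>\<alpha>\<^sub>i = \<theta> i\<close> and \<open>\<beta>\<^sub>j = \<theta> (p + j)\<close>.
\<close>

definition garch_parameter :: "nat \<Rightarrow> nat \<Rightarrow> (nat \<Rightarrow> real) \<Rightarrow> bool" where
  "garch_parameter p q \<theta> \<longleftrightarrow>
     \<theta> \<in> topspace (Euclidean_space (p + q + 1)) \<and> \<theta> 0 > 0 \<and> (\<forall>i\<in>{1..p + q}. \<theta> i \<ge> 0)"

definition max_norm :: "nat \<Rightarrow> (nat \<Rightarrow> real) \<Rightarrow> real" where
  "max_norm d x = Max ((\<lambda>i. \<bar>x i\<bar>) ` {..<d})"

definition inner_prod :: "nat \<Rightarrow> (nat \<Rightarrow> real) \<Rightarrow> (nat \<Rightarrow> real) \<Rightarrow> real" where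
  "inner_prod d x y = (\<Sum>i<d. x i * y i)"

definition param_space :: "nat \<Rightarrow> nat \<Rightarrow> real \<Rightarrow> real \<Rightarrow> real \<Rightarrow> (nat \<Rightarrow> real) set" where
  "param_space p q u_lo u_hi \<rho>\<^sub>0 =
     {u \<in> topspace (Euclidean_space (p + q + 1)).
        (\<Sum>j=1..q. u (p + j)) \<le> \<rho>\<^sub>0 \<and> (\<forall>i<p + q + 1. u_lo \<le> u i \<and> u i \<le> u_hi)}"

subsection \<open>The model\<close>

definition iid_innovations :: "'a measure \<Rightarrow> (int \<Rightarrow> 'a \<Rightarrow> real) \<Rightarrow> bool" where
  "iid_innovations M \<epsilon> \<longleftrightarrow>
     prob_space.indep_vars M (\<lambda>_. borel) \<epsilon> UNIV \<and>
     (\<forall>t. distr M borel (\<epsilon> t) = distr M borel (\<epsilon> 0)) \<and>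
     integrable M (\<epsilon> 0) \<and> integral\<^sup>L M (\<epsilon> 0) = 0 \<and>
     integrable M (\<lambda>\<omega>. (\<epsilon> 0 \<omega>)\<^sup>2) \<and> integral\<^sup>L M (\<lambda>\<omega>. (\<epsilon> 0 \<omega>)\<^sup>2) = 1"

text \<open>
  The random coefficient matrix of Bougerol and Picard, as a function of the innovation \<open>e\<close>:
  it is the matrix \<open>A\<^sub>t\<close> in \<open>Y\<^sub>t = A\<^sub>t Y\<^bsub>t-1\<^esub> + B\<close> for
  \<open>Y\<^sub>t = (\<sigma>\<^bsub>t+1\<^esub>\<^sup>2, ..., \<sigma>\<^bsub>t-q+2\<^esub>\<^sup>2, X\<^sub>t\<^sup>2, ..., X\<^bsub>t-p+2\<^esub>\<^sup>2)\<close>,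
  \<open>B = (\<alpha>\<^sub>0, 0, ..., 0)\<close> and \<open>e = \<epsilon>\<^sub>t\<close>. The index formula also covers \<open>p = 1\<close> (no \<open>X\<close>-entries)
  and \<open>q = 1\<close>, so no padding by zero coefficients is needed.
\<close>

definition bp_matrix :: "nat \<Rightarrow> nat \<Rightarrow> (nat \<Rightarrow> real) \<Rightarrow> real \<Rightarrow> real mat" where
  "bp_matrix p q \<theta> e = Matrix.mat (p + q - 1) (p + q - 1) (\<lambda>(r, s).
     if r = 0 then
       (if s = 0 then \<theta> (p + 1) + \<theta> 1 * e\<^sup>2
        else if s < q then \<theta> (p + (s + 1))
        else \<theta> (s - q + 2))
     else if r = q then (if s = 0 then e\<^sup>2 else 0)
     else (if s = r - 1 then 1 else 0))"

text \<open>The operator norm associated with the maximum norm on vectors.\<close>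

definition mat_op_norm :: "real mat \<Rightarrow> real" where
  "mat_op_norm A = Max ((\<lambda>i. \<Sum>j<dim_col A. \<bar>A $$ (i, j)\<bar>) ` {..<dim_row A})"

text \<open>\<open>bp_product p q \<theta> \<epsilon> n \<omega>\<close> is \<open>A\<^sub>0 A\<^bsub>-1\<^esub> ... A\<^bsub>-(n-1)\<^esub>\<close>.\<close>

definition bp_product ::
  "nat \<Rightarrow> nat \<Rightarrow> (nat \<Rightarrow> real) \<Rightarrow> (int \<Rightarrow> 'a \<Rightarrow> real) \<Rightarrow> nat \<Rightarrow> 'a \<Rightarrow> real mat" where
  "bp_product p q \<theta> \<epsilon> n \<omega> =
     foldr (\<lambda>i B. bp_matrix p q \<theta> (\<epsilon> (- int i) \<omega>) * B) [0..<n] (1\<^sub>m (p + q - 1))"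

text \<open>
  The top Lyapunov exponent. If \<open>\<beta>\<^sub>1 > 0\<close> the norms below are at least \<open>\<beta>\<^sub>1 ^ n\<close> (look at the entry
  in the upper left corner), so that the logarithm is never taken at \<open>0\<close> and is integrable.
\<close>

definition top_lyapunov ::
  "'a measure \<Rightarrow> nat \<Rightarrow> nat \<Rightarrow> (nat \<Rightarrow> real) \<Rightarrow> (int \<Rightarrow> 'a \<Rightarrow> real) \<Rightarrow> ereal" where
  "top_lyapunov M p q \<theta> \<epsilon> =
     (INF n\<in>{1..}. ereal ((1 / real n) *
        (\<integral>\<omega>. ln (mat_op_norm (bp_product p q \<theta> \<epsilon> n \<omega>)) \<partial>M)))"

definition bougerol_picard ::
  "'a measure \<Rightarrow> nat \<Rightarrow> nat \<Rightarrow> (nat \<Rightarrow> real) \<Rightarrow> (int \<Rightarrow> 'a \<Rightarrow> real) \<Rightarrow> bool" where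
  "bougerol_picard M p q \<theta> \<epsilon> \<longleftrightarrow>
     integrable M (\<lambda>\<omega>. max 0 (ln (mat_op_norm (bp_matrix p q \<theta> (\<epsilon> 0 \<omega>))))) \<and>
     top_lyapunov M p q \<theta> \<epsilon> < 0"

definition strictly_stationary ::
  "'a measure \<Rightarrow> (int \<Rightarrow> 'a \<Rightarrow> 'b::topological_space) \<Rightarrow> bool" where
  "strictly_stationary M Z \<longleftrightarrow>
     (\<forall>t. Z t \<in> borel_measurable M) \<and>
     (\<forall>h. distr M (Pi\<^sub>M UNIV (\<lambda>_. borel)) (\<lambda>\<omega> t. Z (t + h) \<omega>)
        = distr M (Pi\<^sub>M UNIV (\<lambda>_. borel)) (\<lambda>\<omega> t. Z t \<omega>))"

text \<open>
  Strictly stationary solution of the GARCH equations with \<open>\<sigma>\<^sub>t\<close> a function of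
  \<open>\<epsilon>\<^bsub>t-1\<^esub>, \<epsilon>\<^bsub>t-2\<^esub>, ...\<close>; the equations are understood almost surely.
\<close>

definition garch_solution ::
  "'a measure \<Rightarrow> nat \<Rightarrow> nat \<Rightarrow> (nat \<Rightarrow> real) \<Rightarrow> (int \<Rightarrow> 'a \<Rightarrow> real) \<Rightarrow>
     (int \<Rightarrow> 'a \<Rightarrow> real) \<Rightarrow> (int \<Rightarrow> 'a \<Rightarrow> real) \<Rightarrow> bool" where
  "garch_solution M p q \<theta> \<epsilon> X \<sigma> \<longleftrightarrow>
     (\<forall>t. X t \<in> borel_measurable M \<and> \<sigma> t \<in> borel_measurable M) \<and>
     (\<forall>t. AE \<omega> in M. \<sigma> t \<omega> \<ge> 0 \<and> X t \<omega> = \<sigma> t \<omega> * \<epsilon> t \<omega> \<and>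
        (\<sigma> t \<omega>)\<^sup>2 = \<theta> 0 + (\<Sum>i=1..p. \<theta> i * (X (t - int i) \<omega>)\<^sup>2)
                       + (\<Sum>j=1..q. \<theta> (p + j) * (\<sigma> (t - int j) \<omega>)\<^sup>2)) \<and>
     strictly_stationary M (\<lambda>t \<omega>. (X t \<omega>, \<sigma> t \<omega>)) \<and>
     (\<forall>t. \<exists>f \<in> borel_measurable (Pi\<^sub>M (UNIV :: nat set) (\<lambda>_. borel)).
        AE \<omega> in M. \<sigma> t \<omega> = f (\<lambda>i. \<epsilon> (t - 1 - int i) \<omega>))"

subsection \<open>The coefficients, the score and the residuals\<close>

fun garch_coeff :: "nat \<Rightarrow> nat \<Rightarrow> (nat \<Rightarrow> real) \<Rightarrow> nat \<Rightarrow> real" where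
  "garch_coeff p q u i =
     (if i = 0 then u 0 / (1 - (\<Sum>j=1..q. u (p + j)))
      else if i \<le> p then u i + (\<Sum>j=1..min (i - 1) q. u (p + j) * garch_coeff p q u (i - j))
      else (\<Sum>j=1..min (i - 1) q. u (p + j) * garch_coeff p q u (i - j)))"

declare garch_coeff.simps [simp del]

text \<open>The \<open>m\<close>-th component of the gradient of \<open>c\<^sub>i\<close> at \<open>u\<close>.\<close>

definition grad_garch_coeff :: "nat \<Rightarrow> nat \<Rightarrow> (nat \<Rightarrow> real) \<Rightarrow> nat \<Rightarrow> nat \<Rightarrow> real" where
  "grad_garch_coeff p q u i m = deriv (\<lambda>x. garch_coeff p q (u(m := x)) i) (u m)"

definition grad_log_sigma2 ::
  "nat \<Rightarrow> nat \<Rightarrow> (int \<Rightarrow> 'a \<Rightarrow> real) \<Rightarrow> int \<Rightarrow> (nat \<Rightarrow> real) \<Rightarrow> 'a \<Rightarrow> nat \<Rightarrow> real" where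
  "grad_log_sigma2 p q X t u \<omega> m =
     (grad_garch_coeff p q u 0 m
        + (\<Sum>i. grad_garch_coeff p q u (Suc i) m * (X (t - int (Suc i)) \<omega>)\<^sup>2))
     / (garch_coeff p q u 0
        + (\<Sum>i. garch_coeff p q u (Suc i) * (X (t - int (Suc i)) \<omega>)\<^sup>2))"

definition garch_psi ::
  "'a measure \<Rightarrow> nat \<Rightarrow> nat \<Rightarrow> (int \<Rightarrow> 'a \<Rightarrow> real) \<Rightarrow> (nat \<Rightarrow> real) \<Rightarrow> nat \<Rightarrow> real" where
  "garch_psi M p q X \<theta> m = (\<integral>\<omega>. grad_log_sigma2 p q X 0 \<theta> \<omega> m \<partial>M)"

text \<open>\<open>\<theta>hat n\<close> is a Borel function of \<open>X\<^sub>0, ..., X\<^sub>n\<close> with values in \<open>\<real>\<^bsup>p+q+1\<^esup>\<close>.\<close>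

definition garch_estimator ::
  "'a measure \<Rightarrow> nat \<Rightarrow> nat \<Rightarrow> (int \<Rightarrow> 'a \<Rightarrow> real) \<Rightarrow> (nat \<Rightarrow> 'a \<Rightarrow> nat \<Rightarrow> real) \<Rightarrow> bool" where
  "garch_estimator M p q X \<theta>hat \<longleftrightarrow>
     (\<forall>n. \<exists>T :: (nat \<Rightarrow> real) \<Rightarrow> nat \<Rightarrow> real.
        (\<forall>x. T x \<in> topspace (Euclidean_space (p + q + 1))) \<and>
        (\<forall>i<p + q + 1. (\<lambda>x. T x i) \<in> borel_measurable (Pi\<^sub>M {0..n} (\<lambda>_. borel))) \<and>
        (\<forall>\<omega>\<in>space M. \<theta>hat n \<omega> = T (\<lambda>t\<in>{0..n}. X (int t) \<omega>)))"

definition sigma2_hat ::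
  "nat \<Rightarrow> nat \<Rightarrow> (int \<Rightarrow> 'a \<Rightarrow> real) \<Rightarrow> (nat \<Rightarrow> 'a \<Rightarrow> nat \<Rightarrow> real) \<Rightarrow> nat \<Rightarrow> nat \<Rightarrow> 'a \<Rightarrow> real" where
  "sigma2_hat p q X \<theta>hat n t \<omega> =
     garch_coeff p q (\<theta>hat n \<omega>) 0
     + (\<Sum>i=1..t. garch_coeff p q (\<theta>hat n \<omega>) i * (X (int t - int i) \<omega>)\<^sup>2)"

definition residual ::
  "nat \<Rightarrow> nat \<Rightarrow> (int \<Rightarrow> 'a \<Rightarrow> real) \<Rightarrow> (nat \<Rightarrow> 'a \<Rightarrow> nat \<Rightarrow> real) \<Rightarrow> nat \<Rightarrow> nat \<Rightarrow> 'a \<Rightarrow> real" where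
  "residual p q X \<theta>hat n t \<omega> = X (int t) \<omega> / sqrt (sigma2_hat p q X \<theta>hat n t \<omega>)"

definition residual_partial_sum ::
  "nat \<Rightarrow> nat \<Rightarrow> (int \<Rightarrow> 'a \<Rightarrow> real) \<Rightarrow> (nat \<Rightarrow> 'a \<Rightarrow> nat \<Rightarrow> real) \<Rightarrow> nat \<Rightarrow> nat \<Rightarrow> real \<Rightarrow> 'a \<Rightarrow> real" where
  "residual_partial_sum p q X \<theta>hat k n u \<omega> =
     (\<Sum>t = 1..nat \<lfloor>real n * u\<rfloor>. residual p q X \<theta>hat n t \<omega> ^ k)"

definition innovation_partial_sum ::
  "(int \<Rightarrow> 'a \<Rightarrow> real) \<Rightarrow> nat \<Rightarrow> nat \<Rightarrow> real \<Rightarrow> 'a \<Rightarrow> real" where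
  "innovation_partial_sum \<epsilon> k n u \<omega> = (\<Sum>t = 1..nat \<lfloor>real n * u\<rfloor>. \<epsilon> (int t) \<omega> ^ k)"

subsection \<open>Stochastic order symbols\<close>

definition bounded_in_prob :: "'a measure \<Rightarrow> (nat \<Rightarrow> 'a \<Rightarrow> real) \<Rightarrow> bool" where
  "bounded_in_prob M Y \<longleftrightarrow>
     (\<forall>\<eta>>0. \<exists>K. \<forall>\<^sub>F n in sequentially. \<P>(\<omega> in M. \<bar>Y n \<omega>\<bar> > K) \<le> \<eta>)"

definition negligible_in_prob :: "'a measure \<Rightarrow> (nat \<Rightarrow> 'a \<Rightarrow> real) \<Rightarrow> bool" where
  "negligible_in_prob M Y \<longleftrightarrow>
     (\<forall>n. Y n \<in> borel_measurable M) \<and>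
     (\<forall>\<eta>>0. (\<lambda>n. \<P>(\<omega> in M. \<bar>Y n \<omega>\<bar> > \<eta>)) \<longlonglongrightarrow> 0)"

end

theory Submission
  imports Defs
begin

text \<open>
  Write \<open>v\<^sub>t = \<sigma>\<^sub>t\<^sup>2\<close> and let \<open>Y\<^sub>t\<close> be the ratio of the estimated to the true conditional variance, so that
  \<open>\<epsilon>hat\<^sub>t\<^sup>k - \<epsilon>\<^sub>t\<^sup>k = \<epsilon>\<^sub>t\<^sup>k (Y\<^sub>t powr (- k / 2) - 1)\<close>. To first order this is \<open>- (k / 2) \<epsilon>\<^sub>t\<^sup>k\<close> times the inner
  product of the score \<open>\<partial> log \<sigma>\<^sub>t\<^sup>2(\<theta>)\<close> with \<open>\<theta>hat - \<theta>\<close>. Since \<open>sqrt n (\<theta>hat - \<theta>)\<close> is bounded in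
  probability, the sum of these linear terms, divided by \<open>sqrt n\<close>, is governed by the averages of
  \<open>\<epsilon>\<^sub>t\<^sup>k\<close> times the score over \<open>t \<le> n u\<close>. As \<open>\<epsilon>\<^sub>t\<close> is independent of the past, on which the score depends, the
  law of large numbers turns them into \<open>u \<mu>\<^sub>k \<psi>(\<theta>)\<close>. It has to be shown that the score is integrable, that the
  law of large numbers holds uniformly in \<open>u\<close>, and that the quadratic remainders and the truncation of
  \<open>\<sigma>\<^sub>t\<^sup>2(u)\<close> at the start of the sample are negligible.

  Everything hinges on the weights \<open>c\<^sub>i(\<theta>) X\<^bsub>t-i\<^esub>\<^sup>2 / v\<^sub>t\<close> in the expansion of the volatility. They decay
  geometrically: since \<open>v\<^sub>t \<le> \<alpha>\<^sub>1 X\<^bsub>t-1\<^esub>\<^sup>2 + C v\<^bsub>t-1\<^esub>\<close> and \<open>X\<^bsub>t-1\<^esub>\<^sup>2 = v\<^bsub>t-1\<^esub> \<epsilon>\<^bsub>t-1\<^esub>\<^sup>2\<close>, the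
  terms \<open>\<beta>\<^sub>j v\<^bsub>t-j\<^esub>\<close> together make up at most the fraction \<open>C / (C + \<alpha>\<^sub>1 \<epsilon>\<^bsub>t-1\<^esub>\<^sup>2)\<close> of \<open>v\<^sub>t\<close>
  (\<open>beta_sum_le\<close>). Iterating, and collecting one such factor from every block of \<open>q\<close> consecutive times,
  gives a bound for the weights by products of independent factors with mean less than \<open>1\<close>
  (\<open>lag_term_le\<close>, \<open>decay_expectation\<close>). Hence for some \<open>\<mu> > 1\<close> the weights are at most
  \<open>g\<^sub>t \<mu> ^ (- 4 i)\<close> with an envelope \<open>g\<^sub>t\<close> whose third moment is finite and that is a function of the past
  (\<open>envelope_exists\<close>, \<open>decay_le_envelope\<close>). The same decay shows that \<open>v\<^sub>t\<close> equals its expansion in the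
  \<open>X\<^bsub>t-i\<^esub>\<^sup>2\<close> (\<open>v_expansion\<close>).

  The coefficients \<open>c\<^sub>i\<close> with \<open>i \<ge> 1\<close> are polynomials with nonnegative coefficients and of degree at most
  \<open>i\<close>. A relative change of the parameter by \<open>e\<close> therefore changes them relatively by \<open>O(i e)\<close>, with quadratic
  remainder \<open>O(i\<^sup>2 e\<^sup>2)\<close>, up to a factor \<open>\<mu> ^ i\<close> (\<open>lag_coeff_taylor\<close>). The weights absorb these factors, so
  the score is \<open>O(g\<^sub>t)\<close>, and \<open>Y\<^sub>t - 1\<close> differs from its linear part by \<open>O((e\<^sup>2 + \<mu> ^ (- t)) g\<^sub>t)\<close>, the second
  term being the truncation (\<open>linearisation\<close>). With \<open>e\<close> of order \<open>1 / sqrt n\<close> and the maximum of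
  \<open>g\<^sub>1, \<dots>, g\<^sub>n\<close> of order \<open>o(sqrt n)\<close>, by its third moment, \<open>Y\<^sub>t\<close> is close to \<open>1\<close> at all times but finitely many
  early ones, and the remainders sum to \<open>O(1)\<close> in probability.

  The law of large numbers (\<open>uniform_LLN\<close>) is proved for integrable functions of the past of an i.i.d.
  sequence by approximation in mean with bounded functions of finitely many innovations. It applies
  because, by strict stationarity, one and the same functional represents \<open>\<sigma>\<^sub>t\<close> at all times
  (\<open>sigma_functional\<close>).
\<close>

section \<open>The coefficients as functions of the parameter\<close>

text \<open>The coefficient \<open>c\<^sub>0\<close> does not enter the recursion for the later ones. With the value at \<open>0\<close> reset to
\<open>0\<close>, that recursion has no boundary terms: a summand with \<open>j \<ge> i\<close> vanishes by itself, because \<open>i - j\<close> is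
then \<open>0\<close> on the naturals.\<close>

definition lag_coeff :: "nat \<Rightarrow> nat \<Rightarrow> (nat \<Rightarrow> real) \<Rightarrow> nat \<Rightarrow> real" where
  "lag_coeff p q u i = (if i = 0 then 0 else garch_coeff p q u i)"

lemma lag_coeff_0 [simp]: "lag_coeff p q u 0 = 0"
  by (simp add: lag_coeff_def)

lemma garch_coeff_pos: "i > 0 \<Longrightarrow> garch_coeff p q u i = lag_coeff p q u i"
  by (simp add: lag_coeff_def)

lemma garch_coeff_0: "garch_coeff p q u 0 = u 0 / (1 - (\<Sum>j=1..q. u (p + j)))"
  by (subst garch_coeff.simps) simp

lemma lag_coeff_rec:
  assumes "i > 0"
  shows "lag_coeff p q u i = (if i \<le> p then u i else 0) + (\<Sum>j=1..q. u (p + j) * lag_coeff p q u (i - j))"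
proof -
  have "(\<Sum>j=1..min (i - 1) q. u (p + j) * garch_coeff p q u (i - j))
      = (\<Sum>j=1..q. u (p + j) * lag_coeff p q u (i - j))"
    using assms by (intro sum.mono_neutral_cong_left) (auto simp: lag_coeff_def)
  then show ?thesis
    using assms by (subst lag_coeff_def, subst garch_coeff.simps) simp
qed

lemma lag_coeff_nonneg:
  assumes "\<And>m. 1 \<le> m \<Longrightarrow> m \<le> p + q \<Longrightarrow> 0 \<le> u m"
  shows "0 \<le> lag_coeff p q u i"
proof (induction i rule: less_induct)
  case (less i)
  show ?case
  proof (cases "i = 0")
    case False
    then show ?thesis
      using assms less by (subst lag_coeff_rec) (auto intro!: add_nonneg_nonneg sum_nonneg mult_nonneg_nonneg)
  qed simp
qed

text \<open>\<open>c\<^sub>i\<close> is a polynomial with nonnegative coefficients whose monomials have degree between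
  \<open>1\<close> and \<open>i\<close>; a scaling of the parameter by at most \<open>L \<ge> 1\<close> therefore costs a factor \<open>L ^ i\<close>.\<close>

lemma lag_coeff_scaled_le:
  assumes "L \<ge> 1"
    and "\<And>m. 1 \<le> m \<Longrightarrow> m \<le> p + q \<Longrightarrow> 0 \<le> u m \<and> 0 \<le> w m \<and> w m \<le> L * u m"
  shows "lag_coeff p q w i \<le> L ^ i * lag_coeff p q u i"
proof (induction i rule: less_induct)
  case (less i)
  show ?case
  proof (cases "i = 0")
    case False
    have "L ^ 1 \<le> L ^ i"
      using False assms(1) by (intro power_increasing) auto
    then have L: "L \<le> L ^ i" by simp
    have nn: "0 \<le> lag_coeff p q u j" "0 \<le> lag_coeff p q w j" for j
      using assms(2) by (auto intro!: lag_coeff_nonneg)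
    have "w i \<le> L ^ i * u i" if "i \<le> p"
    proof -
      have "w i \<le> L * u i" using that assms(2) False by auto
      also have "\<dots> \<le> L ^ i * u i" using that assms(2)[of i] False L by (intro mult_right_mono) auto
      finally show ?thesis .
    qed
    moreover have "w (p + j) * lag_coeff p q w (i - j) \<le> L ^ i * (u (p + j) * lag_coeff p q u (i - j))"
      if "j \<in> {1..q}" for j
    proof (cases "j < i")
      case True
      have "w (p + j) * lag_coeff p q w (i - j) \<le> (L * u (p + j)) * (L ^ (i - j) * lag_coeff p q u (i - j))"
        using that True assms nn less[of "i - j"] by (intro mult_mono) auto
      also have "\<dots> = L ^ (Suc (i - j)) * (u (p + j) * lag_coeff p q u (i - j))"
        by (simp add: algebra_simps)
      also have "\<dots> \<le> L ^ i * (u (p + j) * lag_coeff p q u (i - j))"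
        using that True assms nn by (intro mult_right_mono power_increasing) (auto intro!: mult_nonneg_nonneg)
      finally show ?thesis .
    qed simp
    ultimately show ?thesis
      using False by (subst (1 2) lag_coeff_rec)
        (auto simp: distrib_left sum_distrib_left intro!: add_mono sum_mono)
  qed simp
qed

lemma lag_coeff_differentiable:
  "(\<lambda>x. lag_coeff p q (u(m := x)) i) field_differentiable (at y)"
proof (induction i rule: less_induct)
  case (less i)
  have upd: "(\<lambda>x. (u(m := x)) k) field_differentiable (at y)" for k
    by (cases "k = m") (auto simp: field_differentiable_const field_differentiable_ident)
  show ?case
  proof (cases "i = 0")
    case False
    have "(\<lambda>x. (if i \<le> p then (u(m := x)) i else 0)
        + (\<Sum>j=1..q. (u(m := x)) (p + j) * lag_coeff p q (u(m := x)) (i - j))) field_differentiable (at y)"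
    proof (intro field_differentiable_add field_differentiable_sum field_differentiable_mult upd)
      show "(\<lambda>x. if i \<le> p then (u(m := x)) i else 0) field_differentiable (at y)"
        using upd[of i] by (cases "i \<le> p") (simp_all only: if_True if_False field_differentiable_const)
      show "(\<lambda>x. lag_coeff p q (u(m := x)) (i - j)) field_differentiable (at y)" if "j \<in> {1..q}" for j
        using that False by (intro less) auto
    qed
    then show ?thesis
      using False by (subst lag_coeff_rec) auto
  qed (simp add: field_differentiable_const)
qed

text \<open>The partial derivatives obey the recursion obtained by differentiating the one for \<open>c\<^sub>i\<close> term by term;
the bounds below are read off from it.\<close>

definition lag_coeff_grad :: "nat \<Rightarrow> nat \<Rightarrow> (nat \<Rightarrow> real) \<Rightarrow> nat \<Rightarrow> nat \<Rightarrow> real" where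
  "lag_coeff_grad p q u i m = deriv (\<lambda>x. lag_coeff p q (u(m := x)) i) (u m)"

lemma grad_garch_coeff_pos: "i > 0 \<Longrightarrow> grad_garch_coeff p q u i m = lag_coeff_grad p q u i m"
  by (simp add: lag_coeff_grad_def grad_garch_coeff_def lag_coeff_def)

lemma lag_coeff_grad_0 [simp]: "lag_coeff_grad p q u 0 m = 0"
  by (simp add: lag_coeff_grad_def)

lemma lag_coeff_grad_rec:
  assumes "i > 0"
  shows "lag_coeff_grad p q u i m = (if i \<le> p \<and> m = i then 1 else 0)
    + (\<Sum>j=1..q. (if m = p + j then lag_coeff p q u (i - j) else 0)
                 + u (p + j) * lag_coeff_grad p q u (i - j) m)"
proof -
  have d: "((\<lambda>x. lag_coeff p q (u(m := x)) j) has_field_derivative lag_coeff_grad p q u j m) (at (u m))" for j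
    unfolding lag_coeff_grad_def using lag_coeff_differentiable
    by (simp add: field_differentiable_derivI)
  have upd: "((\<lambda>x. (u(m := x)) k) has_field_derivative (if m = k then 1 else 0)) (at (u m))" for k
    by (cases "k = m") (auto intro!: derivative_eq_intros)
  have "((\<lambda>x. (if i \<le> p then (u(m := x)) i else 0)
        + (\<Sum>j=1..q. (u(m := x)) (p + j) * lag_coeff p q (u(m := x)) (i - j))) has_field_derivative
        (if i \<le> p \<and> m = i then 1 else 0)
       + (\<Sum>j=1..q. (if m = p + j then 1 else 0) * lag_coeff p q (u(m := u m)) (i - j)
                  + lag_coeff_grad p q u (i - j) m * (u(m := u m)) (p + j))) (at (u m))"
  proof (rule DERIV_add)
    show "((\<lambda>x. if i \<le> p then (u(m := x)) i else 0) has_field_derivative (if i \<le> p \<and> m = i then 1 else 0)) (at (u m))"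
      using upd[of i] by (cases "i \<le> p") (simp_all del: fun_upd_apply add: conj_commute)
    show "((\<lambda>x. \<Sum>j=1..q. (u(m := x)) (p + j) * lag_coeff p q (u(m := x)) (i - j)) has_field_derivative
       (\<Sum>j=1..q. (if m = p + j then 1 else 0) * lag_coeff p q (u(m := u m)) (i - j)
                  + lag_coeff_grad p q u (i - j) m * (u(m := u m)) (p + j))) (at (u m))"
      by (intro DERIV_sum DERIV_mult upd d)
  qed
  moreover have "((\<lambda>x. lag_coeff p q (u(m := x)) i) has_field_derivative lag_coeff_grad p q u i m) (at (u m))"
    by (rule d)
  ultimately have "lag_coeff_grad p q u i m = (if i \<le> p \<and> m = i then 1 else 0)
       + (\<Sum>j=1..q. (if m = p + j then 1 else 0) * lag_coeff p q (u(m := u m)) (i - j)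
                  + lag_coeff_grad p q u (i - j) m * (u(m := u m)) (p + j))"
    using assms by (subst (asm) (2) lag_coeff_rec) (auto intro: DERIV_unique)
  also have "\<dots> = (if i \<le> p \<and> m = i then 1 else 0)
    + (\<Sum>j=1..q. (if m = p + j then lag_coeff p q u (i - j) else 0)
                 + u (p + j) * lag_coeff_grad p q u (i - j) m)"
    by (intro arg_cong2[where f="(+)"] refl sum.cong) (auto simp: mult.commute)
  finally show ?thesis .
qed

text \<open>The derivative of \<open>c\<^sub>i\<close> in the direction \<open>h\<close>.\<close>

definition lag_coeff_dir :: "nat \<Rightarrow> nat \<Rightarrow> (nat \<Rightarrow> real) \<Rightarrow> (nat \<Rightarrow> real) \<Rightarrow> nat \<Rightarrow> real" where
  "lag_coeff_dir p q u h i = (\<Sum>m<p + q + 1. lag_coeff_grad p q u i m * h m)"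

lemma lag_coeff_dir_0 [simp]: "lag_coeff_dir p q u h 0 = 0"
  by (simp add: lag_coeff_dir_def)

lemma lag_coeff_dir_rec:
  assumes "i > 0"
  shows "lag_coeff_dir p q u h i = (if i \<le> p then h i else 0)
    + (\<Sum>j=1..q. h (p + j) * lag_coeff p q u (i - j) + u (p + j) * lag_coeff_dir p q u h (i - j))"
proof -
  have "lag_coeff_dir p q u h i = (\<Sum>m<p + q + 1. (if m = i then (if i \<le> p then h i else 0) else 0)
     + (\<Sum>j=1..q. (if m = p + j then h (p + j) * lag_coeff p q u (i - j) else 0)
                 + u (p + j) * (lag_coeff_grad p q u (i - j) m * h m)))"
    unfolding lag_coeff_dir_def
  proof (intro sum.cong refl)
    fix m
    show "lag_coeff_grad p q u i m * h m = (if m = i then (if i \<le> p then h i else 0) else 0)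
     + (\<Sum>j=1..q. (if m = p + j then h (p + j) * lag_coeff p q u (i - j) else 0)
                 + u (p + j) * (lag_coeff_grad p q u (i - j) m * h m))"
      unfolding lag_coeff_grad_rec[OF assms] distrib_right sum_distrib_right
      by (intro arg_cong2[where f="(+)"] sum.cong refl) (auto simp: algebra_simps)
  qed
  also have "\<dots> = (if i \<le> p then h i else 0)
    + (\<Sum>j=1..q. (\<Sum>m<p + q + 1. (if m = p + j then h (p + j) * lag_coeff p q u (i - j) else 0))
                 + u (p + j) * lag_coeff_dir p q u h (i - j))"
    unfolding sum.distrib sum.swap[of _ "{1..q}" "{..<p+q+1}"]
    by (auto simp: lag_coeff_dir_def sum.delta sum_distrib_left distrib_left)
  also have "(\<Sum>j=1..q. (\<Sum>m<p + q + 1. (if m = p + j then h (p + j) * lag_coeff p q u (i - j) else 0))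
                 + u (p + j) * lag_coeff_dir p q u h (i - j))
     = (\<Sum>j=1..q. h (p + j) * lag_coeff p q u (i - j) + u (p + j) * lag_coeff_dir p q u h (i - j))"
    by (intro sum.cong refl) (auto simp: sum.delta)
  finally show ?thesis .
qed

text \<open>Euler's relation in disguise: a direction \<open>h\<close> with \<open>\<bar>h\<bar> \<le> e u\<close> changes every monomial of degree \<open>d\<close> at
rate at most \<open>e d\<close> times the monomial, and \<open>d \<le> i\<close>.\<close>

lemma lag_coeff_dir_bound:
  assumes u: "\<And>m. 1 \<le> m \<Longrightarrow> m \<le> p + q \<Longrightarrow> 0 \<le> u m"
    and h: "\<And>m. 1 \<le> m \<Longrightarrow> m \<le> p + q \<Longrightarrow> \<bar>h m\<bar> \<le> e * u m" and e: "0 \<le> e"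
  shows "\<bar>lag_coeff_dir p q u h i\<bar> \<le> e * real i * lag_coeff p q u i"
proof (induction i rule: less_induct)
  case (less i)
  show ?case
  proof (cases "i = 0")
    case False
    have nn: "0 \<le> lag_coeff p q u j" for j
      using u by (rule lag_coeff_nonneg)
    have "\<bar>h (p + j) * lag_coeff p q u (i - j) + u (p + j) * lag_coeff_dir p q u h (i - j)\<bar>
        \<le> e * real i * (u (p + j) * lag_coeff p q u (i - j))" if "j \<in> {1..q}" for j
    proof (cases "j < i")
      case True
      have "\<bar>h (p + j) * lag_coeff p q u (i - j) + u (p + j) * lag_coeff_dir p q u h (i - j)\<bar>
        \<le> \<bar>h (p + j)\<bar> * lag_coeff p q u (i - j) + u (p + j) * \<bar>lag_coeff_dir p q u h (i - j)\<bar>"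
        using that nn[of "i - j"] u[of "p + j"] by (intro order_trans[OF abs_triangle_ineq]) (auto simp: abs_mult)
      also have "\<dots> \<le> (e * u (p + j)) * lag_coeff p q u (i - j)
           + u (p + j) * (e * real (i - j) * lag_coeff p q u (i - j))"
        using that h[of "p + j"] u[of "p + j"] nn[of "i - j"] less[of "i - j"] True
        by (intro add_mono mult_right_mono mult_left_mono) auto
      also have "\<dots> = e * (1 + real (i - j)) * (u (p + j) * lag_coeff p q u (i - j))"
        by (simp add: algebra_simps)
      also have "\<dots> \<le> e * real i * (u (p + j) * lag_coeff p q u (i - j))"
        using that True e nn[of "i - j"] u[of "p + j"] by (intro mult_right_mono mult_left_mono) auto
      finally show ?thesis .
    qed simp
    then have "\<bar>\<Sum>j=1..q. h (p + j) * lag_coeff p q u (i - j) + u (p + j) * lag_coeff_dir p q u h (i - j)\<bar>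
        \<le> (\<Sum>j=1..q. e * real i * (u (p + j) * lag_coeff p q u (i - j)))"
      by (intro order_trans[OF sum_abs] sum_mono)
    moreover have "\<bar>if i \<le> p then h i else 0\<bar> \<le> e * real i * (if i \<le> p then u i else 0)"
    proof (cases "i \<le> p")
      case True
      have "\<bar>h i\<bar> \<le> e * u i" using h[of i] True False by auto
      also have "\<dots> \<le> e * real i * u i"
        using mult_right_mono[of 1 "real i" "e * u i"] u[of i] True False e by (simp add: algebra_simps)
      finally show ?thesis using True by simp
    qed simp
    ultimately show ?thesis
      using False by (subst lag_coeff_dir_rec, simp, subst lag_coeff_rec, simp)
        (auto simp: distrib_left sum_distrib_left intro: order_trans[OF abs_triangle_ineq])
  qed simp
qed

lemma lag_coeff_grad_bound:
  assumes u: "\<And>m. 1 \<le> m \<Longrightarrow> m \<le> p + q \<Longrightarrow> 0 \<le> u m" and m: "m \<le> p + q" "lo \<le> u m" "0 < lo"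
  shows "\<bar>lag_coeff_grad p q u i m\<bar> \<le> 1 / lo * real i * lag_coeff p q u i"
proof -
  define h :: "nat \<Rightarrow> real" where "h = (\<lambda>k. if k = m then 1 else 0)"
  have "lag_coeff_dir p q u h i = lag_coeff_grad p q u i m"
    using m by (simp add: lag_coeff_dir_def h_def if_distrib[of "\<lambda>x. _ * x"] sum.delta cong: if_cong)
  moreover have "\<bar>lag_coeff_dir p q u h i\<bar> \<le> 1 / lo * real i * lag_coeff p q u i"
    using u m by (intro lag_coeff_dir_bound) (auto simp: h_def field_simps)
  ultimately show ?thesis by simp
qed

text \<open>All perturbation bounds are relative to \<open>c\<^sub>i(u)\<close> itself, up to a polynomial in \<open>i\<close> and a factor
\<open>L ^ i\<close> with \<open>L\<close> as close to \<open>1\<close> as desired. After division by \<open>\<sigma>\<^sub>t\<^sup>2\<close> they therefore only involve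
the weights \<open>c\<^sub>i X\<^bsub>t-i\<^esub>\<^sup>2 / \<sigma>\<^sub>t\<^sup>2\<close>.\<close>

lemma lag_coeff_lipschitz:
  assumes u: "\<And>m. 1 \<le> m \<Longrightarrow> m \<le> p + q \<Longrightarrow> 0 \<le> u m"
    and w: "\<And>m. 1 \<le> m \<Longrightarrow> m \<le> p + q \<Longrightarrow> \<bar>w m - u m\<bar> \<le> e * u m"
    and e: "0 \<le> e" "e \<le> 1" "1 + e \<le> L"
  shows "\<bar>lag_coeff p q w i - lag_coeff p q u i\<bar> \<le> e * real i * L ^ i * lag_coeff p q u i"
proof (induction i rule: less_induct)
  case (less i)
  have w2: "0 \<le> w m \<and> w m \<le> L * u m" if "1 \<le> m" "m \<le> p + q" for m
  proof -
    have "e * u m \<le> 1 * u m" using e u[OF that] by (intro mult_right_mono) auto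
    moreover have "(1 + e) * u m \<le> L * u m" using e u[OF that] by (intro mult_right_mono) auto
    ultimately show ?thesis using w[OF that] by (auto simp: algebra_simps abs_le_iff)
  qed
  show ?case
  proof (cases "i = 0")
    case False
    have L1: "1 \<le> L" using e by simp
    have nn: "0 \<le> lag_coeff p q u j" for j
      using u by (rule lag_coeff_nonneg)
    have nnw: "0 \<le> lag_coeff p q w j" for j
      using w2 by (intro lag_coeff_nonneg) auto
    have "\<bar>w (p + j) * lag_coeff p q w (i - j) - u (p + j) * lag_coeff p q u (i - j)\<bar>
        \<le> e * real i * L ^ i * (u (p + j) * lag_coeff p q u (i - j))" if "j \<in> {1..q}" for j
    proof (cases "j < i")
      case True
      have "w (p + j) * lag_coeff p q w (i - j) - u (p + j) * lag_coeff p q u (i - j)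
         = (w (p + j) - u (p + j)) * lag_coeff p q w (i - j)
          + u (p + j) * (lag_coeff p q w (i - j) - lag_coeff p q u (i - j))"
        by (simp add: algebra_simps)
      also have "\<bar>\<dots>\<bar> \<le> \<bar>w (p + j) - u (p + j)\<bar> * lag_coeff p q w (i - j)
          + u (p + j) * \<bar>lag_coeff p q w (i - j) - lag_coeff p q u (i - j)\<bar>"
        using that nnw[of "i - j"] u[of "p + j"] by (intro order_trans[OF abs_triangle_ineq]) (auto simp: abs_mult)
      also have "\<dots> \<le> (e * u (p + j)) * (L ^ (i - j) * lag_coeff p q u (i - j))
           + u (p + j) * (e * real (i - j) * L ^ (i - j) * lag_coeff p q u (i - j))"
        using that w[of "p + j"] u[of "p + j"] nn[of "i - j"] nnw[of "i - j"] less[of "i - j"] True L1 w2 u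
        by (intro add_mono mult_mono mult_left_mono lag_coeff_scaled_le) (auto intro!: mult_nonneg_nonneg e)
      also have "\<dots> = e * (1 + real (i - j)) * L ^ (i - j) * (u (p + j) * lag_coeff p q u (i - j))"
        by (simp add: algebra_simps)
      also have "\<dots> \<le> e * real i * L ^ i * (u (p + j) * lag_coeff p q u (i - j))"
        using that True e nn[of "i - j"] u[of "p + j"] L1
        by (intro mult_right_mono mult_mono power_increasing) (auto intro!: mult_nonneg_nonneg)
      finally show ?thesis .
    qed simp
    then have "\<bar>\<Sum>j=1..q. w (p + j) * lag_coeff p q w (i - j) - u (p + j) * lag_coeff p q u (i - j)\<bar>
        \<le> (\<Sum>j=1..q. e * real i * L ^ i * (u (p + j) * lag_coeff p q u (i - j)))"
      by (intro order_trans[OF sum_abs] sum_mono)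
    moreover have "\<bar>if i \<le> p then w i - u i else 0\<bar> \<le> e * real i * L ^ i * (if i \<le> p then u i else 0)"
    proof (cases "i \<le> p")
      case True
      have "1 * 1 \<le> real i * L ^ i" using False L1 by (intro mult_mono) auto
      then have "1 * (e * u i) \<le> (real i * L ^ i) * (e * u i)" 
        using u[of i] True False e by (intro mult_right_mono) auto
      then show ?thesis using True w[of i] False by (auto simp: algebra_simps)
    qed simp
    moreover have "lag_coeff p q w i - lag_coeff p q u i = (if i \<le> p then w i - u i else 0) +
       (\<Sum>j=1..q. w (p + j) * lag_coeff p q w (i - j) - u (p + j) * lag_coeff p q u (i - j))"
      using False by (subst (1 2) lag_coeff_rec) (auto simp: sum_subtractf)
    moreover have "e * real i * L ^ i * lag_coeff p q u i = e * real i * L ^ i * (if i \<le> p then u i else 0)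
        + (\<Sum>j=1..q. e * real i * L ^ i * (u (p + j) * lag_coeff p q u (i - j)))"
      using False by (subst lag_coeff_rec) (simp_all add: distrib_left sum_distrib_left)
    ultimately show ?thesis
      by linarith
  qed simp
qed

text \<open>The remainder satisfies the recursion of \<open>c\<^sub>i\<close> with the product of two increments as source, which
makes it quadratic in \<open>e\<close>.\<close>

lemma lag_coeff_taylor:
  assumes u: "\<And>m. 1 \<le> m \<Longrightarrow> m \<le> p + q \<Longrightarrow> 0 \<le> u m"
    and w: "\<And>m. 1 \<le> m \<Longrightarrow> m \<le> p + q \<Longrightarrow> \<bar>w m - u m\<bar> \<le> e * u m"
    and e: "0 \<le> e" "e \<le> 1" "1 + e \<le> L"
  shows "\<bar>lag_coeff p q w i - lag_coeff p q u i - lag_coeff_dir p q u (\<lambda>m. w m - u m) i\<bar>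
    \<le> e\<^sup>2 * (real i)\<^sup>2 * L ^ i * lag_coeff p q u i"
proof (induction i rule: less_induct)
  case (less i)
  let ?r = "\<lambda>i. lag_coeff p q w i - lag_coeff p q u i - lag_coeff_dir p q u (\<lambda>m. w m - u m) i"
  show ?case
  proof (cases "i = 0")
    case False
    have L1: "1 \<le> L" using e by simp
    have nn: "0 \<le> lag_coeff p q u j" for j
      using u by (rule lag_coeff_nonneg)
    have "\<bar>(w (p + j) - u (p + j)) * (lag_coeff p q w (i - j) - lag_coeff p q u (i - j)) + u (p + j) * ?r (i - j)\<bar>
        \<le> e\<^sup>2 * (real i)\<^sup>2 * L ^ i * (u (p + j) * lag_coeff p q u (i - j))" if "j \<in> {1..q}" for j
    proof (cases "j < i")
      case True
      define k where "k = i - j"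
      have k: "k < i" using that True by (auto simp: k_def)
      have "\<bar>(w (p + j) - u (p + j)) * (lag_coeff p q w k - lag_coeff p q u k) + u (p + j) * ?r k\<bar>
        \<le> \<bar>w (p + j) - u (p + j)\<bar> * \<bar>lag_coeff p q w k - lag_coeff p q u k\<bar> + u (p + j) * \<bar>?r k\<bar>"
        using that u[of "p + j"] by (intro order_trans[OF abs_triangle_ineq]) (auto simp: abs_mult)
      also have "\<dots> \<le> (e * u (p + j)) * (e * real k * L ^ k * lag_coeff p q u k)
           + u (p + j) * (e\<^sup>2 * (real k)\<^sup>2 * L ^ k * lag_coeff p q u k)"
        using that w[of "p + j"] u[of "p + j"] less[OF k] k e
        by (intro add_mono mult_mono mult_left_mono lag_coeff_lipschitz u w) auto
      also have "\<dots> = e\<^sup>2 * (real k + (real k)\<^sup>2) * L ^ k * (u (p + j) * lag_coeff p q u k)"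
        by (simp add: algebra_simps power2_eq_square)
      also have "\<dots> \<le> e\<^sup>2 * (real i)\<^sup>2 * L ^ i * (u (p + j) * lag_coeff p q u k)"
      proof -
        have "k + k\<^sup>2 \<le> i\<^sup>2"
        proof -
          have "k + k\<^sup>2 = k * Suc k" by (simp add: power2_eq_square)
          also have "\<dots> \<le> i * i" using k by (intro mult_mono) auto
          finally show ?thesis by (simp add: power2_eq_square)
        qed
        then have "real k + (real k)\<^sup>2 \<le> (real i)\<^sup>2"
          by (metis of_nat_add of_nat_le_iff of_nat_power)
        then show ?thesis
          using that k e nn[of k] u[of "p + j"] L1
          by (intro mult_right_mono mult_mono[of "e\<^sup>2 * _" "e\<^sup>2 * _"] mult_left_mono power_increasing)
             (auto intro!: mult_nonneg_nonneg)
      qed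
      finally show ?thesis by (simp add: k_def)
    qed simp
    then have "\<bar>\<Sum>j=1..q. (w (p + j) - u (p + j)) * (lag_coeff p q w (i - j) - lag_coeff p q u (i - j)) + u (p + j) * ?r (i - j)\<bar>
        \<le> (\<Sum>j=1..q. e\<^sup>2 * (real i)\<^sup>2 * L ^ i * (u (p + j) * lag_coeff p q u (i - j)))"
      by (intro order_trans[OF sum_abs] sum_mono)
    also have "\<dots> \<le> e\<^sup>2 * (real i)\<^sup>2 * L ^ i * lag_coeff p q u i"
      using False u[of i] L1 by (subst (2) lag_coeff_rec) (auto simp: sum_distrib_left distrib_left)
    also have "(\<Sum>j=1..q. (w (p + j) - u (p + j)) * (lag_coeff p q w (i - j) - lag_coeff p q u (i - j)) + u (p + j) * ?r (i - j))
      = ?r i"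
    proof -
      have i: "i > 0" using False by simp
      show ?thesis
        unfolding lag_coeff_rec[OF i, of p q w] lag_coeff_rec[OF i, of p q u] lag_coeff_dir_rec[OF i]
        by (simp add: sum_subtractf sum.distrib algebra_simps)
    qed
    finally show ?thesis .
  qed simp
qed

text \<open>The constant term \<open>c\<^sub>0(u) = s\<^sub>0 / (1 - t\<^sub>1 - \<dots> - t\<^sub>q)\<close> is the only coefficient that is not a
  polynomial; it needs the sum of the \<open>t\<^sub>j\<close> to stay away from \<open>1\<close>.\<close>

lemma grad_garch_coeff_0:
  assumes "m \<le> p + q" "(\<Sum>j=1..q. u (p + j)) < 1"
  shows "grad_garch_coeff p q u 0 m =
    (if m = 0 then 1 / (1 - (\<Sum>j=1..q. u (p + j))) else 0)
    + (if m > p then u 0 / (1 - (\<Sum>j=1..q. u (p + j)))\<^sup>2 else 0)"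
proof -
  define b where "b = (\<Sum>j=1..q. u (p + j))"
  define d where "d = (if m > p then 1 else 0 :: real)"
  have sum: "((\<lambda>x. \<Sum>j=1..q. (u(m := x)) (p + j)) has_field_derivative (\<Sum>j=1..q. if m = p + j then 1 else 0)) (at (u m))"
  proof (intro DERIV_sum)
    fix j
    show "((\<lambda>x. (u(m := x)) (p + j)) has_field_derivative (if m = p + j then 1 else 0)) (at (u m))"
      by (cases "m = p + j") (auto intro!: derivative_eq_intros)
  qed
  have "(\<Sum>j=1..q. if m = p + j then 1 else 0 :: real) = (\<Sum>j=1..q. if j = m - p \<and> m > p then 1 else 0)"
    by (intro sum.cong) auto
  also have "\<dots> = d"
    using assms(1) by (auto simp: d_def)
  finally have sumd: "((\<lambda>x. \<Sum>j=1..q. (u(m := x)) (p + j)) has_field_derivative d) (at (u m))"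
    using sum by simp
  have u0: "((\<lambda>x. (u(m := x)) 0) has_field_derivative (if m = 0 then 1 else 0)) (at (u m))"
    by (cases "m = 0") (auto intro!: derivative_eq_intros)
  have b1: "1 - b \<noteq> 0" using assms(2) by (simp add: b_def)
  have "((\<lambda>x. (u(m := x)) 0 / (1 - (\<Sum>j=1..q. (u(m := x)) (p + j)))) has_field_derivative
     ((if m = 0 then 1 else 0) * (1 - b) - u 0 * (0 - d)) / ((1 - b) * (1 - b))) (at (u m))"
    using DERIV_divide[OF u0 DERIV_diff[OF DERIV_const[of 1] sumd]] b1 unfolding fun_upd_triv b_def[symmetric] by blast
  then have "grad_garch_coeff p q u 0 m = ((if m = 0 then 1 else 0) * (1 - b) - u 0 * (0 - d)) / ((1 - b) * (1 - b))"
    unfolding grad_garch_coeff_def garch_coeff_0 by (rule DERIV_imp_deriv)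
  also have "\<dots> = (if m = 0 then 1 / (1 - b) else 0) + (if m > p then u 0 / (1 - b)\<^sup>2 else 0)"
    using b1 by (auto simp: d_def power2_eq_square)
  finally show ?thesis by (simp add: b_def)
qed

lemma garch_coeff_0_dir:
  assumes "(\<Sum>j=1..q. u (p + j)) < 1"
  shows "(\<Sum>m<p + q + 1. grad_garch_coeff p q u 0 m * h m) =
    h 0 / (1 - (\<Sum>j=1..q. u (p + j))) + u 0 * (\<Sum>j=1..q. h (p + j)) / (1 - (\<Sum>j=1..q. u (p + j)))\<^sup>2"
proof -
  define b where "b = (\<Sum>j=1..q. u (p + j))"
  have "(\<Sum>m<p + q + 1. grad_garch_coeff p q u 0 m * h m) =
    (\<Sum>m<p + q + 1. (if m = 0 then h m / (1 - b) else 0) + (if m > p then u 0 * h m / (1 - b)\<^sup>2 else 0))"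
    using assms by (intro sum.cong refl) (auto simp: grad_garch_coeff_0 b_def distrib_right)
  also have "\<dots> = h 0 / (1 - b) + (\<Sum>m<p + q + 1. if m > p then u 0 * h m / (1 - b)\<^sup>2 else 0)"
    by (simp only: sum.distrib) (simp add: sum.delta)
  also have "(\<Sum>m<p + q + 1. if m > p then u 0 * h m / (1 - b)\<^sup>2 else 0)
      = (\<Sum>m\<in>{p+1..p+q}. u 0 * h m / (1 - b)\<^sup>2)"
    by (intro sum.mono_neutral_cong_right) auto
  also have "\<dots> = (\<Sum>j=1..q. u 0 * h (p + j) / (1 - b)\<^sup>2)"
    by (rule sum.reindex_bij_witness[of _ "\<lambda>j. p + j" "\<lambda>m. m - p"]) auto
  also have "\<dots> = u 0 * (\<Sum>j=1..q. h (p + j)) / (1 - b)\<^sup>2"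
    by (simp add: sum_distrib_left sum_divide_distrib)
  finally show ?thesis by (simp add: b_def)
qed

lemma garch_coeff_0_taylor:
  assumes u: "\<And>m. m \<le> p + q \<Longrightarrow> 0 < u m"
    and w: "\<And>m. m \<le> p + q \<Longrightarrow> \<bar>w m - u m\<bar> \<le> e * u m"
    and b: "b = (\<Sum>j=1..q. u (p + j))" "b < 1" and e: "0 \<le> e" "e \<le> (1 - b) / 2"
  shows "\<bar>garch_coeff p q w 0 - garch_coeff p q u 0 - (\<Sum>m<p + q + 1. grad_garch_coeff p q u 0 m * (w m - u m))\<bar>
      \<le> 2 * u 0 / (1 - b) ^ 3 * e\<^sup>2"
    and "\<bar>\<Sum>m<p + q + 1. grad_garch_coeff p q u 0 m * (w m - u m)\<bar> \<le> u 0 / (1 - b)\<^sup>2 * e"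
    and "u 0 / 2 \<le> garch_coeff p q w 0"
proof -
  define b' where "b' = (\<Sum>j=1..q. w (p + j))"
  define c where "c = 1 - b"
  have b0: "0 \<le> b" unfolding b using u by (intro sum_nonneg) (auto intro: less_imp_le)
  have c: "0 < c" "c \<le> 1" "b = 1 - c" using b b0 by (auto simp: c_def)
  have bb: "b' - b = (\<Sum>j=1..q. w (p + j) - u (p + j))" by (simp add: b'_def b sum_subtractf)
  have "\<bar>b' - b\<bar> \<le> (\<Sum>j=1..q. e * u (p + j))"
    unfolding bb using w by (intro order_trans[OF sum_abs] sum_mono) auto
  then have db: "\<bar>b' - b\<bar> \<le> e * b" by (simp add: b sum_distrib_left)
  also have "e * b \<le> c / 2 * 1" using e b b0 by (intro mult_mono) (auto simp: c_def)
  finally have "\<bar>b' - b\<bar> \<le> c / 2" by simp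
  then have "b' - b \<le> c / 2" by (rule abs_le_D1)
  then have c': "c / 2 \<le> 1 - b'" by (simp add: c_def field_simps)
  have b'0: "0 \<le> b'" unfolding b'_def
  proof (intro sum_nonneg)
    fix j assume j: "j \<in> {1..q}"
    have "e * u (p + j) \<le> 1 * u (p + j)" using e u[of "p + j"] b0 j by (intro mult_right_mono) auto
    then show "0 \<le> w (p + j)" using w[of "p + j"] j by auto
  qed
  have dir: "(\<Sum>m<p + q + 1. grad_garch_coeff p q u 0 m * (w m - u m)) = (w 0 - u 0) / c + u 0 * (b' - b) / c\<^sup>2"
    using garch_coeff_0_dir[where u=u and p=p and q=q and h="\<lambda>m. w m - u m"] b(2)
    unfolding b(1)[symmetric] bb[symmetric] c_def by simp
  have w0: "\<bar>w 0 - u 0\<bar> \<le> e * u 0" "0 < u 0" using w u by auto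
  have diff: "garch_coeff p q w 0 - garch_coeff p q u 0 = ((w 0 - u 0) + u 0 * (b' - b) / c) / (1 - b')"
  proof -
    have w: "garch_coeff p q w 0 = w 0 / (1 - b')" by (simp add: garch_coeff_0 b'_def)
    have u: "garch_coeff p q u 0 = u 0 / c" unfolding garch_coeff_0 b(1)[symmetric] c_def ..
    show ?thesis unfolding w u using c c' by (simp add: c(3) field_simps)
  qed
  have num: "\<bar>(w 0 - u 0) + u 0 * (b' - b) / c\<bar> \<le> e * u 0 / c"
  proof -
    have "\<bar>u 0 * (b' - b) / c\<bar> = u 0 * \<bar>b' - b\<bar> / c"
      using w0(2) c(1) by (simp add: abs_mult)
    also have "\<dots> \<le> u 0 * (e * b) / c"
      using w0(2) c(1) db by (intro divide_right_mono mult_left_mono) auto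
    finally have "\<bar>(w 0 - u 0) + u 0 * (b' - b) / c\<bar> \<le> e * u 0 + u 0 * (e * b) / c"
      using w0(1) by linarith
    also have "\<dots> = e * u 0 / c" unfolding c(3) using c(1) by (simp add: field_simps)
    finally show ?thesis .
  qed
  have "garch_coeff p q w 0 - garch_coeff p q u 0 - ((w 0 - u 0) / c + u 0 * (b' - b) / c\<^sup>2)
     = (b' - b) / c * (garch_coeff p q w 0 - garch_coeff p q u 0)"
    unfolding diff using c c' by (simp add: c(3) field_simps power2_eq_square)
  also have "\<bar>\<dots>\<bar> \<le> (e * 1 / c) * ((e * u 0 / c) / (c / 2))"
  proof -
    have "e * b \<le> e * 1" using e b by (intro mult_left_mono) auto
    then have 1: "\<bar>(b' - b) / c\<bar> \<le> e * 1 / c" using db c by (simp add: divide_right_mono)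
    have 2: "\<bar>garch_coeff p q w 0 - garch_coeff p q u 0\<bar> \<le> (e * u 0 / c) / (c / 2)"
      unfolding diff abs_divide using num c c' e w0 by (intro frac_le) auto
    show ?thesis unfolding abs_mult using 1 2 c e by (intro mult_mono) auto
  qed
  also have "\<dots> = 2 * u 0 / (1 - b) ^ 3 * e\<^sup>2"
    by (simp add: c_def power2_eq_square power3_eq_cube mult_ac)
  finally show "\<bar>garch_coeff p q w 0 - garch_coeff p q u 0 - (\<Sum>m<p + q + 1. grad_garch_coeff p q u 0 m * (w m - u m))\<bar>
      \<le> 2 * u 0 / (1 - b) ^ 3 * e\<^sup>2" by (simp only: dir)
  have "(w 0 - u 0) / c + u 0 * (b' - b) / c\<^sup>2 = ((w 0 - u 0) + u 0 * (b' - b) / c) / c"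
    using c by (simp add: field_simps power2_eq_square)
  also have "\<bar>\<dots>\<bar> \<le> (e * u 0 / c) / c"
    using divide_right_mono[OF num, of c] c(1) by (simp add: abs_divide)
  also have "\<dots> = u 0 / (1 - b)\<^sup>2 * e" by (simp add: c_def power2_eq_square)
  finally show "\<bar>\<Sum>m<p + q + 1. grad_garch_coeff p q u 0 m * (w m - u m)\<bar> \<le> u 0 / (1 - b)\<^sup>2 * e"
    by (simp only: dir)
  have "e * u 0 \<le> (1/2) * u 0" using e b0 w0 by (intro mult_right_mono) auto
  then have "u 0 / 2 \<le> w 0" using w0(1) unfolding abs_le_iff by linarith
  also have "w 0 \<le> w 0 / (1 - b')"
    using divide_left_mono[of "1 - b'" 1 "w 0"] b'0 c(1) c' w0(2) \<open>u 0 / 2 \<le> w 0\<close> by simp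
  finally show "u 0 / 2 \<le> garch_coeff p q w 0"
    by (simp add: garch_coeff_0 b'_def)
qed

section \<open>Pathwise decay of the past\<close>

text \<open>Passes from a bound on one term of the volatility equation at time \<open>t - 1\<close> to a bound on the term with
the same random variable at time \<open>t\<close>, where it appears with the next coefficient.\<close>

lemma rescale_le: "a * x \<le> v \<Longrightarrow> 0 < a \<Longrightarrow> 0 < b \<Longrightarrow> b * x \<le> b / a * v" for a b x v :: real
  by (simp add: field_simps)

locale garch_param =
  fixes p q :: nat and \<theta> :: "nat \<Rightarrow> real"
  assumes p1: "1 \<le> p" and q1: "1 \<le> q"
    and theta_pos: "\<And>m. m \<le> p + q \<Longrightarrow> 0 < \<theta> m"
    and beta_lt_1: "(\<Sum>j=1..q. \<theta> (p + j)) < 1"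
begin

text \<open>The part of \<open>v\<^sub>t\<close> that does not involve \<open>X\<^bsub>t-1\<^esub>\<close> is at most \<open>growth * v\<^bsub>t-1\<^esub>\<close>, because each of its terms occurs,
with the preceding coefficient, in the equation for \<open>v\<^bsub>t-1\<^esub>\<close>. All coefficients being positive, these
ratios are finite.\<close>

definition growth :: real where
  "growth = 1 + (\<Sum>i=2..p. \<theta> i / \<theta> (i - 1)) + \<theta> (p + 1) + (\<Sum>j=2..q. \<theta> (p + j) / \<theta> (p + (j - 1)))"

text \<open>An upper bound for the share of the \<open>\<beta>\<close>-terms in \<open>v\<^sub>t\<close> given that \<open>\<epsilon>\<^bsub>t-1\<^esub> = y\<close>.\<close>

definition damping :: "real \<Rightarrow> real" where
  "damping y = growth / (growth + \<theta> 1 * y\<^sup>2)"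

text \<open>The expansion of \<open>v\<^sub>t\<close> jumps back by at most \<open>q\<close> time steps, so it visits every block of \<open>q\<close>
consecutive times, but at an unknown place. The maximum of the \<open>q\<close> damping factors of a block is what it
pays; \<open>1\<close> minus the product of the complements dominates that maximum and has a computable mean.\<close>

definition block_damping :: "(nat \<Rightarrow> real) \<Rightarrow> nat \<Rightarrow> real" where
  "block_damping y b = 1 - (\<Prod>l<q. 1 - damping (y (b * q + l)))"

text \<open>The blocks are disjoint sets of innovations, so the factors are independent. The shift by \<open>p\<close> accounts
for the final step of the expansion, from some \<open>v\<close> to an \<open>X\<close> at most \<open>p\<close> steps earlier.\<close>

definition decay :: "nat \<Rightarrow> (nat \<Rightarrow> real) \<Rightarrow> real" where
  "decay i y = (\<Prod>b<(i - p) div q. block_damping y b)"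

lemma growth_pos: "growth > 0"
proof -
  have "0 \<le> (\<Sum>i=2..p. \<theta> i / \<theta> (i - 1))" 
    using theta_pos by (intro sum_nonneg divide_nonneg_pos) (auto intro: less_imp_le)
  moreover have "0 \<le> (\<Sum>j=2..q. \<theta> (p + j) / \<theta> (p + (j - 1)))"
    using theta_pos by (intro sum_nonneg divide_nonneg_pos) (auto intro!: less_imp_le)
  ultimately show ?thesis using theta_pos[of "p + 1"] q1 by (simp add: growth_def)
qed

lemma damping_bounds: "0 < damping y" "damping y \<le> 1"
proof -
  have "0 \<le> \<theta> 1 * y\<^sup>2" using theta_pos[of 1] p1 by auto
  then show "0 < damping y" "damping y \<le> 1"
    using growth_pos by (auto simp: damping_def field_simps)
qed

lemma block_damping_bounds: "0 \<le> block_damping y b" "block_damping y b \<le> 1"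
proof -
  have "0 \<le> (\<Prod>l<q. 1 - damping (y (b * q + l)))" "(\<Prod>l<q. 1 - damping (y (b * q + l))) \<le> 1"
    using damping_bounds(2) less_imp_le[OF damping_bounds(1)] by (auto intro!: prod_nonneg prod_le_1)
  then show "0 \<le> block_damping y b" "block_damping y b \<le> 1"
    by (auto simp: block_damping_def)
qed

lemma damping_le_block_damping:
  assumes "l < q" shows "damping (y (b * q + l)) \<le> block_damping y b"
proof -
  have "(\<Prod>k<q. 1 - damping (y (b * q + k))) = (1 - damping (y (b * q + l))) * (\<Prod>k\<in>{..<q} - {l}. 1 - damping (y (b * q + k)))"
    using assms by (subst prod.remove[of _ l]) auto
  also have "\<dots> \<le> (1 - damping (y (b * q + l))) * 1"
    using damping_bounds(2) less_imp_le[OF damping_bounds(1)] by (intro mult_left_mono prod_le_1) auto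
  finally show ?thesis by (simp add: block_damping_def)
qed

lemma decay_bounds: "0 \<le> decay i y" "decay i y \<le> 1"
  using block_damping_bounds by (auto simp: decay_def intro!: prod_nonneg prod_le_1)

lemma lag_nonneg: "0 \<le> lag_coeff p q \<theta> i"
  using theta_pos by (intro lag_coeff_nonneg) (auto intro: less_imp_le)

lemma c0_pos: "0 < garch_coeff p q \<theta> 0"
  using theta_pos[of 0] beta_lt_1 by (simp add: garch_coeff_0)

end

text \<open>One realisation of the volatility equation, with \<open>x = X\<^sup>2\<close>, \<open>v = \<sigma>\<^sup>2\<close> and the innovations \<open>e\<close>.\<close>

locale garch_path = garch_param +
  fixes x v e :: "int \<Rightarrow> real"
  assumes v_rec: "\<And>t. v t = \<theta> 0 + (\<Sum>i=1..p. \<theta> i * x (t - int i)) + (\<Sum>j=1..q. \<theta> (p + j) * v (t - int j))"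
    and x_eq: "\<And>t. x t = v t * (e t)\<^sup>2" and v_nonneg: "\<And>t. 0 \<le> v t"
begin

lemma x_nonneg: "0 \<le> x t"
  using v_nonneg[of t] by (simp add: x_eq)

lemma alpha_sum_nonneg: "0 \<le> \<theta> i * x t" if "i \<le> p"
  using that theta_pos[of i] x_nonneg[of t] by auto

lemma beta_nonneg: "0 \<le> \<theta> (p + j) * v t" if "j \<le> q"
  using that theta_pos[of "p + j"] v_nonneg[of t] by auto

lemma v_ge: "\<theta> 0 \<le> v t"
proof -
  have "0 \<le> (\<Sum>i=1..p. \<theta> i * x (t - int i))" "0 \<le> (\<Sum>j=1..q. \<theta> (p + j) * v (t - int j))"
    using alpha_sum_nonneg beta_nonneg by (auto intro!: sum_nonneg)
  then show ?thesis by (subst v_rec) simp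
qed

lemma v_pos: "0 < v t"
  using v_ge[of t] theta_pos[of 0] by simp

lemma alpha_le: "\<theta> i * x (t - int i) \<le> v t" if "1 \<le> i" "i \<le> p"
proof -
  have "\<theta> i * x (t - int i) \<le> (\<Sum>i=1..p. \<theta> i * x (t - int i))"
    using that alpha_sum_nonneg by (intro member_le_sum) auto
  moreover have "0 \<le> (\<Sum>j=1..q. \<theta> (p + j) * v (t - int j))"
    using beta_nonneg by (auto intro!: sum_nonneg)
  ultimately show ?thesis using theta_pos[of 0] by (subst v_rec) simp
qed

lemma beta_le: "\<theta> (p + j) * v (t - int j) \<le> v t" if "1 \<le> j" "j \<le> q"
proof -
  have "\<theta> (p + j) * v (t - int j) \<le> (\<Sum>j=1..q. \<theta> (p + j) * v (t - int j))"
    using that beta_nonneg by (intro member_le_sum) auto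
  moreover have "0 \<le> (\<Sum>i=1..p. \<theta> i * x (t - int i))"
    using alpha_sum_nonneg by (auto intro!: sum_nonneg)
  ultimately show ?thesis using theta_pos[of 0] by (subst v_rec) simp
qed

text \<open>With \<open>y = v\<^sub>t - \<alpha>\<^sub>1 X\<^bsub>t-1\<^esub>\<^sup>2 \<le> growth * v\<^bsub>t-1\<^esub>\<close> and \<open>\<alpha>\<^sub>1 X\<^bsub>t-1\<^esub>\<^sup>2 = k v\<^bsub>t-1\<^esub>\<close>, the share \<open>y / v\<^sub>t\<close> is at
most \<open>growth / (growth + k)\<close>, whatever the level of the volatility. This is the only place where the
innovations reduce the influence of the past.\<close>

lemma beta_sum_le: "(\<Sum>j=1..q. \<theta> (p + j) * v (t - int j)) \<le> damping (e (t - 1)) * v t"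
proof -
  define v' where "v' = v (t - 1)"
  define A where "A = (\<Sum>i=2..p. \<theta> i * x (t - int i))"
  define B where "B = (\<Sum>j=1..q. \<theta> (p + j) * v (t - int j))"
  define y where "y = \<theta> 0 + A + B"
  define k where "k = \<theta> 1 * (e (t - 1))\<^sup>2"
  have k: "0 \<le> k" using theta_pos[of 1] p1 by (simp add: k_def)
  have "(\<Sum>i=1..p. \<theta> i * x (t - int i)) = \<theta> 1 * x (t - 1) + A"
    using p1 unfolding A_def by (subst sum.atLeast_Suc_atMost) (auto simp: numeral_2_eq_2)
  then have vt: "v t = k * v' + y"
    by (subst v_rec) (simp add: y_def B_def x_eq[of "t-1"] k_def v'_def)
  have A: "A \<le> (\<Sum>i=2..p. \<theta> i / \<theta> (i - 1)) * v'"
  proof -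
    have "\<theta> i * x (t - int i) \<le> \<theta> i / \<theta> (i - 1) * v'" if "i \<in> {2..p}" for i
    proof -
      have "\<theta> (i - 1) * x (t - 1 - int (i - 1)) \<le> v'"
        unfolding v'_def using that by (intro alpha_le) auto
      moreover have "t - 1 - int (i - 1) = t - int i" using that by auto
      ultimately have "\<theta> (i - 1) * x (t - int i) \<le> v'" by simp
      then show ?thesis using that theta_pos by (intro rescale_le) auto
    qed
    then show ?thesis unfolding A_def sum_distrib_right by (intro sum_mono)
  qed
  have B: "B \<le> (\<theta> (p + 1) + (\<Sum>j=2..q. \<theta> (p + j) / \<theta> (p + (j - 1)))) * v'"
  proof -
    have "\<theta> (p + j) * v (t - int j) \<le> \<theta> (p + j) / \<theta> (p + (j - 1)) * v'" if "j \<in> {2..q}" for j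
    proof -
      have "\<theta> (p + (j - 1)) * v (t - 1 - int (j - 1)) \<le> v'"
        unfolding v'_def using that by (intro beta_le) auto
      moreover have "t - 1 - int (j - 1) = t - int j" using that by auto
      ultimately have "\<theta> (p + (j - 1)) * v (t - int j) \<le> v'" by simp
      then show ?thesis using that theta_pos by (intro rescale_le) auto
    qed
    then have "(\<Sum>j=2..q. \<theta> (p + j) * v (t - int j)) \<le> (\<Sum>j=2..q. \<theta> (p + j) / \<theta> (p + (j - 1))) * v'"
      unfolding sum_distrib_right by (intro sum_mono)
    moreover have "B = \<theta> (p + 1) * v' + (\<Sum>j=2..q. \<theta> (p + j) * v (t - int j))"
      using q1 unfolding B_def v'_def by (subst sum.atLeast_Suc_atMost) (auto simp: numeral_2_eq_2)
    ultimately show ?thesis by (simp add: distrib_right)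
  qed
  have "y \<le> growth * v'"
    using A B v_ge[of "t - 1"] by (simp add: y_def growth_def v'_def[symmetric] distrib_right)
  then have "k * y \<le> k * (growth * v')" using k by (rule mult_left_mono)
  then have "(growth + k) * y \<le> growth * v t"
    by (simp add: vt algebra_simps)
  then have "y \<le> growth / (growth + k) * v t"
    using growth_pos k by (simp add: field_simps)
  then have "y \<le> damping (e (t - 1)) * v t"
    by (simp only: damping_def k_def)
  moreover have "B \<le> y"
  proof -
    have "0 \<le> A" unfolding A_def using alpha_sum_nonneg by (auto intro!: sum_nonneg)
    then show ?thesis using theta_pos[of 0] by (simp add: y_def)
  qed
  ultimately show ?thesis by (simp add: B_def)
qed

text \<open>A quantity dominated by \<open>v\<close> that propagates through the \<open>\<beta>\<close>-part of the equation loses one factor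
per block. The induction runs backwards from the horizon \<open>N\<close>: a step from position \<open>a\<close> lands in the same
block or in the next one, and the damping at \<open>a\<close> pays for the block of \<open>a\<close>; should the next position lie
in the same block, that block is paid for twice, which only helps.\<close>

lemma block_contraction:
  fixes h :: "nat \<Rightarrow> real"
  assumes le: "\<And>a. h a \<le> v (t - int a)"
    and rec: "\<And>a. a < N \<Longrightarrow> h a \<le> (\<Sum>j=1..q. \<theta> (p + j) * h (a + j))"
  shows "h a \<le> v (t - int a) * (\<Prod>b\<in>{a div q..<N div q}. block_damping (\<lambda>l. e (t - 1 - int l)) b)"
proof (induction "N - a" arbitrary: a rule: less_induct)
  case less
  let ?P = "\<lambda>c. (\<Prod>b\<in>{c..<N div q}. block_damping (\<lambda>l. e (t - 1 - int l)) b)"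
  have P01: "0 \<le> ?P c" for c
    using block_damping_bounds by (auto intro!: prod_nonneg)
  show ?case
  proof (cases "a div q < N div q")
    case True
    then have aN: "a < N" using div_le_mono[of N a q] by (cases "a < N") auto
    have split: "?P (a div q) = block_damping (\<lambda>l. e (t - 1 - int l)) (a div q) * ?P (Suc (a div q))"
      using True by (simp add: prod.atLeast_Suc_lessThan)
    have P_le: "?P (a div q) \<le> ?P (Suc (a div q))"
      unfolding split using P01 block_damping_bounds by (intro mult_left_le_one_le) auto
    have step: "h (a + j) \<le> v (t - int a - int j) * ?P (Suc (a div q))" if j: "j \<in> {1..q}" for j
    proof -
      have "h (a + j) \<le> v (t - int (a + j)) * ?P ((a + j) div q)"
        using j aN by (intro less) auto
      also have "\<dots> \<le> v (t - int (a + j)) * ?P (Suc (a div q))"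
      proof (intro mult_left_mono v_nonneg)
        have "a div q \<le> (a + j) div q" by (simp add: div_le_mono)
        moreover have "(a + j) div q \<le> (a + q) div q" using j by (intro div_le_mono) auto
        moreover have "(a + q) div q = Suc (a div q)" using q1 by simp
        ultimately have "(a + j) div q = a div q \<or> (a + j) div q = Suc (a div q)" by linarith
        then show "?P ((a + j) div q) \<le> ?P (Suc (a div q))" using P_le by auto
      qed
      finally have "h (a + j) \<le> v (t - int (a + j)) * ?P (Suc (a div q))" .
      moreover have "t - int (a + j) = t - int a - int j" by simp
      ultimately show ?thesis by (simp only:)
    qed
    have "h a \<le> (\<Sum>j=1..q. \<theta> (p + j) * h (a + j))" using aN by (rule rec)
    also have "\<dots> \<le> (\<Sum>j=1..q. \<theta> (p + j) * (v (t - int a - int j) * ?P (Suc (a div q))))"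
      using step theta_pos by (intro sum_mono mult_left_mono) (auto intro: less_imp_le)
    also have "\<dots> = (\<Sum>j=1..q. \<theta> (p + j) * v (t - int a - int j)) * ?P (Suc (a div q))"
      by (simp add: sum_distrib_right mult.assoc)
    also have "\<dots> \<le> (damping (e (t - int a - 1)) * v (t - int a)) * ?P (Suc (a div q))"
      by (intro mult_right_mono beta_sum_le P01)
    also have "\<dots> \<le> (block_damping (\<lambda>l. e (t - 1 - int l)) (a div q) * v (t - int a)) * ?P (Suc (a div q))"
    proof (intro mult_right_mono P01 v_nonneg)
      have "damping ((\<lambda>l. e (t - 1 - int l)) (a div q * q + a mod q)) \<le> block_damping (\<lambda>l. e (t - 1 - int l)) (a div q)"
        using q1 by (intro damping_le_block_damping) auto
      then show "damping (e (t - int a - 1)) \<le> block_damping (\<lambda>l. e (t - 1 - int l)) (a div q)"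
        by (simp add: algebra_simps)
    qed
    also have "\<dots> = v (t - int a) * ?P (a div q)" by (simp add: split)
    finally show ?thesis .
  next
    case False
    then show ?thesis using le[of a] by simp
  qed
qed

lemma lag_term_le_v: "lag_coeff p q \<theta> i * x (t - int i) \<le> v t"
proof (induction i arbitrary: t rule: less_induct)
  case (less i)
  show ?case
  proof (cases "i = 0")
    case True
    then show ?thesis using v_nonneg by simp
  next
    case False
    have "(if i \<le> p then \<theta> i else 0) * x (t - int i) \<le> (\<Sum>i=1..p. \<theta> i * x (t - int i))"
    proof (cases "i \<le> p")
      case True
      then show ?thesis using False alpha_sum_nonneg by (auto intro!: member_le_sum[where f="\<lambda>i. \<theta> i * x (t - int i)"])
    qed (use alpha_sum_nonneg in \<open>auto intro!: sum_nonneg\<close>)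
    moreover have "(\<Sum>j=1..q. \<theta> (p + j) * lag_coeff p q \<theta> (i - j)) * x (t - int i) \<le> (\<Sum>j=1..q. \<theta> (p + j) * v (t - int j))"
    proof -
      have "lag_coeff p q \<theta> (i - j) * x (t - int i) \<le> v (t - int j)" if "j \<in> {1..q}" for j
      proof (cases "j < i")
        case True
        then have "t - int j - int (i - j) = t - int i" by auto
        then show ?thesis using less[of "i - j" "t - int j"] that True by auto
      qed (use v_nonneg in auto)
      then have "\<theta> (p + j) * (lag_coeff p q \<theta> (i - j) * x (t - int i)) \<le> \<theta> (p + j) * v (t - int j)" if "j \<in> {1..q}" for j
        using that theta_pos[of "p + j"] by (intro mult_left_mono) auto
      then show ?thesis
        unfolding sum_distrib_right by (intro sum_mono) (simp add: mult.assoc)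
    qed
    ultimately show ?thesis
      using False theta_pos[of 0] by (subst lag_coeff_rec, simp, subst v_rec) (simp add: distrib_right)
  qed
qed

text \<open>The contribution of \<open>X\<^bsub>t-i\<^esub>\<^sup>2\<close> to \<open>v\<^sub>t\<close>, followed along the expansion: seen from time \<open>t - a\<close> it is
\<open>c\<^bsub>i-a\<^esub> X\<^bsub>t-i\<^esub>\<^sup>2\<close>, which as long as \<open>i - a > p\<close> is produced by the \<open>\<beta>\<close>-terms alone.\<close>

lemma lag_term_le: "lag_coeff p q \<theta> i * x (t - int i) \<le> v t * decay i (\<lambda>l. e (t - 1 - int l))"
proof -
  define h where "h = (\<lambda>a. if a < i then lag_coeff p q \<theta> (i - a) * x (t - int i) else 0)"
  have "h 0 \<le> v (t - int 0) * (\<Prod>b\<in>{0 div q..<(i - p) div q}. block_damping (\<lambda>l. e (t - 1 - int l)) b)"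
  proof (rule block_contraction)
    fix a
    show "h a \<le> v (t - int a)"
      using lag_term_le_v[of "i - a" "t - int a"] v_nonneg by (auto simp: h_def of_nat_diff)
    assume a: "a < i - p"
    then show "h a \<le> (\<Sum>j=1..q. \<theta> (p + j) * h (a + j))"
      by (simp add: h_def lag_coeff_rec[of "i - a"] sum_distrib_right)
         (auto intro!: sum_mono simp: mult.assoc)
  qed
  then show ?thesis
    by (cases "i = 0") (auto simp: h_def decay_def atLeast0LessThan)
qed

lemma lag_partial_sum_rec:
  "(\<Sum>i<m. lag_coeff p q \<theta> i * x (t - int i)) =
     (\<Sum>i\<in>{1..p} \<inter> {..<m}. \<theta> i * x (t - int i))
     + (\<Sum>j=1..q. \<theta> (p + j) * (\<Sum>i<m - j. lag_coeff p q \<theta> i * x (t - int j - int i)))"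
proof -
  have "(\<Sum>i<m. lag_coeff p q \<theta> i * x (t - int i)) = (\<Sum>i\<in>{1..<m}. lag_coeff p q \<theta> i * x (t - int i))"
    by (intro sum.mono_neutral_right) (auto simp: not_le)
  also have "\<dots> = (\<Sum>i\<in>{1..<m}. (if i \<le> p then \<theta> i * x (t - int i) else 0)
       + (\<Sum>j=1..q. \<theta> (p + j) * (lag_coeff p q \<theta> (i - j) * x (t - int i))))"
  proof (intro sum.cong refl)
    fix i assume "i \<in> {1..<m}"
    then have i: "i > 0" by simp
    show "lag_coeff p q \<theta> i * x (t - int i) = (if i \<le> p then \<theta> i * x (t - int i) else 0)
       + (\<Sum>j=1..q. \<theta> (p + j) * (lag_coeff p q \<theta> (i - j) * x (t - int i)))"
      unfolding lag_coeff_rec[OF i] by (simp add: distrib_right sum_distrib_right mult.assoc)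
  qed
  also have "\<dots> = (\<Sum>i\<in>{1..<m}. if i \<le> p then \<theta> i * x (t - int i) else 0)
     + (\<Sum>j=1..q. \<theta> (p + j) * (\<Sum>i\<in>{1..<m}. lag_coeff p q \<theta> (i - j) * x (t - int i)))"
    unfolding sum.distrib by (subst sum.swap) (simp add: sum_distrib_left)
  also have "(\<Sum>i\<in>{1..<m}. if i \<le> p then \<theta> i * x (t - int i) else 0) = (\<Sum>i\<in>{1..p} \<inter> {..<m}. \<theta> i * x (t - int i))"
    by (intro sum.mono_neutral_cong_right) auto
  also have "(\<Sum>j=1..q. \<theta> (p + j) * (\<Sum>i\<in>{1..<m}. lag_coeff p q \<theta> (i - j) * x (t - int i)))
      = (\<Sum>j=1..q. \<theta> (p + j) * (\<Sum>i<m - j. lag_coeff p q \<theta> i * x (t - int j - int i)))"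
  proof -
    have "(\<Sum>i\<in>{1..<m}. lag_coeff p q \<theta> (i - j) * x (t - int i)) = (\<Sum>i<m - j. lag_coeff p q \<theta> i * x (t - int j - int i))"
      if j: "j \<in> {1..q}" for j
    proof -
    have "(\<Sum>i\<in>{1..<m}. lag_coeff p q \<theta> (i - j) * x (t - int i)) = (\<Sum>i\<in>{j..<m}. lag_coeff p q \<theta> (i - j) * x (t - int i))"
      using j by (intro sum.mono_neutral_right) auto
    also have "\<dots> = (\<Sum>i<m - j. lag_coeff p q \<theta> i * x (t - int j - int i))"
      by (rule sum.reindex_bij_witness[of _ "\<lambda>i. i + j" "\<lambda>i. i - j"]) (auto simp: of_nat_diff)
    finally show ?thesis .
    qed
    then show ?thesis by (intro sum.cong refl) (simp only:)
  qed
  finally show ?thesis .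
qed

lemma lag_partial_sum_le: "(\<Sum>i<m. lag_coeff p q \<theta> i * x (t - int i)) \<le> v t"
proof (induction m arbitrary: t rule: less_induct)
  case (less m)
  show ?case
  proof (cases "m = 0")
    case True
    then show ?thesis using v_nonneg by simp
  next
    case False
    have "(\<Sum>i\<in>{1..p} \<inter> {..<m}. \<theta> i * x (t - int i)) \<le> (\<Sum>i=1..p. \<theta> i * x (t - int i))"
      using alpha_sum_nonneg by (intro sum_mono2) auto
    moreover have "(\<Sum>j=1..q. \<theta> (p + j) * (\<Sum>i<m - j. lag_coeff p q \<theta> i * x (t - int j - int i)))
        \<le> (\<Sum>j=1..q. \<theta> (p + j) * v (t - int j))"
      using False theta_pos by (intro sum_mono mult_left_mono less) (auto intro: less_imp_le)
    ultimately show ?thesis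
      using theta_pos[of 0] by (subst lag_partial_sum_rec, subst v_rec) simp
  qed
qed

lemma lag_term_nonneg: "0 \<le> lag_coeff p q \<theta> i * x t"
  using lag_nonneg x_nonneg by auto

lemma lag_summable: "summable (\<lambda>i. lag_coeff p q \<theta> i * x (t - int i))"
  by (rule summableI_nonneg_bounded[OF lag_term_nonneg lag_partial_sum_le])

text \<open>The difference \<open>z\<close> between \<open>v\<close> and its expansion solves the homogeneous equation
  \<open>z\<^sub>t = \<beta>\<^sub>1 z\<^bsub>t-1\<^esub> + \<dots> + \<beta>\<^sub>q z\<^bsub>t-q\<^esub>\<close> and is bounded by a multiple of \<open>v\<close>, so the block contraction
  kills it.\<close>

lemma v_expansion:
  assumes lim: "(\<lambda>N. \<Prod>b<N. block_damping (\<lambda>l. e (t - 1 - int l)) b) \<longlonglongrightarrow> 0"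
  shows "v t = garch_coeff p q \<theta> 0 + (\<Sum>i. lag_coeff p q \<theta> i * x (t - int i))"
proof -
  define S where "S = (\<lambda>t. \<Sum>i. lag_coeff p q \<theta> i * x (t - int i))"
  define b where "b = (\<Sum>j=1..q. \<theta> (p + j))"
  define c0 where "c0 = garch_coeff p q \<theta> 0"
  have c0: "c0 * (1 - b) = \<theta> 0" "0 < c0"
    using beta_lt_1 c0_pos by (auto simp: c0_def b_def garch_coeff_0)
  have Sle: "0 \<le> S t" "S t \<le> v t" for t
    unfolding S_def using lag_summable lag_partial_sum_le lag_term_nonneg
    by (auto intro!: suminf_nonneg suminf_le_const)
  have S_rec: "S t = (\<Sum>i=1..p. \<theta> i * x (t - int i)) + (\<Sum>j=1..q. \<theta> (p + j) * S (t - int j))" for t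
  proof (rule LIMSEQ_unique)
    have lim: "(\<lambda>m. \<Sum>i<m. lag_coeff p q \<theta> i * x (t - int i)) \<longlonglongrightarrow> S t" for t
      unfolding S_def by (rule summable_LIMSEQ[OF lag_summable])
    show "(\<lambda>m. \<Sum>i<m + (p + q + 1). lag_coeff p q \<theta> i * x (t - int i)) \<longlonglongrightarrow> S t"
      using LIMSEQ_ignore_initial_segment[OF lim] .
    have "(\<lambda>m. (\<Sum>i=1..p. \<theta> i * x (t - int i))
     + (\<Sum>j=1..q. \<theta> (p + j) * (\<Sum>i<m + (p + q + 1 - j). lag_coeff p q \<theta> i * x (t - int j - int i)))) \<longlonglongrightarrow>
      (\<Sum>i=1..p. \<theta> i * x (t - int i)) + (\<Sum>j=1..q. \<theta> (p + j) * S (t - int j))"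
      by (intro tendsto_intros LIMSEQ_ignore_initial_segment[OF lim])
    also have "(\<lambda>m. (\<Sum>i=1..p. \<theta> i * x (t - int i))
     + (\<Sum>j=1..q. \<theta> (p + j) * (\<Sum>i<m + (p + q + 1 - j). lag_coeff p q \<theta> i * x (t - int j - int i))))
     = (\<lambda>m. \<Sum>i<m + (p + q + 1). lag_coeff p q \<theta> i * x (t - int i))"
    proof
      fix m
      have "{1..p} \<inter> {..<m + (p + q + 1)} = {1..p}" by auto
      then show "(\<Sum>i=1..p. \<theta> i * x (t - int i))
     + (\<Sum>j=1..q. \<theta> (p + j) * (\<Sum>i<m + (p + q + 1 - j). lag_coeff p q \<theta> i * x (t - int j - int i)))
     = (\<Sum>i<m + (p + q + 1). lag_coeff p q \<theta> i * x (t - int i))"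
        unfolding lag_partial_sum_rec[of t "m + (p + q + 1)"] by simp
    qed
    finally show "(\<lambda>m. \<Sum>i<m + (p + q + 1). lag_coeff p q \<theta> i * x (t - int i)) \<longlonglongrightarrow>
      (\<Sum>i=1..p. \<theta> i * x (t - int i)) + (\<Sum>j=1..q. \<theta> (p + j) * S (t - int j))" .
  qed
  define z where "z = (\<lambda>t. v t - c0 - S t)"
  have z_rec: "z t = (\<Sum>j=1..q. \<theta> (p + j) * z (t - int j))" for t
  proof -
    have "(\<Sum>j=1..q. \<theta> (p + j) * z (t - int j)) = (\<Sum>j=1..q. \<theta> (p + j) * v (t - int j)) - c0 * b
       - (\<Sum>j=1..q. \<theta> (p + j) * S (t - int j))"
      by (simp add: z_def b_def algebra_simps sum_subtractf sum.distrib sum_distrib_left)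
    then show ?thesis
      unfolding z_def using c0 by (subst v_rec, subst S_rec) (simp add: algebra_simps)
  qed
  define K where "K = 1 + 1 / (1 - b)"
  have b: "0 \<le> b" "b < 1" using beta_lt_1 less_imp_le[OF theta_pos] by (auto simp: b_def intro!: sum_nonneg)
  then have K: "K > 0" by (simp add: K_def add_pos_nonneg)
  have zK: "\<bar>z t\<bar> \<le> K * v t" for t
  proof -
    have "c0 = \<theta> 0 / (1 - b)" using c0 b by (simp add: field_simps)
    also have "\<dots> \<le> v t / (1 - b)" using v_ge b by (intro divide_right_mono) auto
    finally show ?thesis using Sle[of t] v_nonneg[of t] c0 by (auto simp: z_def K_def distrib_right abs_le_iff)
  qed
  have "\<bar>z t\<bar> / K \<le> v t * (\<Prod>b<N. block_damping (\<lambda>l. e (t - 1 - int l)) b)" for N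
  proof -
    have "(\<lambda>a. \<bar>z (t - int a)\<bar> / K) 0 \<le> v (t - int 0) * (\<Prod>b\<in>{0 div q..<(N * q) div q}. block_damping (\<lambda>l. e (t - 1 - int l)) b)"
    proof (rule block_contraction)
      fix a
      show "\<bar>z (t - int a)\<bar> / K \<le> v (t - int a)" using zK[of "t - int a"] K by (simp add: field_simps)
      have "\<bar>z (t - int a)\<bar> \<le> (\<Sum>j=1..q. \<theta> (p + j) * \<bar>z (t - int (a + j))\<bar>)"
        using theta_pos by (subst z_rec, intro order_trans[OF sum_abs] sum_mono)
          (auto simp: abs_mult algebra_simps abs_of_pos)
      then show "\<bar>z (t - int a)\<bar> / K \<le> (\<Sum>j=1..q. \<theta> (p + j) * (\<bar>z (t - int (a + j))\<bar> / K))"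
        using K by (simp add: sum_divide_distrib[symmetric] divide_right_mono)
    qed
    then show ?thesis using q1 by (simp add: atLeast0LessThan)
  qed
  moreover have "(\<lambda>N. v t * (\<Prod>b<N. block_damping (\<lambda>l. e (t - 1 - int l)) b)) \<longlonglongrightarrow> v t * 0"
    by (intro tendsto_intros lim)
  ultimately have "\<bar>z t\<bar> / K \<le> v t * 0"
    by (intro LIMSEQ_le_const) auto
  then have "z t = 0" using K by (simp add: field_simps)
  then show ?thesis by (simp add: z_def c0_def S_def)
qed

end

section \<open>The innovations and their past\<close>

text \<open>Monotone convergence: a series of nonnegative functions with summable means converges almost everywhere.\<close>

lemma nonneg_series_integrable:
  fixes f :: "nat \<Rightarrow> 'a \<Rightarrow> real"
  assumes int: "\<And>i. integrable M (f i)" and nn: "\<And>i x. 0 \<le> f i x"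
    and sum: "summable (\<lambda>i. \<integral>x. f i x \<partial>M)"
  shows "AE x in M. summable (\<lambda>i. f i x)" "integrable M (\<lambda>x. \<Sum>i. f i x)"
proof -
  have [measurable]: "f i \<in> borel_measurable M" for i using int by auto
  have "(\<integral>\<^sup>+x. (\<Sum>i. ennreal (f i x)) \<partial>M) = (\<Sum>i. \<integral>\<^sup>+x. ennreal (f i x) \<partial>M)"
    by (rule nn_integral_suminf) measurable
  also have "\<dots> = (\<Sum>i. ennreal (\<integral>x. f i x \<partial>M))"
    using int nn by (intro suminf_cong nn_integral_eq_integral) auto
  also have "\<dots> \<noteq> \<infinity>"
    using sum nn by (subst suminf_ennreal2) (auto intro!: integral_nonneg)
  finally have "AE x in M. (\<Sum>i. ennreal (f i x)) \<noteq> \<infinity>"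
    by (intro nn_integral_PInf_AE) auto
  then show ae: "AE x in M. summable (\<lambda>i. f i x)"
    by eventually_elim (use nn in \<open>auto intro: summable_suminf_not_top\<close>)
  show "integrable M (\<lambda>x. \<Sum>i. f i x)"
    using ae nn sum int by (intro integrable_suminf) auto
qed

locale iid_noise = prob_space M for M :: "'a measure" +
  fixes \<epsilon> :: "int \<Rightarrow> 'a \<Rightarrow> real"
  assumes noise_indep: "indep_vars (\<lambda>_. borel) \<epsilon> UNIV"
    and noise_distr: "\<And>t. distr M borel (\<epsilon> t) = distr M borel (\<epsilon> 0)"
begin

lemma noise_measurable [measurable]: "\<epsilon> t \<in> borel_measurable M"
  using noise_indep by (auto simp: indep_vars_def)

definition past :: "int \<Rightarrow> 'a \<Rightarrow> nat \<Rightarrow> real" where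
  "past t \<omega> = (\<lambda>i. \<epsilon> (t - int i) \<omega>)"

lemma past_measurable [measurable]: "past t \<in> measurable M (Pi\<^sub>M UNIV (\<lambda>_. borel))"
  unfolding past_def by (intro measurable_PiM_single') auto

text \<open>Independence is invariant under relabelling; it is obtained from the independence of the restrictions
to singletons.\<close>

lemma noise_reindex_indep:
  assumes "inj_on g J"
  shows "indep_vars (\<lambda>_. borel) (\<lambda>j. \<epsilon> (g j)) J"
proof -
  have "indep_vars (\<lambda>j. Pi\<^sub>M {g j} (\<lambda>_. borel)) (\<lambda>j \<omega>. restrict (\<lambda>i. \<epsilon> i \<omega>) {g j}) J"
    using assms by (intro indep_vars_restrict[OF noise_indep]) (auto simp: disjoint_family_on_def inj_on_def)
  then have "indep_vars (\<lambda>_. borel) (\<lambda>j \<omega>. (\<lambda>f. f (g j)) (restrict (\<lambda>i. \<epsilon> i \<omega>) {g j})) J"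
    by (rule indep_vars_compose2) auto
  then show ?thesis by simp
qed

lemma distr_past: "distr M (Pi\<^sub>M UNIV (\<lambda>_. borel)) (past t) = distr M (Pi\<^sub>M UNIV (\<lambda>_. borel)) (past s)"
proof -
  have "distr M (Pi\<^sub>M UNIV (\<lambda>_. borel)) (past t) = Pi\<^sub>M UNIV (\<lambda>_. distr M borel (\<epsilon> 0))" for t
  proof -
    have "indep_vars (\<lambda>_. borel) (\<lambda>i::nat. \<epsilon> (t - int i)) UNIV"
      by (rule noise_reindex_indep) (auto simp: inj_on_def)
    then have "distr M (Pi\<^sub>M UNIV (\<lambda>_. borel)) (\<lambda>\<omega>. \<lambda>i\<in>UNIV. \<epsilon> (t - int i) \<omega>)
        = Pi\<^sub>M UNIV (\<lambda>i::nat. distr M borel (\<epsilon> (t - int i)))"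
      by (subst (asm) indep_vars_iff_distr_eq_PiM) auto
    also have "\<dots> = Pi\<^sub>M UNIV (\<lambda>_. distr M borel (\<epsilon> 0))"
      by (intro PiM_cong refl noise_distr)
    finally show ?thesis by (simp add: past_def[abs_def] restrict_def)
  qed
  then show ?thesis by simp
qed

lemma integrable_past_shift:
  fixes f :: "(nat \<Rightarrow> real) \<Rightarrow> real"
  assumes [measurable]: "f \<in> borel_measurable (Pi\<^sub>M UNIV (\<lambda>_. borel))"
  shows "integrable M (\<lambda>\<omega>. f (past t \<omega>)) \<longleftrightarrow> integrable M (\<lambda>\<omega>. f (past s \<omega>))"
  using integrable_distr_eq[of "past t" M "Pi\<^sub>M UNIV (\<lambda>_. borel)" f]
    integrable_distr_eq[of "past s" M "Pi\<^sub>M UNIV (\<lambda>_. borel)" f] distr_past[of t s] by simp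

lemma expectation_past_shift:
  fixes f :: "(nat \<Rightarrow> real) \<Rightarrow> real"
  assumes [measurable]: "f \<in> borel_measurable (Pi\<^sub>M UNIV (\<lambda>_. borel))"
  shows "expectation (\<lambda>\<omega>. f (past t \<omega>)) = expectation (\<lambda>\<omega>. f (past s \<omega>))"
  using integral_distr[of "past t" M "Pi\<^sub>M UNIV (\<lambda>_. borel)" f]
    integral_distr[of "past s" M "Pi\<^sub>M UNIV (\<lambda>_. borel)" f] distr_past[of t s] by simp

lemma indep_noise_past:
  fixes f :: "real \<Rightarrow> real" and h :: "(nat \<Rightarrow> real) \<Rightarrow> real"
  assumes [measurable]: "f \<in> borel_measurable borel" "h \<in> borel_measurable (Pi\<^sub>M UNIV (\<lambda>_. borel))"
  shows "indep_var borel (\<lambda>\<omega>. f (\<epsilon> t \<omega>)) borel (\<lambda>\<omega>. h (past (t - 1) \<omega>))"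
proof -
  have 1: "indep_var (Pi\<^sub>M {t} (\<lambda>_. borel)) (\<lambda>\<omega>. restrict (\<lambda>i. \<epsilon> i \<omega>) {t})
          (Pi\<^sub>M {..<t} (\<lambda>_. borel)) (\<lambda>\<omega>. restrict (\<lambda>i. \<epsilon> i \<omega>) {..<t})"
    by (rule indep_var_restrict[OF noise_indep]) auto
  have 2: "(\<lambda>f i. f (t - 1 - int i)) \<in> measurable (Pi\<^sub>M {..<t} (\<lambda>_. borel)) (Pi\<^sub>M UNIV (\<lambda>_. borel))"
    by (intro measurable_PiM_single') auto
  have 3: "(\<lambda>g. h (\<lambda>i. g (t - 1 - int i))) \<in> borel_measurable (Pi\<^sub>M {..<t} (\<lambda>_. borel))"
    using measurable_compose[OF 2 assms(2)] by simp
  have 4: "(\<lambda>g. f (g t)) \<in> borel_measurable (Pi\<^sub>M {t} (\<lambda>_. borel))"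
    by measurable
  show ?thesis
    using indep_var_compose[OF 1 4 3] by (simp add: comp_def past_def)
qed

lemma noise_past_product:
  fixes f :: "real \<Rightarrow> real" and h :: "(nat \<Rightarrow> real) \<Rightarrow> real"
  assumes [measurable]: "f \<in> borel_measurable borel" "h \<in> borel_measurable (Pi\<^sub>M UNIV (\<lambda>_. borel))"
    and int: "integrable M (\<lambda>\<omega>. f (\<epsilon> 0 \<omega>))" "integrable M (\<lambda>\<omega>. h (past s \<omega>))"
  shows "integrable M (\<lambda>\<omega>. f (\<epsilon> t \<omega>) * h (past (t - 1) \<omega>))"
    and "expectation (\<lambda>\<omega>. f (\<epsilon> t \<omega>) * h (past (t - 1) \<omega>)) =
      expectation (\<lambda>\<omega>. f (\<epsilon> 0 \<omega>)) * expectation (\<lambda>\<omega>. h (past s \<omega>))"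
proof -
  have ind: "indep_var borel (\<lambda>\<omega>. f (\<epsilon> t \<omega>)) borel (\<lambda>\<omega>. h (past (t - 1) \<omega>))"
    by (rule indep_noise_past) measurable
  have e: "expectation (\<lambda>\<omega>. f (\<epsilon> t \<omega>)) = expectation (\<lambda>\<omega>. f (\<epsilon> 0 \<omega>))"
    using integral_distr[of "\<epsilon> t" M borel f] integral_distr[of "\<epsilon> 0" M borel f] noise_distr[of t] by simp
  have i1: "integrable M (\<lambda>\<omega>. f (\<epsilon> t \<omega>))"
    using integrable_distr_eq[of "\<epsilon> t" M borel f] integrable_distr_eq[of "\<epsilon> 0" M borel f] noise_distr[of t] int by simp
  have i2: "integrable M (\<lambda>\<omega>. h (past (t - 1) \<omega>))"
    using int(2) integrable_past_shift[of h s "t - 1"] by simp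
  show "integrable M (\<lambda>\<omega>. f (\<epsilon> t \<omega>) * h (past (t - 1) \<omega>))"
    by (rule indep_var_integrable[OF ind i1 i2])
  show "expectation (\<lambda>\<omega>. f (\<epsilon> t \<omega>) * h (past (t - 1) \<omega>)) =
      expectation (\<lambda>\<omega>. f (\<epsilon> 0 \<omega>)) * expectation (\<lambda>\<omega>. h (past s \<omega>))"
    using indep_var_lebesgue_integral[OF ind i1 i2] e expectation_past_shift[of h "t - 1" s] by simp
qed

end

section \<open>An integrable envelope\<close>

context garch_param
begin

lemma damping_measurable [measurable]: "damping \<in> borel_measurable borel"
  unfolding damping_def by measurable

lemma block_damping_measurable [measurable]:
  "(\<lambda>y. block_damping y b) \<in> borel_measurable (Pi\<^sub>M UNIV (\<lambda>_. borel))"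
  unfolding block_damping_def by measurable

lemma decay_measurable [measurable]: "decay i \<in> borel_measurable (Pi\<^sub>M UNIV (\<lambda>_. borel))"
  unfolding decay_def by measurable

text \<open>The number \<open>12 = 3 * 4\<close>: the cube root of the envelope has to beat the decay factors by a factor
\<open>\<mu> ^ (4 * i)\<close>. The cube makes the maximum over \<open>n\<close> observations \<open>o(sqrt n)\<close> although only the mean of the
envelope is known to be finite. The four powers of \<open>\<mu>\<close> are spent on polynomial weights, on the perturbation
of the parameter, on the truncation of the series at the start of the sample, and on summability.\<close>

definition envelope :: "real \<Rightarrow> (nat \<Rightarrow> real) \<Rightarrow> real" where
  "envelope \<mu> y = (\<Sum>i. \<mu> ^ (12 * i) * decay i y)"

lemma envelope_measurable [measurable]: "envelope \<mu> \<in> borel_measurable (Pi\<^sub>M UNIV (\<lambda>_. borel))"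
  unfolding envelope_def by measurable

end

locale garch_noise = garch_param + iid_noise +
  assumes noise_sq_integrable: "integrable M (\<lambda>\<omega>. (\<epsilon> 0 \<omega>)\<^sup>2)"
    and noise_variance: "expectation (\<lambda>\<omega>. (\<epsilon> 0 \<omega>)\<^sup>2) = 1"
begin

definition damping_mean :: real where
  "damping_mean = expectation (\<lambda>\<omega>. damping (\<epsilon> 0 \<omega>))"

lemma damping_integrable: "integrable M (\<lambda>\<omega>. damping (\<epsilon> t \<omega>))"
  using damping_bounds by (intro integrable_const_bound[where B=1]) (auto intro!: AE_I2 simp: abs_of_pos)

lemma damping_expectation: "expectation (\<lambda>\<omega>. damping (\<epsilon> t \<omega>)) = damping_mean"
  unfolding damping_mean_def
  using integral_distr[of "\<epsilon> t" M borel damping] integral_distr[of "\<epsilon> 0" M borel damping] noise_distr[of t] by simp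

text \<open>The damping factor is strictly below \<open>1\<close> unless the innovation vanishes, and it is not
almost surely \<open>0\<close> since its second moment is \<open>1\<close>.\<close>

lemma damping_mean_bounds: "0 \<le> damping_mean" "damping_mean < 1"
proof -
  show "0 \<le> damping_mean" unfolding damping_mean_def
    using less_imp_le[OF damping_bounds(1)] by (auto intro!: integral_nonneg)
  have int: "integrable M (\<lambda>\<omega>. 1 - damping (\<epsilon> 0 \<omega>))" using damping_integrable by auto
  have eq: "expectation (\<lambda>\<omega>. 1 - damping (\<epsilon> 0 \<omega>)) = 1 - damping_mean"
    using damping_integrable by (simp add: damping_mean_def prob_space)
  have "0 \<le> expectation (\<lambda>\<omega>. 1 - damping (\<epsilon> 0 \<omega>))"
    using damping_bounds by (auto intro!: integral_nonneg)
  moreover have "expectation (\<lambda>\<omega>. 1 - damping (\<epsilon> 0 \<omega>)) \<noteq> 0"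
  proof
    assume "expectation (\<lambda>\<omega>. 1 - damping (\<epsilon> 0 \<omega>)) = 0"
    then have "AE \<omega> in M. 1 - damping (\<epsilon> 0 \<omega>) = 0"
      using damping_bounds int by (subst (asm) integral_nonneg_eq_0_iff_AE) auto
    then have "AE \<omega> in M. (\<epsilon> 0 \<omega>)\<^sup>2 = 0"
    proof eventually_elim
      case (elim \<omega>)
      have "0 \<le> \<theta> 1 * (\<epsilon> 0 \<omega>)\<^sup>2" using theta_pos[of 1] p1 by auto
      then show ?case
        using elim growth_pos theta_pos[of 1] p1 by (auto simp: damping_def)
    qed
    then have "expectation (\<lambda>\<omega>. (\<epsilon> 0 \<omega>)\<^sup>2) = expectation (\<lambda>\<omega>. 0)"
      by (intro integral_cong_AE) auto
    then show False using noise_variance by simp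
  qed
  ultimately show "damping_mean < 1" unfolding eq by linarith
qed

definition rate :: real where "rate = 1 - (1 - damping_mean) ^ q"

lemma rate_bounds: "0 \<le> rate" "rate < 1"
  using damping_mean_bounds by (auto simp: rate_def power_le_one)

lemma block_damping_expectation: "expectation (\<lambda>\<omega>. block_damping (past t \<omega>) b) = rate"
proof -
  have ind: "indep_vars (\<lambda>_. borel) (\<lambda>l \<omega>. 1 - damping (\<epsilon> (t - int (b * q + l)) \<omega>)) {..<q}"
    using indep_vars_compose2[where Y="\<lambda>_ y. 1 - damping y" and N="\<lambda>_. borel",
        OF noise_reindex_indep[of "\<lambda>l. t - int (b * q + l)" "{..<q}"]]
    by (auto simp: inj_on_def)
  have int: "integrable M (\<lambda>\<omega>. 1 - damping (\<epsilon> (t - int (b * q + l)) \<omega>))" for l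
    using damping_integrable by auto
  have "expectation (\<lambda>\<omega>. \<Prod>l<q. 1 - damping (\<epsilon> (t - int (b * q + l)) \<omega>))
     = (\<Prod>l<q. expectation (\<lambda>\<omega>. 1 - damping (\<epsilon> (t - int (b * q + l)) \<omega>)))"
    by (rule indep_vars_lebesgue_integral[OF _ ind int]) auto
  also have "\<dots> = (1 - damping_mean) ^ q"
    using damping_integrable by (simp add: damping_expectation prob_space)
  finally show ?thesis
    using indep_vars_integrable[OF _ ind int]
    by (simp add: block_damping_def past_def rate_def prob_space)
qed

lemma decay_expectation: "expectation (\<lambda>\<omega>. decay i (past t \<omega>)) = rate ^ ((i - p) div q)"
proof -
  define K where "K = (\<lambda>b. (\<lambda>l. t - int (b * q + l)) ` {..<q})"
  define Y where "Y = (\<lambda>b (f :: int \<Rightarrow> real). 1 - (\<Prod>l<q. 1 - damping (f (t - int (b * q + l)))))"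
  define B where "B = {..<(i - p) div q}"
  have "b = b'" if "l < q" "l' < q" "t - int (b * q + l) = t - int (b' * q + l')" for b b' l l'
  proof -
    have "b * q + l = b' * q + l'" using that(3) by linarith
    then have "(b * q + l) div q = (b' * q + l') div q" by simp
    then show ?thesis using that by simp
  qed
  then have "disjoint_family_on K B"
    unfolding disjoint_family_on_def K_def by blast
  then have ind: "indep_vars (\<lambda>b. Pi\<^sub>M (K b) (\<lambda>_. borel)) (\<lambda>b \<omega>. restrict (\<lambda>i. \<epsilon> i \<omega>) (K b)) B"
    by (intro indep_vars_restrict[OF noise_indep]) auto
  have "indep_vars (\<lambda>_. borel) (\<lambda>b \<omega>. Y b (restrict (\<lambda>i. \<epsilon> i \<omega>) (K b))) B"
  proof (rule indep_vars_compose2[where Y=Y and N="\<lambda>_. borel", OF ind])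
    fix b assume "b \<in> B"
    have comp: "(\<lambda>f. damping (f (t - int (b * q + l)))) \<in> borel_measurable (Pi\<^sub>M (K b) (\<lambda>_. borel))" if "l < q" for l
    proof -
      have "(\<lambda>f. f (t - int (b * q + l))) \<in> borel_measurable (Pi\<^sub>M (K b) (\<lambda>_. borel))"
        using that by (intro measurable_component_singleton) (auto simp: K_def)
      then show ?thesis by (rule measurable_compose) (rule damping_measurable)
    qed
    show "Y b \<in> borel_measurable (Pi\<^sub>M (K b) (\<lambda>_. borel))"
      unfolding Y_def by (intro borel_measurable_diff borel_measurable_const borel_measurable_prod comp) auto
  qed
  moreover have "Y b (restrict (\<lambda>i. \<epsilon> i \<omega>) (K b)) = block_damping (past t \<omega>) b" for b \<omega>
    unfolding Y_def block_damping_def past_def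
    by (intro arg_cong2[where f="(-)"] refl prod.cong) (auto simp: K_def)
  ultimately have ind: "indep_vars (\<lambda>_. borel) (\<lambda>b \<omega>. block_damping (past t \<omega>) b) B"
    by simp
  have "expectation (\<lambda>\<omega>. \<Prod>b\<in>B. block_damping (past t \<omega>) b) = (\<Prod>b\<in>B. expectation (\<lambda>\<omega>. block_damping (past t \<omega>) b))"
    using block_damping_bounds
    by (intro indep_vars_lebesgue_integral ind) (auto simp: B_def intro!: integrable_const_bound[where B=1])
  then show ?thesis by (simp add: decay_def B_def block_damping_expectation)
qed

lemma decay_integrable: "integrable M (\<lambda>\<omega>. decay i (past t \<omega>))"
  using decay_bounds by (intro integrable_const_bound[where B=1]) (auto intro!: AE_I2)

text \<open>The means of the decay factors decrease geometrically, so a sufficiently small \<open>\<mu> > 1\<close> keeps the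
weighted series of means summable.\<close>

lemma envelope_exists:
  "\<exists>\<mu>>1. (\<forall>t. AE \<omega> in M. summable (\<lambda>i. \<mu> ^ (12 * i) * decay i (past t \<omega>)))
     \<and> (\<forall>t. integrable M (\<lambda>\<omega>. envelope \<mu> (past t \<omega>)))"
proof -
  define r where "r = (1 + rate) / 2"
  have r: "0 < r" "r < 1" "rate \<le> r" using rate_bounds by (auto simp: r_def)
  define \<rho> where "\<rho> = root q r"
  have q0: "0 < q" using q1 by simp
  have \<rho>: "0 < \<rho>" "\<rho> < 1" "\<rho> ^ q = r"
    using r q0 by (auto simp: \<rho>_def)
  have "1 < root 12 (1 / \<rho>)" using \<rho> by simp
  then obtain \<mu> where \<mu>: "1 < \<mu>" "\<mu> < root 12 (1 / \<rho>)" using dense by blast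
  have "\<mu> ^ 12 < root 12 (1 / \<rho>) ^ 12" using \<mu> by (intro power_strict_mono) auto
  also have "\<dots> = 1 / \<rho>" using \<rho> by (intro real_root_pow_pos2) auto
  finally have \<mu>\<rho>: "\<mu> ^ 12 * \<rho> < 1" using \<rho> by (simp add: field_simps)
  have bound: "rate ^ ((i - p) div q) \<le> \<rho> ^ i / \<rho> ^ (p + q)" for i
  proof -
    have "i - p < q + q * ((i - p) div q)" using q0 by (rule dividend_less_times_div)
    then have "i \<le> q * ((i - p) div q) + (p + q)" by simp
    then have "\<rho> ^ (q * ((i - p) div q) + (p + q)) \<le> \<rho> ^ i" using \<rho> by (intro power_decreasing) auto
    moreover have "\<rho> ^ (q * ((i - p) div q)) = r ^ ((i - p) div q)" by (simp add: power_mult \<rho>)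
    moreover have "rate ^ ((i - p) div q) \<le> r ^ ((i - p) div q)" using r rate_bounds by (intro power_mono) auto
    ultimately have "rate ^ ((i - p) div q) * \<rho> ^ (p + q) \<le> \<rho> ^ i"
      using \<rho> by (auto simp: power_add intro: order_trans[OF mult_right_mono])
    then show ?thesis using \<rho> by (simp add: pos_le_divide_eq)
  qed
  have summ: "summable (\<lambda>i. expectation (\<lambda>\<omega>. \<mu> ^ (12 * i) * decay i (past t \<omega>)))" for t
  proof (rule summable_comparison_test')
    show "summable (\<lambda>i. (\<mu> ^ 12 * \<rho>) ^ i * (1 / \<rho> ^ (p + q)))"
      using \<mu>\<rho> \<mu> \<rho> by (intro summable_mult2 summable_geometric) auto
    fix i :: nat
    have "\<mu> ^ (12 * i) * rate ^ ((i - p) div q) \<le> \<mu> ^ (12 * i) * (\<rho> ^ i / \<rho> ^ (p + q))"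
      using bound \<mu> by (intro mult_left_mono) auto
    then show "norm (expectation (\<lambda>\<omega>. \<mu> ^ (12 * i) * decay i (past t \<omega>))) \<le> (\<mu> ^ 12 * \<rho>) ^ i * (1 / \<rho> ^ (p + q))"
      using \<mu> rate_bounds by (simp add: decay_expectation power_mult_distrib power_mult abs_mult)
  qed
  have nn: "0 \<le> \<mu> ^ (12 * i) * decay i y" for i y using \<mu> decay_bounds by auto
  have int: "integrable M (\<lambda>\<omega>. \<mu> ^ (12 * i) * decay i (past t \<omega>))" for i t
    using decay_integrable by auto
  show ?thesis
    using \<mu>(1) nonneg_series_integrable[OF int nn summ] unfolding envelope_def by blast
qed

end

text \<open>The cube root of the envelope dominates geometrically weighted decay factors; its third
  moment is the mean of the envelope.\<close>

lemma (in garch_param) decay_le_envelope: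
  assumes \<mu>: "1 < \<mu>" and s: "summable (\<lambda>i. \<mu> ^ (12 * i) * decay i y)"
  shows "1 \<le> envelope \<mu> y" "\<mu> ^ (4 * i) * decay i y \<le> root 3 (envelope \<mu> y)"
    "(\<lambda>N. \<Prod>b<N. block_damping y b) \<longlonglongrightarrow> 0"
proof -
  have nn: "0 \<le> \<mu> ^ (12 * i) * decay i y" for i using \<mu> decay_bounds by auto
  have le: "\<mu> ^ (12 * i) * decay i y \<le> envelope \<mu> y" for i
    unfolding envelope_def using sum_le_suminf[OF s, of "{i}"] nn by auto
  show "1 \<le> envelope \<mu> y" using le[of 0] by (simp add: decay_def)
  have "(\<mu> ^ (4 * i) * decay i y) ^ 3 = \<mu> ^ (12 * i) * decay i y ^ 3"
    by (simp add: power_mult_distrib power_mult[symmetric])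
  also have "\<dots> \<le> \<mu> ^ (12 * i) * decay i y"
    using \<mu> decay_bounds[of i y] power_decreasing[of 1 3 "decay i y"] by (intro mult_left_mono) auto
  also note le
  finally have "root 3 ((\<mu> ^ (4 * i) * decay i y) ^ 3) \<le> root 3 (envelope \<mu> y)" by simp
  then show "\<mu> ^ (4 * i) * decay i y \<le> root 3 (envelope \<mu> y)"
    by (simp add: odd_real_root_power_cancel)
  have "(\<lambda>i. decay i y) \<longlonglongrightarrow> 0"
  proof (rule tendsto_sandwich[OF _ _ tendsto_const summable_LIMSEQ_zero[OF s]])
    show "\<forall>\<^sub>F i in sequentially. 0 \<le> decay i y" using decay_bounds by auto
    show "\<forall>\<^sub>F i in sequentially. decay i y \<le> \<mu> ^ (12 * i) * decay i y"
    proof (intro always_eventually allI)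
      fix i
      have "1 * decay i y \<le> \<mu> ^ (12 * i) * decay i y"
        using \<mu> decay_bounds by (intro mult_right_mono one_le_power) auto
      then show "decay i y \<le> \<mu> ^ (12 * i) * decay i y" by simp
    qed
  qed
  then have "((\<lambda>i. decay i y) \<circ> (\<lambda>N. p + N * q)) \<longlonglongrightarrow> 0"
    using q1 by (intro LIMSEQ_subseq_LIMSEQ) (auto simp: strict_mono_def)
  then show "(\<lambda>N. \<Prod>b<N. block_damping y b) \<longlonglongrightarrow> 0"
    using q1 by (simp add: comp_def decay_def)
qed

section \<open>A uniform law of large numbers\<close>

text \<open>Replacing all coordinates from \<open>m\<close> on by \<open>0\<close>; invariance under this map expresses that a function depends
on the first \<open>m\<close> coordinates only.\<close>

definition truncate_seq :: "nat \<Rightarrow> (nat \<Rightarrow> real) \<Rightarrow> nat \<Rightarrow> real" where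
  "truncate_seq m y = (\<lambda>i. if i < m then y i else 0)"

definition finite_window_approx :: "(nat \<Rightarrow> real) measure \<Rightarrow> ((nat \<Rightarrow> real) \<Rightarrow> real) \<Rightarrow> bool" where
  "finite_window_approx Q f \<longleftrightarrow> (\<forall>\<delta>>0. \<exists>m h C. h \<in> borel_measurable Q \<and> (\<forall>y. \<bar>h y\<bar> \<le> C)
     \<and> (\<forall>y. h (truncate_seq m y) = h y) \<and> (\<integral>y. \<bar>f y - h y\<bar> \<partial>Q) < \<delta>)"

lemma truncate_seq_truncate: "truncate_seq m (truncate_seq n y) = truncate_seq (min m n) y"
  by (auto simp: truncate_seq_def)

context prob_space
begin

lemma bounded_integrable:
  assumes "h \<in> borel_measurable M" "\<And>y. \<bar>h y\<bar> \<le> (C :: real)"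
  shows "integrable M h"
  using assms by (intro integrable_const_bound[where B=C]) auto

end

lemma window_dependence_mono:
  assumes "\<And>y. h (truncate_seq m y) = h y" "m \<le> n"
  shows "h (truncate_seq n y) = h y"
proof -
  have "h (truncate_seq n y) = h (truncate_seq m (truncate_seq n y))" using assms(1) by simp
  also have "\<dots> = h y" using assms by (simp add: truncate_seq_truncate min_def)
  finally show ?thesis .
qed

lemma finite_window_approx_limit:
  assumes "prob_space Q" "integrable Q f"
    and "\<And>\<delta>. \<delta> > 0 \<Longrightarrow> \<exists>g. integrable Q g \<and> finite_window_approx Q g \<and> (\<integral>y. \<bar>f y - g y\<bar> \<partial>Q) < \<delta>"
  shows "finite_window_approx Q f"
  unfolding finite_window_approx_def
proof (intro allI impI)
  interpret prob_space Q by fact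
  fix \<delta> :: real assume "\<delta> > 0"
  then obtain g where g: "integrable Q g" "finite_window_approx Q g" "(\<integral>y. \<bar>f y - g y\<bar> \<partial>Q) < \<delta> / 2"
    using assms(3)[of "\<delta> / 2"] by auto
  then obtain m h C where h: "h \<in> borel_measurable Q" "\<And>y. \<bar>h y\<bar> \<le> C" "\<And>y. h (truncate_seq m y) = h y"
    "(\<integral>y. \<bar>g y - h y\<bar> \<partial>Q) < \<delta> / 2"
    using \<open>\<delta> > 0\<close> unfolding finite_window_approx_def by (meson half_gt_zero)
  have ih: "integrable Q h" using h by (intro bounded_integrable)
  have "(\<integral>y. \<bar>f y - h y\<bar> \<partial>Q) \<le> (\<integral>y. \<bar>f y - g y\<bar> + \<bar>g y - h y\<bar> \<partial>Q)"
    using assms(2) g(1) ih by (intro integral_mono) auto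
  also have "\<dots> = (\<integral>y. \<bar>f y - g y\<bar> \<partial>Q) + (\<integral>y. \<bar>g y - h y\<bar> \<partial>Q)"
    using assms(2) g(1) ih by (intro Bochner_Integration.integral_add) auto
  also have "\<dots> < \<delta>" using g h by simp
  finally show "\<exists>m h C. h \<in> borel_measurable Q \<and> (\<forall>y. \<bar>h y\<bar> \<le> C)
     \<and> (\<forall>y. h (truncate_seq m y) = h y) \<and> (\<integral>y. \<bar>f y - h y\<bar> \<partial>Q) < \<delta>"
    using h by blast
qed

lemma finite_window_approx_add:
  assumes "prob_space Q" "integrable Q f" "integrable Q g" "finite_window_approx Q f" "finite_window_approx Q g"
  shows "finite_window_approx Q (\<lambda>y. f y + g y)"
  unfolding finite_window_approx_def
proof (intro allI impI)
  interpret prob_space Q by fact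
  fix \<delta> :: real assume \<delta>: "\<delta> > 0"
  obtain m h C where h: "h \<in> borel_measurable Q" "\<And>y. \<bar>h y\<bar> \<le> C" "\<And>y. h (truncate_seq m y) = h y"
    "(\<integral>y. \<bar>f y - h y\<bar> \<partial>Q) < \<delta> / 2"
    using assms(4) \<delta> unfolding finite_window_approx_def by (meson half_gt_zero)
  obtain m' h' C' where h': "h' \<in> borel_measurable Q" "\<And>y. \<bar>h' y\<bar> \<le> C'" "\<And>y. h' (truncate_seq m' y) = h' y"
    "(\<integral>y. \<bar>g y - h' y\<bar> \<partial>Q) < \<delta> / 2"
    using assms(5) \<delta> unfolding finite_window_approx_def by (meson half_gt_zero)
  have ih: "integrable Q h" "integrable Q h'" using h h' by (auto intro: bounded_integrable)
  have "(\<integral>y. \<bar>(f y + g y) - (h y + h' y)\<bar> \<partial>Q) \<le> (\<integral>y. \<bar>f y - h y\<bar> + \<bar>g y - h' y\<bar> \<partial>Q)"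
    using assms(2,3) ih by (intro integral_mono) auto
  also have "\<dots> = (\<integral>y. \<bar>f y - h y\<bar> \<partial>Q) + (\<integral>y. \<bar>g y - h' y\<bar> \<partial>Q)"
    using assms(2,3) ih by (intro Bochner_Integration.integral_add) auto
  also have "\<dots> < \<delta>" using h h' by simp
  finally have "(\<integral>y. \<bar>(f y + g y) - (h y + h' y)\<bar> \<partial>Q) < \<delta>" .
  moreover have "(\<lambda>y. h y + h' y) \<in> borel_measurable Q" using h h' by auto
  moreover have "\<bar>h y + h' y\<bar> \<le> C + C'" for y using h(2)[of y] h'(2)[of y] by linarith
  moreover have "h (truncate_seq (max m m') y) + h' (truncate_seq (max m m') y) = h y + h' y" for y
    using window_dependence_mono[of h m "max m m'" y] window_dependence_mono[of h' m' "max m m'" y] h h' by simp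
  ultimately show "\<exists>m h C. h \<in> borel_measurable Q \<and> (\<forall>y. \<bar>h y\<bar> \<le> C)
     \<and> (\<forall>y. h (truncate_seq m y) = h y) \<and> (\<integral>y. \<bar>f y + g y - h y\<bar> \<partial>Q) < \<delta>"
    by (intro exI[of _ "max m m'"] exI[of _ "\<lambda>y. h y + h' y"] exI[of _ "C + C'"]) auto
qed

lemma finite_window_approx_scale:
  assumes "finite_window_approx Q f"
  shows "finite_window_approx Q (\<lambda>y. c * f y)"
  unfolding finite_window_approx_def
proof (intro allI impI)
  fix \<delta> :: real assume \<delta>: "\<delta> > 0"
  then have "\<delta> / (\<bar>c\<bar> + 1) > 0" by simp
  then obtain m h C where h: "h \<in> borel_measurable Q" "\<And>y. \<bar>h y\<bar> \<le> C" "\<And>y. h (truncate_seq m y) = h y"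
    "(\<integral>y. \<bar>f y - h y\<bar> \<partial>Q) < \<delta> / (\<bar>c\<bar> + 1)"
    using assms unfolding finite_window_approx_def by blast
  have "(\<integral>y. \<bar>c * f y - c * h y\<bar> \<partial>Q) = \<bar>c\<bar> * (\<integral>y. \<bar>f y - h y\<bar> \<partial>Q)"
    by (simp add: right_diff_distrib[symmetric] abs_mult)
  also have "\<dots> \<le> \<bar>c\<bar> * (\<delta> / (\<bar>c\<bar> + 1))" using h(4) by (intro mult_left_mono) auto
  also have "\<dots> < \<delta>" using \<delta> by (simp add: field_simps)
  finally have "(\<integral>y. \<bar>c * f y - c * h y\<bar> \<partial>Q) < \<delta>" .
  moreover have "\<bar>c * h y\<bar> \<le> \<bar>c\<bar> * C" for y
    using h(2)[of y] by (auto simp: abs_mult intro: mult_left_mono)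
  ultimately show "\<exists>m h C. h \<in> borel_measurable Q \<and> (\<forall>y. \<bar>h y\<bar> \<le> C)
     \<and> (\<forall>y. h (truncate_seq m y) = h y) \<and> (\<integral>y. \<bar>c * f y - h y\<bar> \<partial>Q) < \<delta>"
    using h by (intro exI[of _ m] exI[of _ "\<lambda>y. c * h y"] exI[of _ "\<bar>c\<bar> * C"]) auto
qed

lemma finite_window_approx_const: "finite_window_approx Q (\<lambda>_. c)"
  unfolding finite_window_approx_def by (intro allI impI exI[of _ 0] exI[of _ "\<lambda>_. c"] exI[of _ "\<bar>c\<bar>"]) auto

lemma finite_window_approx_sum:
  assumes Q: "prob_space Q" and "\<And>i. i \<in> I \<Longrightarrow> integrable Q (f i)" "\<And>i. i \<in> I \<Longrightarrow> finite_window_approx Q (f i)"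
  shows "finite_window_approx Q (\<lambda>y. \<Sum>i\<in>I. f i y)"
  using assms(2,3)
proof (induction I rule: infinite_finite_induct)
  case (insert i I)
  then show ?case
    by (simp, intro finite_window_approx_add Q) auto
qed (auto intro: finite_window_approx_const)

text \<open>Cylinder sets depend on finitely many coordinates and form an intersection-stable generator; the
approximable sets are closed under complements and disjoint unions because the approximable functions
form a vector space that is closed under limits in mean.\<close>

lemma finite_window_approx_indicator:
  assumes Q: "prob_space Q" and sets: "sets Q = sets (Pi\<^sub>M UNIV (\<lambda>_. borel))" and A: "A \<in> sets Q"
  shows "finite_window_approx Q (indicator A)"
proof -
  interpret prob_space Q by fact
  let ?\<Omega> = "(\<Pi>\<^sub>E i\<in>(UNIV :: nat set). space (borel :: real measure))"
  let ?G = "prod_algebra UNIV (\<lambda>_::nat. borel :: real measure)"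
  have sg: "sets Q = sigma_sets ?\<Omega> ?G" unfolding sets sets_PiM ..
  have ind_int: "integrable Q (indicator B :: _ \<Rightarrow> real)" if "B \<in> sets Q" for B
    using that by (intro integrable_const_bound[where B=1]) (auto simp: indicator_def)
  have "A \<in> sigma_sets ?\<Omega> ?G" using A sg by simp
  with Int_stable_prod_algebra prod_algebra_sets_into_space show ?thesis
  proof (induction rule: sigma_sets_induct_disjoint)
    case (basic A)
    then have AQ: "A \<in> sets Q" using sg by auto
    from basic obtain J E where J: "A = prod_emb UNIV (\<lambda>_. borel) J (Pi\<^sub>E J E)" "finite J"
      by (elim prod_algebraE) auto
    obtain m where m: "\<forall>j\<in>J. j < m" using J(2) finite_nat_set_iff_bounded by blast
    have mem: "y \<in> A \<longleftrightarrow> (\<forall>j\<in>J. y j \<in> E j)" for y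
      using J by (auto simp: prod_emb_def)
    have "truncate_seq m y \<in> A \<longleftrightarrow> y \<in> A" for y
      unfolding mem using m by (auto simp: truncate_seq_def)
    then show ?case
      using AQ unfolding finite_window_approx_def
      by (intro allI impI exI[of _ m] exI[of _ "indicator A :: _ \<Rightarrow> real"] exI[of _ 1]) (auto simp: indicator_def)
  next
    case empty
    show ?case using finite_window_approx_const[of Q 0] by simp
  next
    case (compl A)
    have AQ: "A \<in> sets Q" using compl sg by auto
    have "finite_window_approx Q (\<lambda>y. 1 + (-1) * indicator A y)"
      using compl AQ ind_int by (intro finite_window_approx_add finite_window_approx_scale finite_window_approx_const Q) auto
    also have "(\<lambda>y. 1 + (-1) * indicator A y) = (indicator (?\<Omega> - A) :: _ \<Rightarrow> real)"
      by (auto simp: indicator_def fun_eq_iff)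
    finally show ?case .
  next
    case (union A)
    have AQ: "A i \<in> sets Q" for i using union sg by auto
    have UQ: "(\<Union>i. A i) \<in> sets Q" using AQ by auto
    show ?case
    proof (rule finite_window_approx_limit[OF Q])
      show "integrable Q (indicator (\<Union>i. A i) :: _ \<Rightarrow> real)" by (rule ind_int[OF UQ])
      fix \<delta> :: real assume \<delta>: "\<delta> > 0"
      have fin: "(\<Sum>i<N. indicator (A i) y) = (indicator (\<Union>i<N. A i) y :: real)" for N y
        using union(1) by (intro indicator_UN_disjoint[symmetric]) (auto simp: disjoint_family_on_def)
      have "(\<lambda>N. \<integral>y. \<bar>indicator (\<Union>i. A i) y - (\<Sum>i<N. indicator (A i) y)\<bar> \<partial>Q) \<longlonglongrightarrow> (\<integral>y. (0::real) \<partial>Q)"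
      proof (rule integral_dominated_convergence[where w="\<lambda>_. 1"])
        show "AE y in Q. (\<lambda>N. \<bar>indicator (\<Union>i. A i) y - (\<Sum>i<N. indicator (A i) y)\<bar>) \<longlonglongrightarrow> (0::real)"
        proof (intro AE_I2)
          fix y
          have "(\<lambda>N. \<Sum>i<N. indicator (A i) y) \<longlonglongrightarrow> (indicator (\<Union>i. A i) y :: real)"
            unfolding fin by (rule LIMSEQ_indicator_UN)
          then have "(\<lambda>N. \<bar>indicator (\<Union>i. A i) y - (\<Sum>i<N. indicator (A i) y)\<bar>) \<longlonglongrightarrow> \<bar>indicator (\<Union>i. A i) y - indicator (\<Union>i. A i) y :: real\<bar>"
            by (intro tendsto_intros)
          then show "(\<lambda>N. \<bar>indicator (\<Union>i. A i) y - (\<Sum>i<N. indicator (A i) y)\<bar>) \<longlonglongrightarrow> (0::real)" by simp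
        qed
        show "AE y in Q. norm \<bar>indicator (\<Union>i. A i) y - (\<Sum>i<N. indicator (A i) y) :: real\<bar> \<le> 1" for N
        proof (intro AE_I2)
          fix y
          have "0 \<le> (indicator (\<Union>i. A i) y :: real)" "(indicator (\<Union>i. A i) y :: real) \<le> 1"
            "0 \<le> (indicator (\<Union>i<N. A i) y :: real)" "(indicator (\<Union>i<N. A i) y :: real) \<le> 1"
            by (rule indicator_pos_le indicator_le_1)+
          then show "norm \<bar>indicator (\<Union>i. A i) y - (\<Sum>i<N. indicator (A i) y) :: real\<bar> \<le> 1"
            unfolding fin real_norm_def by linarith
        qed
        show "(\<lambda>y. \<bar>indicator (\<Union>i. A i) y - (\<Sum>i<N. indicator (A i) y)\<bar> :: real) \<in> borel_measurable Q" for N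
          using AQ UQ by auto
      qed auto
      then have "\<forall>\<^sub>F N in sequentially. (\<integral>y. \<bar>indicator (\<Union>i. A i) y - (\<Sum>i<N. indicator (A i) y)\<bar> \<partial>Q) < \<delta>"
        using \<delta> by (intro order_tendstoD(2)) auto
      then obtain N where "(\<integral>y. \<bar>indicator (\<Union>i. A i) y - (\<Sum>i<N. indicator (A i) y)\<bar> \<partial>Q) < \<delta>"
        using eventually_happens'[of sequentially] by auto
      then show "\<exists>g. integrable Q g \<and> finite_window_approx Q g \<and> (\<integral>y. \<bar>indicator (\<Union>i. A i) y - g y\<bar> \<partial>Q) < \<delta>"
        using AQ ind_int union by (intro exI[of _ "\<lambda>y. \<Sum>i<N. indicator (A i) y"] conjI finite_window_approx_sum Q) auto
    qed
  qed
qed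

lemma integrable_finite_window_approx:
  assumes Q: "prob_space Q" and sets: "sets Q = sets (Pi\<^sub>M UNIV (\<lambda>_. borel))" and f: "integrable Q f"
  shows "finite_window_approx Q f"
  using f
proof (induction rule: integrable_induct)
  case (base A c)
  show ?case using finite_window_approx_scale[OF finite_window_approx_indicator[OF Q sets base(1)], of c]
    by (simp add: mult.commute)
next
  case (add f g)
  then show ?case by (intro finite_window_approx_add Q) auto
next
  case (lim f s)
  show ?case
  proof (rule finite_window_approx_limit[OF Q])
    show "integrable Q f" by fact
    fix \<delta> :: real assume \<delta>: "\<delta> > 0"
    have meas: "s i \<in> borel_measurable Q" "f \<in> borel_measurable Q" for i using lim by auto
    have "(\<lambda>N. \<integral>y. \<bar>f y - s N y\<bar> \<partial>Q) \<longlonglongrightarrow> (\<integral>y. (0::real) \<partial>Q)"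
    proof (rule integral_dominated_convergence[where w="\<lambda>y. 3 * \<bar>f y\<bar>"])
      show "AE y in Q. (\<lambda>N. \<bar>f y - s N y\<bar>) \<longlonglongrightarrow> 0"
      proof (intro AE_I2)
        fix y assume "y \<in> space Q"
        then have "(\<lambda>N. \<bar>f y - s N y\<bar>) \<longlonglongrightarrow> \<bar>f y - f y\<bar>" using lim by (intro tendsto_intros) auto
        then show "(\<lambda>N. \<bar>f y - s N y\<bar>) \<longlonglongrightarrow> 0" by simp
      qed
      show "AE y in Q. norm \<bar>f y - s N y\<bar> \<le> 3 * \<bar>f y\<bar>" for N
      proof (intro AE_I2)
        fix y assume "y \<in> space Q"
        then have "\<bar>s N y\<bar> \<le> 2 * \<bar>f y\<bar>" using lim by auto
        then show "norm \<bar>f y - s N y\<bar> \<le> 3 * \<bar>f y\<bar>" by auto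
      qed
      show "integrable Q (\<lambda>y. 3 * \<bar>f y\<bar>)" using lim by auto
    qed (use meas in auto)
    then have "\<forall>\<^sub>F N in sequentially. (\<integral>y. \<bar>f y - s N y\<bar> \<partial>Q) < \<delta>"
      using \<delta> by (intro order_tendstoD(2)) auto
    then obtain N where "(\<integral>y. \<bar>f y - s N y\<bar> \<partial>Q) < \<delta>"
      using eventually_happens'[of sequentially] by auto
    then show "\<exists>g. integrable Q g \<and> finite_window_approx Q g \<and> (\<integral>y. \<bar>f y - g y\<bar> \<partial>Q) < \<delta>"
      using lim by blast
  qed
qed

context iid_noise
begin

text \<open>Functions of windows that do not overlap are functions of disjoint sets of innovations.\<close>

lemma window_uncorrelated:
  fixes h :: "(nat \<Rightarrow> real) \<Rightarrow> real"
  assumes h: "h \<in> borel_measurable (Pi\<^sub>M UNIV (\<lambda>_. borel))" "\<And>y. \<bar>h y\<bar> \<le> C"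
    and win: "\<And>y. h (truncate_seq m y) = h y" and s: "s + int m \<le> t"
  shows "expectation (\<lambda>\<omega>. h (past t \<omega>) * h (past s \<omega>)) = expectation (\<lambda>\<omega>. h (past t \<omega>)) * expectation (\<lambda>\<omega>. h (past s \<omega>))"
proof -
  let ?A = "{t - int m<..t}" and ?B = "{..s}"
  have 1: "indep_var (Pi\<^sub>M ?A (\<lambda>_. borel)) (\<lambda>\<omega>. restrict (\<lambda>i. \<epsilon> i \<omega>) ?A)
          (Pi\<^sub>M ?B (\<lambda>_. borel)) (\<lambda>\<omega>. restrict (\<lambda>i. \<epsilon> i \<omega>) ?B)"
    using s by (intro indep_var_restrict[OF noise_indep]) auto
  have "(\<lambda>g i. if i < m then g (t - int i) else 0) \<in> measurable (Pi\<^sub>M ?A (\<lambda>_. borel)) (Pi\<^sub>M UNIV (\<lambda>_. borel :: real measure))"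
  proof (intro measurable_PiM_single')
    fix i
    show "(\<lambda>g. if i < m then g (t - int i) else 0) \<in> borel_measurable (Pi\<^sub>M ?A (\<lambda>_. borel :: real measure))"
      by (cases "i < m") auto
  qed auto
  from measurable_compose[OF this h(1)]
  have 2: "(\<lambda>g. h (\<lambda>i. if i < m then g (t - int i) else 0)) \<in> borel_measurable (Pi\<^sub>M ?A (\<lambda>_. borel))" .
  have "(\<lambda>g i. g (s - int i)) \<in> measurable (Pi\<^sub>M ?B (\<lambda>_. borel)) (Pi\<^sub>M UNIV (\<lambda>_. borel :: real measure))"
    by (intro measurable_PiM_single') auto
  from measurable_compose[OF this h(1)]
  have 3: "(\<lambda>g. h (\<lambda>i. g (s - int i))) \<in> borel_measurable (Pi\<^sub>M ?B (\<lambda>_. borel))" .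
  have e: "h (\<lambda>i. if i < m then restrict (\<lambda>i. \<epsilon> i \<omega>) ?A (t - int i) else 0) = h (past t \<omega>)" for \<omega>
    by (subst win[symmetric, of "past t \<omega>"]) (auto simp: truncate_seq_def past_def intro!: arg_cong[where f=h])
  have ind: "indep_var borel (\<lambda>\<omega>. h (past t \<omega>)) borel (\<lambda>\<omega>. h (past s \<omega>))"
    using indep_var_compose[OF 1 2 3] unfolding comp_def e by (simp add: past_def)
  have "integrable M (\<lambda>\<omega>. h (past t \<omega>))" for t
    using h by (intro bounded_integrable[where C=C]) (auto intro: measurable_compose[OF past_measurable])
  then show ?thesis by (intro indep_var_lebesgue_integral ind)
qed

lemma window_sum_second_moment:
  fixes h :: "(nat \<Rightarrow> real) \<Rightarrow> real"
  assumes h: "h \<in> borel_measurable (Pi\<^sub>M UNIV (\<lambda>_. borel))" "\<And>y. \<bar>h y\<bar> \<le> C"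
    and win: "\<And>y. h (truncate_seq m y) = h y" and mean: "expectation (\<lambda>\<omega>. h (past 0 \<omega>)) = 0"
  shows "expectation (\<lambda>\<omega>. (\<Sum>t=1..j. h (past (int t) \<omega>))\<^sup>2) \<le> real j * (real (2 * m + 1) * C\<^sup>2)"
proof -
  have [measurable]: "(\<lambda>\<omega>. h (past t \<omega>)) \<in> borel_measurable M" for t
    using measurable_compose[OF past_measurable h(1)] .
  have C: "0 \<le> C" using h(2)[of undefined] by linarith
  have bd: "\<bar>h (past t \<omega>) * h (past s \<omega>)\<bar> \<le> C\<^sup>2" for t s \<omega>
    using h(2) C by (auto simp: abs_mult power2_eq_square intro!: mult_mono)
  have int: "integrable M (\<lambda>\<omega>. h (past t \<omega>) * h (past s \<omega>))" for t s
    using bd by (intro bounded_integrable[where C="C\<^sup>2"]) auto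
  have mean': "expectation (\<lambda>\<omega>. h (past t \<omega>)) = 0" for t
    using mean expectation_past_shift[OF h(1), of t 0] by simp
  have cov: "expectation (\<lambda>\<omega>. h (past (int t) \<omega>) * h (past (int s) \<omega>)) \<le> (if s \<in> {t - m..t + m} then C\<^sup>2 else 0)" for t s :: nat
  proof (cases "s \<in> {t - m..t + m}")
    case True
    have "expectation (\<lambda>\<omega>. h (past (int t) \<omega>) * h (past (int s) \<omega>)) \<le> expectation (\<lambda>_. C\<^sup>2)"
      using bd int by (intro integral_mono) (auto simp: abs_le_iff)
    then show ?thesis using True by (simp add: prob_space)
  next
    case False
    then consider "int s + int m \<le> int t" | "int t + int m \<le> int s" by fastforce
    then have "expectation (\<lambda>\<omega>. h (past (int t) \<omega>) * h (past (int s) \<omega>)) = 0"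
    proof cases
      case 1
      then show ?thesis using window_uncorrelated[OF h win 1] mean' by simp
    next
      case 2
      then show ?thesis using window_uncorrelated[OF h win 2] mean' by (simp add: mult.commute)
    qed
    then show ?thesis using False by simp
  qed
  have "expectation (\<lambda>\<omega>. (\<Sum>t=1..j. h (past (int t) \<omega>))\<^sup>2)
     = expectation (\<lambda>\<omega>. \<Sum>t=1..j. \<Sum>s=1..j. h (past (int t) \<omega>) * h (past (int s) \<omega>))"
    by (simp add: power2_eq_square sum_product)
  also have "\<dots> = (\<Sum>t=1..j. \<Sum>s=1..j. expectation (\<lambda>\<omega>. h (past (int t) \<omega>) * h (past (int s) \<omega>)))"
    using int by (simp add: Bochner_Integration.integral_sum Bochner_Integration.integrable_sum)
  also have "\<dots> \<le> (\<Sum>t=1..j. real (2 * m + 1) * C\<^sup>2)"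
  proof (intro sum_mono)
    fix t
    have "(\<Sum>s=1..j. expectation (\<lambda>\<omega>. h (past (int t) \<omega>) * h (past (int s) \<omega>)))
      \<le> (\<Sum>s=1..j. if s \<in> {t - m..t + m} then C\<^sup>2 else 0)"
      by (intro sum_mono cov)
    also have "\<dots> = (\<Sum>s\<in>{1..j} \<inter> {t - m..t + m}. C\<^sup>2)"
      by (intro sum.mono_neutral_cong_right) auto
    also have "\<dots> \<le> (\<Sum>s\<in>{t - m..t + m}. C\<^sup>2)"
      by (intro sum_mono2) auto
    also have "\<dots> \<le> real (2 * m + 1) * C\<^sup>2" by (auto intro!: mult_right_mono)
    finally show "(\<Sum>s=1..j. expectation (\<lambda>\<omega>. h (past (int t) \<omega>) * h (past (int s) \<omega>))) \<le> real (2 * m + 1) * C\<^sup>2" .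
  qed
  finally show ?thesis by simp
qed

lemma window_sum_deviation:
  fixes h :: "(nat \<Rightarrow> real) \<Rightarrow> real"
  assumes h: "h \<in> borel_measurable (Pi\<^sub>M UNIV (\<lambda>_. borel))" "\<And>y. \<bar>h y\<bar> \<le> C"
    and win: "\<And>y. h (truncate_seq m y) = h y" and mean: "expectation (\<lambda>\<omega>. h (past 0 \<omega>)) = 0"
    and a: "0 < a"
  shows "prob {\<omega> \<in> space M. a \<le> \<bar>\<Sum>t=1..j. h (past (int t) \<omega>)\<bar>} \<le> real j * (real (2 * m + 1) * C\<^sup>2) / a\<^sup>2"
proof -
  have [measurable]: "(\<lambda>\<omega>. h (past t \<omega>)) \<in> borel_measurable M" for t
    using measurable_compose[OF past_measurable h(1)] .
  have "\<bar>(\<Sum>t=1..j. h (past (int t) \<omega>))\<^sup>2\<bar> \<le> (real j * C)\<^sup>2" for \<omega>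
  proof -
    have "\<bar>\<Sum>t=1..j. h (past (int t) \<omega>)\<bar> \<le> (\<Sum>t=1..j. C)"
      using h(2) by (intro order_trans[OF sum_abs] sum_mono) auto
    then have "\<bar>\<Sum>t=1..j. h (past (int t) \<omega>)\<bar>\<^sup>2 \<le> (real j * C)\<^sup>2"
      by (intro power_mono) auto
    then show ?thesis by simp
  qed
  then have int: "integrable M (\<lambda>\<omega>. (\<Sum>t=1..j. h (past (int t) \<omega>))\<^sup>2)"
    by (intro bounded_integrable) auto
  have "prob {\<omega> \<in> space M. a \<le> \<bar>\<Sum>t=1..j. h (past (int t) \<omega>)\<bar>}
     = prob {\<omega> \<in> space M. a\<^sup>2 \<le> (\<Sum>t=1..j. h (past (int t) \<omega>))\<^sup>2}"
    using a by (intro arg_cong[where f=prob] Collect_cong conj_cong refl)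
      (metis abs_le_square_iff abs_of_pos)
  also have "\<dots> \<le> expectation (\<lambda>\<omega>. (\<Sum>t=1..j. h (past (int t) \<omega>))\<^sup>2) / a\<^sup>2"
    using a int by (intro integral_Markov_inequality_measure[where A="{}"]) auto
  also have "\<dots> \<le> real j * (real (2 * m + 1) * C\<^sup>2) / a\<^sup>2"
    using window_sum_second_moment[OF h win mean] by (intro divide_right_mono) auto
  finally show ?thesis .
qed

text \<open>Chebyshev's inequality on a fixed number of grid times; between neighbouring grid times a partial sum
of bounded terms moves by at most \<open>C\<close> times the mesh.\<close>

lemma window_uniform_LLN:
  fixes h :: "(nat \<Rightarrow> real) \<Rightarrow> real"
  assumes h: "h \<in> borel_measurable (Pi\<^sub>M UNIV (\<lambda>_. borel))" "\<And>y. \<bar>h y\<bar> \<le> C"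
    and win: "\<And>y. h (truncate_seq m y) = h y" and mean: "expectation (\<lambda>\<omega>. h (past 0 \<omega>)) = 0"
    and \<eta>: "0 < \<eta>" and \<delta>: "0 < \<delta>"
  shows "\<forall>\<^sub>F n in sequentially. \<exists>A\<in>events. prob A \<le> \<delta> \<and>
    (\<forall>\<omega>\<in>space M - A. \<forall>j\<le>n. \<bar>\<Sum>t=1..j. h (past (int t) \<omega>)\<bar> \<le> \<eta> * real n)"
proof -
  have [measurable]: "(\<lambda>\<omega>. h (past t \<omega>)) \<in> borel_measurable M" for t
    using measurable_compose[OF past_measurable h(1)] .
  have C: "0 \<le> C" using h(2)[of undefined] by linarith
  \<comment> \<open>\<open>K\<close> grid cells make the movement inside a cell at most \<open>C n / K \<le> \<eta> n / 4\<close>; \<open>N\<close> makes the union bound at most \<open>\<delta>\<close>.\<close>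
  define K where "K = nat \<lceil>4 * C / \<eta>\<rceil> + 1"
  have K: "4 * C / \<eta> \<le> real K" "0 < K" unfolding K_def by linarith+
  define V where "V = real (2 * m + 1) * C\<^sup>2"
  have V: "0 \<le> V" by (simp add: V_def)
  define N where "N = nat \<lceil>4 * (real K + 1) * V / (\<eta>\<^sup>2 * \<delta>)\<rceil> + 1"
  show ?thesis
  proof (rule eventually_sequentiallyI[of N])
    fix n assume n: "N \<le> n"
    have n1: "4 * (real K + 1) * V / (\<eta>\<^sup>2 * \<delta>) \<le> real n" "0 < n"
      using n unfolding N_def by linarith+
    define w where "w = n div K + 1"
    define A where "A = (\<Union>l\<in>{..K}. {\<omega> \<in> space M. \<eta> * real n / 2 \<le> \<bar>\<Sum>t=1..min n (l * w). h (past (int t) \<omega>)\<bar>})"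
    have "A \<in> events" unfolding A_def by (intro sets.finite_UN) auto
    moreover have "prob A \<le> \<delta>"
    proof -
      have "prob A \<le> (\<Sum>l\<in>{..K}. prob {\<omega> \<in> space M. \<eta> * real n / 2 \<le> \<bar>\<Sum>t=1..min n (l * w). h (past (int t) \<omega>)\<bar>})"
        unfolding A_def by (intro finite_measure_subadditive_finite) auto
      also have "\<dots> \<le> (\<Sum>l\<in>{..K}. real n * V / (\<eta> * real n / 2)\<^sup>2)"
      proof (intro sum_mono)
        fix l
        have "prob {\<omega> \<in> space M. \<eta> * real n / 2 \<le> \<bar>\<Sum>t=1..min n (l * w). h (past (int t) \<omega>)\<bar>}
          \<le> real (min n (l * w)) * V / (\<eta> * real n / 2)\<^sup>2"
          unfolding V_def using \<eta> n1 by (intro window_sum_deviation h win mean) auto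
        also have "\<dots> \<le> real n * V / (\<eta> * real n / 2)\<^sup>2"
          using V by (intro divide_right_mono mult_right_mono) auto
        finally show "prob {\<omega> \<in> space M. \<eta> * real n / 2 \<le> \<bar>\<Sum>t=1..min n (l * w). h (past (int t) \<omega>)\<bar>}
          \<le> real n * V / (\<eta> * real n / 2)\<^sup>2" .
      qed
      also have "\<dots> = 4 * (real K + 1) * V / \<eta>\<^sup>2 / real n"
        using n1 \<eta> by (simp add: field_simps power2_eq_square)
      also have "\<dots> \<le> \<delta>"
        using n1 \<eta> \<delta> by (simp add: field_simps)
      finally show ?thesis .
    qed
    moreover have "\<bar>\<Sum>t=1..j. h (past (int t) \<omega>)\<bar> \<le> \<eta> * real n" if \<omega>: "\<omega> \<in> space M - A" and j: "j \<le> n" for \<omega> j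
    proof -
      define l where "l = j div w"
      have "l * w \<le> j" by (simp add: l_def)
      then have lj: "l * w \<le> j" "min n (l * w) = l * w" using j by auto
      have "n < K * w" using K(2) dividend_less_times_div[of K n] by (simp add: w_def algebra_simps)
      then have "l \<le> K" unfolding l_def using j by (intro less_imp_le_nat div_less_iff_less_mult[THEN iffD2]) (auto simp: w_def)
      then have 1: "\<bar>\<Sum>t=1..l * w. h (past (int t) \<omega>)\<bar> < \<eta> * real n / 2"
        using \<omega> lj unfolding A_def by force
      have "(\<Sum>t=1..j. h (past (int t) \<omega>)) = (\<Sum>t=1..l * w. h (past (int t) \<omega>)) + (\<Sum>t=l * w + 1..j. h (past (int t) \<omega>))"
      proof -
        have "{1..j} = {1..l * w} \<union> {l * w + 1..j}" using lj(1) by auto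
        then show ?thesis by (simp only:) (rule sum.union_disjoint, auto)
      qed
      moreover have "\<bar>\<Sum>t=l * w + 1..j. h (past (int t) \<omega>)\<bar> \<le> \<eta> * real n / 2"
      proof -
        have "\<bar>\<Sum>t=l * w + 1..j. h (past (int t) \<omega>)\<bar> \<le> (\<Sum>t=l * w + 1..j. C)"
          using h(2) by (intro order_trans[OF sum_abs] sum_mono) auto
        also have "\<dots> = real (j - l * w) * C" by simp
        also have "\<dots> \<le> (real n / real K) * C"
        proof (intro mult_right_mono C)
          have "j - l * w = j mod w" by (simp add: l_def minus_div_mult_eq_mod)
          also have "\<dots> \<le> n div K" using mod_less_divisor[of w j] by (simp add: w_def)
          finally have "real (j - l * w) \<le> real (n div K)" by simp
          also have "\<dots> \<le> real n / real K" by (rule of_nat_div_le_of_nat)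
          finally show "real (j - l * w) \<le> real n / real K" .
        qed
        also have "\<dots> \<le> \<eta> * real n / 2"
        proof -
          have "4 * C \<le> real K * \<eta>" using K \<eta> by (simp add: field_simps)
          then have "2 * C * real n \<le> real K * \<eta> * real n" using C by (intro mult_right_mono) auto
          then show ?thesis using K by (simp add: field_simps)
        qed
        finally show ?thesis .
      qed
      ultimately show ?thesis using 1 by linarith
    qed
    ultimately show "\<exists>A\<in>events. prob A \<le> \<delta> \<and>
      (\<forall>\<omega>\<in>space M - A. \<forall>j\<le>n. \<bar>\<Sum>t=1..j. h (past (int t) \<omega>)\<bar> \<le> \<eta> * real n)" by blast
  qed
qed

text \<open>The law of large numbers for integrable functions of the whole past, uniform in the upper summation
limit. Approximation in mean by a bounded function of a finite window reduces it to the previous lemma,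
and the sum of the absolute errors controls all partial sums at once.\<close>

lemma uniform_LLN:
  fixes \<Phi> :: "(nat \<Rightarrow> real) \<Rightarrow> real"
  assumes meas: "\<Phi> \<in> borel_measurable (Pi\<^sub>M UNIV (\<lambda>_. borel))"
    and int: "integrable M (\<lambda>\<omega>. \<Phi> (past 0 \<omega>))" and \<eta>: "0 < \<eta>" and \<delta>: "0 < \<delta>"
  shows "\<forall>\<^sub>F n in sequentially. \<exists>A\<in>events. prob A \<le> \<delta> \<and>
    (\<forall>\<omega>\<in>space M - A. \<forall>j\<le>n.
       \<bar>(\<Sum>t=1..j. \<Phi> (past (int t) \<omega>)) - real j * expectation (\<lambda>\<omega>. \<Phi> (past 0 \<omega>))\<bar> \<le> \<eta> * real n)"
proof -
  define Q where "Q = distr M (Pi\<^sub>M UNIV (\<lambda>_. borel)) (past 0)"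
  have Q: "prob_space Q" unfolding Q_def by (rule prob_space_distr) measurable
  have setsQ: "sets Q = sets (Pi\<^sub>M UNIV (\<lambda>_. borel))" by (simp add: Q_def)
  have "integrable Q \<Phi>" unfolding Q_def using int meas by (subst integrable_distr_eq) auto
  then have "finite_window_approx Q \<Phi>" by (rule integrable_finite_window_approx[OF Q setsQ])
  moreover define \<kappa> where "\<kappa> = min (\<eta> / 4) (\<eta> * \<delta> / 8)"
  have \<kappa>: "0 < \<kappa>" using \<eta> \<delta> by (simp add: \<kappa>_def)
  ultimately obtain m h C where h: "h \<in> borel_measurable Q" "\<And>y. \<bar>h y\<bar> \<le> C" "\<And>y. h (truncate_seq m y) = h y"
    "(\<integral>y. \<bar>\<Phi> y - h y\<bar> \<partial>Q) < \<kappa>"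
    unfolding finite_window_approx_def by blast
  have hm [measurable]: "h \<in> borel_measurable (Pi\<^sub>M UNIV (\<lambda>_. borel))" using h(1) setsQ
    by (simp cong: measurable_cong_sets)
  note [measurable] = meas
  have ih: "integrable M (\<lambda>\<omega>. h (past t \<omega>))" for t
    using h(2) by (intro bounded_integrable[where C=C]) auto
  have i\<Phi>: "integrable M (\<lambda>\<omega>. \<Phi> (past t \<omega>))" for t using int integrable_past_shift[OF meas, of t 0] by simp
  define a where "a = expectation (\<lambda>\<omega>. \<Phi> (past 0 \<omega>))"
  define c where "c = expectation (\<lambda>\<omega>. h (past 0 \<omega>))"
  have close: "expectation (\<lambda>\<omega>. \<bar>\<Phi> (past t \<omega>) - h (past t \<omega>)\<bar>) < \<kappa>" for t
  proof -
    have "expectation (\<lambda>\<omega>. \<bar>\<Phi> (past t \<omega>) - h (past t \<omega>)\<bar>) = expectation (\<lambda>\<omega>. \<bar>\<Phi> (past 0 \<omega>) - h (past 0 \<omega>)\<bar>)"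
      by (rule expectation_past_shift[where f="\<lambda>y. \<bar>\<Phi> y - h y\<bar>"]) measurable
    also have "\<dots> = (\<integral>y. \<bar>\<Phi> y - h y\<bar> \<partial>Q)"
      unfolding Q_def by (subst integral_distr) auto
    finally show ?thesis using h(4) by simp
  qed
  have ac: "\<bar>a - c\<bar> \<le> \<eta> / 4"
  proof -
    have "a - c = expectation (\<lambda>\<omega>. \<Phi> (past 0 \<omega>) - h (past 0 \<omega>))"
      using ih i\<Phi> by (simp add: a_def c_def)
    then have "\<bar>a - c\<bar> \<le> expectation (\<lambda>\<omega>. \<bar>\<Phi> (past 0 \<omega>) - h (past 0 \<omega>)\<bar>)" 
      using integral_abs_bound by simp
    then show ?thesis using close[of 0] by (simp add: \<kappa>_def)
  qed
  have "\<forall>\<^sub>F n in sequentially. \<exists>A\<in>events. prob A \<le> \<delta> / 2 \<and>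
    (\<forall>\<omega>\<in>space M - A. \<forall>j\<le>n. \<bar>\<Sum>t=1..j. h (past (int t) \<omega>) - c\<bar> \<le> \<eta> / 2 * real n)"
  proof (rule window_uniform_LLN[where C="C + \<bar>c\<bar>" and m=m])
    show "\<bar>h y - c\<bar> \<le> C + \<bar>c\<bar>" for y using h(2)[of y] by linarith
    show "h (truncate_seq m y) - c = h y - c" for y using h(3) by simp
    show "expectation (\<lambda>\<omega>. h (past 0 \<omega>) - c) = 0" using ih by (simp add: c_def prob_space)
  qed (use \<eta> \<delta> in auto)
  then show ?thesis
    using eventually_gt_at_top[of 0]
  proof eventually_elim
    case (elim n)
    then obtain A where A: "A \<in> events" "prob A \<le> \<delta> / 2"
      "\<And>\<omega> j. \<omega> \<in> space M - A \<Longrightarrow> j \<le> n \<Longrightarrow> \<bar>\<Sum>t=1..j. h (past (int t) \<omega>) - c\<bar> \<le> \<eta> / 2 * real n"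
      by blast
    define D where "D = (\<lambda>\<omega>. \<Sum>t=1..n. \<bar>\<Phi> (past (int t) \<omega>) - h (past (int t) \<omega>)\<bar>)"
    define B where "B = {\<omega> \<in> space M. \<eta> / 4 * real n \<le> D \<omega>}"
    have D: "integrable M D" unfolding D_def using ih i\<Phi> by auto
    have "prob B \<le> expectation D / (\<eta> / 4 * real n)"
      unfolding B_def using D \<eta> elim
      by (intro integral_Markov_inequality_measure[where A="{}"]) (auto simp: D_def intro!: sum_nonneg)
    also have "expectation D \<le> (\<Sum>t=1..n. \<kappa>)"
      unfolding D_def using ih i\<Phi> close
      by (subst Bochner_Integration.integral_sum) (auto intro!: sum_mono less_imp_le[OF close] simp del: sum_constant)
    also have "(\<Sum>t=1..n. \<kappa>) / (\<eta> / 4 * real n) \<le> \<delta> / 2"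
    proof -
      have "\<kappa> \<le> \<eta> * \<delta> / 8" by (simp add: \<kappa>_def)
      then show ?thesis using \<eta> elim by (simp add: field_simps)
    qed
    finally have pB: "prob B \<le> \<delta> / 2" using \<eta> elim by (simp add: divide_right_mono)
    have [measurable]: "D \<in> borel_measurable M" using D by auto
    have Be: "B \<in> events" unfolding B_def by measurable
    have "prob (A \<union> B) \<le> \<delta>" using pB A Be measure_Un_le[of A M B] by simp
    moreover have "\<bar>(\<Sum>t=1..j. \<Phi> (past (int t) \<omega>)) - real j * a\<bar> \<le> \<eta> * real n"
      if \<omega>: "\<omega> \<in> space M - (A \<union> B)" and j: "j \<le> n" for \<omega> j
    proof -
      let ?P = "\<Sum>t=1..j. \<Phi> (past (int t) \<omega>) - h (past (int t) \<omega>)"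
      let ?R = "\<Sum>t=1..j. h (past (int t) \<omega>) - c"
      have P: "\<bar>?P\<bar> \<le> D \<omega>"
        unfolding D_def using j by (intro order_trans[OF sum_abs] sum_mono2) auto
      have "D \<omega> < \<eta> / 4 * real n" using \<omega> by (auto simp: B_def)
      with P have P: "\<bar>?P\<bar> \<le> \<eta> / 4 * real n" by (rule order_trans[OF _ less_imp_le])
      have R: "\<bar>?R\<bar> \<le> \<eta> / 2 * real n" using A(3)[of \<omega> j] \<omega> j by auto
      have c: "\<bar>real j * (c - a)\<bar> \<le> real n * (\<eta> / 4)"
        unfolding abs_mult using ac j by (intro mult_mono) (auto simp: abs_minus_commute)
      have "(\<Sum>t=1..j. \<Phi> (past (int t) \<omega>)) - real j * a = ?P + ?R + real j * (c - a)"
        by (simp add: sum_subtractf algebra_simps)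
      also have "\<bar>\<dots>\<bar> \<le> \<bar>?P\<bar> + \<bar>?R\<bar> + \<bar>real j * (c - a)\<bar>"
        by (intro order_trans[OF abs_triangle_ineq] add_mono abs_triangle_ineq order_refl)
      also have "\<dots> \<le> \<eta> / 4 * real n + \<eta> / 2 * real n + real n * (\<eta> / 4)"
        by (intro add_mono P R c)
      also have "\<dots> = \<eta> * real n" by simp
      finally show ?thesis .
    qed
    ultimately show ?case
      using A Be unfolding a_def by (intro bexI[of _ "A \<union> B"]) auto
  qed
qed

end

section \<open>Linearisation of the residuals along a path\<close>

text \<open>With \<open>s = sqrt Y\<close> the left-hand side equals \<open>(s - 1)\<^sup>2 (s + 2) / (2 s)\<close>, and
\<open>(Y - 1)\<^sup>2 = (s - 1)\<^sup>2 (s + 1)\<^sup>2\<close>.\<close>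

lemma inverse_sqrt_taylor:
  assumes "\<bar>Y - 1\<bar> \<le> (1/2 :: real)"
  shows "\<bar>1 / sqrt Y - 1 + (Y - 1) / 2\<bar> \<le> (Y - 1)\<^sup>2"
proof -
  define s where "s = sqrt Y"
  have Y: "1/2 \<le> Y" using assms unfolding abs_le_iff by linarith
  then have s: "Y = s\<^sup>2" by (simp add: s_def)
  have "(1/2)\<^sup>2 \<le> Y" using Y by (simp add: power2_eq_square)
  then have s12: "1/2 \<le> s" unfolding s_def by (rule real_le_rsqrt)
  have mult: "(1 / s - 1 + (s\<^sup>2 - 1) / 2) * (2 * s) = (s - 1)\<^sup>2 * (s + 2)"
    using s12 by (simp add: field_simps power2_eq_square)
  have "2 * s \<noteq> 0" using s12 by simp
  then have eq: "1 / s - 1 + (s\<^sup>2 - 1) / 2 = (s - 1)\<^sup>2 * (s + 2) / (2 * s)"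
    by (rule nonzero_eq_divide_eq[THEN iffD2]) (rule mult)
  have "s + 2 \<le> (s + 1)\<^sup>2 * (2 * s)"
  proof -
    have "s\<^sup>2 \<ge> 1/2" using Y s by simp
    then have "s * s\<^sup>2 \<ge> s * (1/2)" using s12 by (intro mult_left_mono) auto
    then have "(s + 1)\<^sup>2 * (2 * s) \<ge> s + 4 * s\<^sup>2 + 2 * s"
      by (simp add: power2_eq_square algebra_simps)
    then show ?thesis using \<open>s\<^sup>2 \<ge> 1/2\<close> s12 by linarith
  qed
  then have "(s - 1)\<^sup>2 * (s + 2) \<le> (s - 1)\<^sup>2 * ((s + 1)\<^sup>2 * (2 * s))" by (rule mult_left_mono) simp
  also have "\<dots> = (s\<^sup>2 - 1)\<^sup>2 * (2 * s)" by (simp add: power2_eq_square algebra_simps)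
  finally have "(s - 1)\<^sup>2 * (s + 2) / (2 * s) \<le> (s\<^sup>2 - 1)\<^sup>2" using s12 by (simp add: field_simps)
  moreover have "0 \<le> (s - 1)\<^sup>2 * (s + 2) / (2 * s)" using s12 by simp
  ultimately show ?thesis unfolding s_def[symmetric] using eq s by simp
qed

lemma inverse_sqrt_power_taylor:
  "\<exists>C\<ge>0. \<forall>Y. \<bar>Y - 1\<bar> \<le> (1/2 :: real) \<longrightarrow> \<bar>(1 / sqrt Y) ^ k - 1 + real k / 2 * (Y - 1)\<bar> \<le> C * (Y - 1)\<^sup>2"
proof (induction k)
  case 0
  show ?case by (intro exI[of _ 0]) auto
next
  case (Suc k)
  then obtain C where C: "0 \<le> C" "\<And>Y. \<bar>Y - 1\<bar> \<le> (1/2 :: real) \<Longrightarrow> \<bar>(1 / sqrt Y) ^ k - 1 + real k / 2 * (Y - 1)\<bar> \<le> C * (Y - 1)\<^sup>2"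
    by blast
  show ?case
  proof (intro exI[of _ "2 * C + (1 + real k / 2) + real k / 4"] conjI allI impI)
    show "0 \<le> 2 * C + (1 + real k / 2) + real k / 4" using C by simp
    fix Y :: real assume Y: "\<bar>Y - 1\<bar> \<le> 1/2"
    define y where "y = Y - 1"
    define A where "A = (1 / sqrt Y) ^ k"
    define B where "B = 1 / sqrt Y"
    have A: "\<bar>A - 1 + real k / 2 * y\<bar> \<le> C * y\<^sup>2" using C(2)[OF Y] by (simp add: A_def y_def)
    have B: "\<bar>B - 1 + y / 2\<bar> \<le> y\<^sup>2" using inverse_sqrt_taylor[OF Y] by (simp add: B_def y_def)
    have y: "\<bar>y\<bar> \<le> 1/2" using Y by (simp add: y_def)
    have y2: "y\<^sup>2 \<le> 1/4"
    proof -
      have "\<bar>y\<bar>\<^sup>2 \<le> (1/2)\<^sup>2" using y by (intro power_mono) auto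
      then show ?thesis by (simp add: power2_eq_square)
    qed
    have B2: "\<bar>B\<bar> \<le> 2" using B y y2 by linarith
    have "A * B - 1 + real (Suc k) / 2 * y
      = (A - 1 + real k / 2 * y) * B + (1 - real k / 2 * y) * (B - 1 + y / 2) + real k / 4 * y\<^sup>2"
      by (simp add: algebra_simps power2_eq_square add_divide_distrib)
    also have "\<bar>\<dots>\<bar> \<le> \<bar>A - 1 + real k / 2 * y\<bar> * \<bar>B\<bar> + \<bar>1 - real k / 2 * y\<bar> * \<bar>B - 1 + y / 2\<bar> + real k / 4 * y\<^sup>2"
      by (intro order_trans[OF abs_triangle_ineq] add_mono order_trans[OF abs_triangle_ineq]) (auto simp: abs_mult)
    also have "\<dots> \<le> (C * y\<^sup>2) * 2 + (1 + real k / 2) * y\<^sup>2 + real k / 4 * y\<^sup>2"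
    proof (intro add_mono mult_mono)
      have "\<bar>real k / 2 * y\<bar> \<le> real k / 2 * 1" unfolding abs_mult using y by (intro mult_mono) auto
      then show "\<bar>1 - real k / 2 * y\<bar> \<le> 1 + real k / 2" by linarith
    qed (use A B B2 C(1) in auto)
    also have "\<dots> = (2 * C + (1 + real k / 2) + real k / 4) * y\<^sup>2" by (simp add: algebra_simps)
    finally show "\<bar>(1 / sqrt Y) ^ Suc k - 1 + real (Suc k) / 2 * (Y - 1)\<bar> \<le> (2 * C + (1 + real k / 2) + real k / 4) * (Y - 1)\<^sup>2"
      by (simp add: A_def B_def y_def mult.commute)
  qed
qed

text \<open>A quadratic weight is absorbed by a geometric one (Bernoulli's inequality for \<open>sqrt \<mu>\<close>).\<close>

definition poly_weight :: "real \<Rightarrow> real" where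
  "poly_weight \<mu> = 1 / (min 1 (sqrt \<mu> - 1))\<^sup>2"

lemma poly_weight:
  assumes "1 < \<mu>"
  shows "0 < poly_weight \<mu>" "(1 + real i)\<^sup>2 \<le> poly_weight \<mu> * \<mu> ^ i"
proof -
  define a where "a = min 1 (sqrt \<mu> - 1)"
  have a: "0 < a" "a \<le> 1" "1 + a \<le> sqrt \<mu>" using assms by (auto simp: a_def)
  have "1 + real i * a \<le> (1 + a) ^ i" using a by (intro Bernoulli_inequality) auto
  also have "\<dots> \<le> sqrt \<mu> ^ i" using a by (intro power_mono) auto
  finally have "a * (1 + real i) \<le> sqrt \<mu> ^ i" using a by (simp add: algebra_simps)
  then have "(a * (1 + real i))\<^sup>2 \<le> (sqrt \<mu> ^ i)\<^sup>2" using a by (intro power_mono) auto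
  also have "(sqrt \<mu> ^ i)\<^sup>2 = \<mu> ^ i" using assms by (simp add: power_even_eq[symmetric] power_mult power2_eq_square power_mult_distrib[symmetric])
  finally have "a\<^sup>2 * (1 + real i)\<^sup>2 \<le> \<mu> ^ i" by (simp add: power_mult_distrib)
  then show "(1 + real i)\<^sup>2 \<le> poly_weight \<mu> * \<mu> ^ i" "0 < poly_weight \<mu>"
    using a by (simp_all add: poly_weight_def a_def[symmetric] field_simps)
qed

context garch_param
begin

definition beta_gap :: real where "beta_gap = 1 - (\<Sum>j=1..q. \<theta> (p + j))"

lemma beta_gap: "0 < beta_gap" "beta_gap \<le> 1"
  using beta_lt_1 less_imp_le[OF theta_pos] by (auto simp: beta_gap_def intro!: sum_nonneg)

text \<open>The first two summands come from \<open>c\<^sub>0\<close>, the last one from the series over the lags.\<close>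

definition lin_const :: "real \<Rightarrow> real" where
  "lin_const \<mu> = 2 / beta_gap ^ 3 + 1 / beta_gap\<^sup>2 + poly_weight \<mu> * (1 / (1 - 1 / \<mu>))"

definition score_const :: "real \<Rightarrow> real \<Rightarrow> real" where
  "score_const \<mu> lo = (1 / beta_gap + \<theta> 0 / beta_gap\<^sup>2) / \<theta> 0 + (1 / lo) * (poly_weight \<mu> * (1 / (1 - 1 / \<mu>)))"

lemma lin_const_pos: "1 < \<mu> \<Longrightarrow> 0 < lin_const \<mu>"
  using beta_gap poly_weight(1)[of \<mu>] unfolding lin_const_def
  by (intro add_pos_pos mult_pos_pos) auto

end

context garch_path
begin

definition path_score :: "int \<Rightarrow> nat \<Rightarrow> real" where
  "path_score t m = (grad_garch_coeff p q \<theta> 0 m + (\<Sum>i. lag_coeff_grad p q \<theta> i m * x (t - int i))) / v t"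

context
  fixes \<mu> :: real and t :: int and g :: real
  assumes mu: "1 < \<mu>" and g1: "1 \<le> g"
    and term_le: "\<And>i. lag_coeff p q \<theta> i * x (t - int i) \<le> v t * (g / \<mu> ^ (4 * i))"
begin

lemma geometric_tail: "summable (\<lambda>i. B * (1 / \<mu>) ^ i)" "(\<Sum>i. B * (1 / \<mu>) ^ i) = B * (1 / (1 - 1 / \<mu>))"
  using mu by (auto intro!: summable_mult summable_geometric simp: suminf_mult suminf_geometric)

text \<open>One of the four powers of \<open>\<mu>\<close> absorbs the polynomial weight.\<close>

lemma weighted_term_le:
  "(1 + real i)\<^sup>2 * (lag_coeff p q \<theta> i * x (t - int i)) \<le> poly_weight \<mu> * g * v t * (1 / \<mu>) ^ (3 * i)"
proof -
  have "(1 + real i)\<^sup>2 * (lag_coeff p q \<theta> i * x (t - int i)) \<le> (poly_weight \<mu> * \<mu> ^ i) * (v t * (g / \<mu> ^ (4 * i)))"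
    using poly_weight(1)[OF mu] mu by (intro mult_mono[OF poly_weight(2)[OF mu] term_le] lag_term_nonneg) auto
  also have "\<mu> ^ (4 * i) = \<mu> ^ i * \<mu> ^ (3 * i)" by (simp add: power_add[symmetric])
  also have "(poly_weight \<mu> * \<mu> ^ i) * (v t * (g / (\<mu> ^ i * \<mu> ^ (3 * i)))) = poly_weight \<mu> * g * v t * (1 / \<mu>) ^ (3 * i)"
    using mu by (simp add: field_simps)
  finally show ?thesis .
qed

lemma series_bound:
  assumes a: "\<And>i. \<bar>a i\<bar> \<le> B * (1 / \<mu>) ^ i"
  shows "summable a" "\<bar>suminf a\<bar> \<le> B * (1 / (1 - 1 / \<mu>))"
proof -
  have sabs: "summable (\<lambda>i. \<bar>a i\<bar>)"
    using a by (intro summable_comparison_test'[OF geometric_tail(1)[of B]]) auto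
  then show "summable a" by (rule summable_rabs_cancel)
  have "\<bar>suminf a\<bar> \<le> (\<Sum>i. \<bar>a i\<bar>)" using sabs by (rule summable_rabs)
  also have "\<dots> \<le> (\<Sum>i. B * (1 / \<mu>) ^ i)" by (intro suminf_le a sabs geometric_tail)
  finally show "\<bar>suminf a\<bar> \<le> B * (1 / (1 - 1 / \<mu>))" by (simp only: geometric_tail)
qed

lemma inverse_power_mono: "k \<le> l \<Longrightarrow> (1 / \<mu>) ^ l \<le> (1 / \<mu>) ^ k"
  using mu by (intro power_decreasing) auto

lemma linear_weight_le: "(c * real i) * (lag_coeff p q \<theta> i * x (t - int i)) \<le> c * poly_weight \<mu> * g * v t * (1 / \<mu>) ^ i"
  if "0 \<le> c"
proof -
  have "1 * real i \<le> (1 + real i) * (1 + real i)" by (intro mult_mono) auto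
  then have "real i \<le> (1 + real i)\<^sup>2" by (simp add: power2_eq_square)
  then have "real i * (lag_coeff p q \<theta> i * x (t - int i)) \<le> (1 + real i)\<^sup>2 * (lag_coeff p q \<theta> i * x (t - int i))"
    by (intro mult_right_mono lag_term_nonneg)
  also note weighted_term_le
  also have "poly_weight \<mu> * g * v t * (1 / \<mu>) ^ (3 * i) \<le> poly_weight \<mu> * g * v t * (1 / \<mu>) ^ i"
    using poly_weight(1)[OF mu] g1 v_nonneg by (intro mult_left_mono inverse_power_mono) auto
  finally have "real i * (lag_coeff p q \<theta> i * x (t - int i)) \<le> poly_weight \<mu> * g * v t * (1 / \<mu>) ^ i" .
  from mult_left_mono[OF this that] show ?thesis by (simp only: mult_ac)
qed

lemma grad_series:
  assumes "m \<le> p + q" "lo \<le> \<theta> m" "0 < lo"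
  shows "summable (\<lambda>i. lag_coeff_grad p q \<theta> i m * x (t - int i))"
    "\<bar>\<Sum>i. lag_coeff_grad p q \<theta> i m * x (t - int i)\<bar> \<le> (1 / lo * poly_weight \<mu> * g * v t) * (1 / (1 - 1 / \<mu>))"
proof -
  have "\<bar>lag_coeff_grad p q \<theta> i m * x (t - int i)\<bar> \<le> (1 / lo * poly_weight \<mu> * g * v t) * (1 / \<mu>) ^ i" for i
  proof -
    have grad: "\<bar>lag_coeff_grad p q \<theta> i m\<bar> \<le> 1 / lo * real i * lag_coeff p q \<theta> i"
      using assms theta_pos by (intro lag_coeff_grad_bound) (auto intro: less_imp_le)
    have "\<bar>lag_coeff_grad p q \<theta> i m * x (t - int i)\<bar> \<le> (1 / lo * real i * lag_coeff p q \<theta> i) * x (t - int i)"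
      by (simp only: abs_mult abs_of_nonneg[OF x_nonneg]) (intro mult_right_mono grad x_nonneg)
    also have "\<dots> = (1 / lo * real i) * (lag_coeff p q \<theta> i * x (t - int i))" by simp
    also have "\<dots> \<le> (1 / lo * poly_weight \<mu> * g * v t) * (1 / \<mu>) ^ i"
      using assms by (intro linear_weight_le) auto
    finally show ?thesis .
  qed
  from series_bound[OF this] show "summable (\<lambda>i. lag_coeff_grad p q \<theta> i m * x (t - int i))"
    "\<bar>\<Sum>i. lag_coeff_grad p q \<theta> i m * x (t - int i)\<bar> \<le> (1 / lo * poly_weight \<mu> * g * v t) * (1 / (1 - 1 / \<mu>))" .
qed

lemma path_score_bound:
  assumes "m \<le> p + q" "lo \<le> \<theta> m" "0 < lo"
  shows "\<bar>path_score t m\<bar> \<le> score_const \<mu> lo * g"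
proof -
  define G where "G = 1 / beta_gap + \<theta> 0 / beta_gap\<^sup>2"
  have G: "0 \<le> G" using beta_gap theta_pos[of 0] by (simp add: G_def)
  have "\<bar>grad_garch_coeff p q \<theta> 0 m\<bar> \<le> G"
    unfolding grad_garch_coeff_0[OF assms(1) beta_lt_1] beta_gap_def[symmetric] G_def
    using beta_gap theta_pos[of 0] by auto
  also have "G \<le> G / \<theta> 0 * g * v t"
  proof -
    have "\<theta> 0 * 1 \<le> v t * g" using v_ge g1 v_nonneg by (intro mult_mono) auto
    then have "G * \<theta> 0 \<le> G * (v t * g)" using G by (intro mult_left_mono) auto
    then show ?thesis using theta_pos[of 0] by (simp add: field_simps)
  qed
  finally have 1: "\<bar>grad_garch_coeff p q \<theta> 0 m\<bar> \<le> G / \<theta> 0 * g * v t" .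
  have "\<bar>grad_garch_coeff p q \<theta> 0 m + (\<Sum>i. lag_coeff_grad p q \<theta> i m * x (t - int i))\<bar>
     \<le> G / \<theta> 0 * g * v t + (1 / lo * poly_weight \<mu> * g * v t) * (1 / (1 - 1 / \<mu>))"
    by (intro order_trans[OF abs_triangle_ineq] add_mono 1 grad_series(2)[OF assms])
  also have "\<dots> = (score_const \<mu> lo * g) * v t"
    by (simp only: score_const_def G_def distrib_right distrib_left mult_ac)
  finally show ?thesis
    unfolding path_score_def abs_divide using v_pos[of t] by (simp add: pos_divide_le_eq)
qed

lemma path_score_dir:
  "v t * (\<Sum>m<p + q + 1. path_score t m * h m) =
    (\<Sum>m<p + q + 1. grad_garch_coeff p q \<theta> 0 m * h m) + (\<Sum>i. lag_coeff_dir p q \<theta> h i * x (t - int i))"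
proof -
  have s: "summable (\<lambda>i. lag_coeff_grad p q \<theta> i m * x (t - int i))" if "m < p + q + 1" for m
    using that theta_pos[of m] by (intro grad_series[where lo="\<theta> m"]) auto
  have "v t * (\<Sum>m<p + q + 1. path_score t m * h m)
     = (\<Sum>m<p + q + 1. (grad_garch_coeff p q \<theta> 0 m + (\<Sum>i. lag_coeff_grad p q \<theta> i m * x (t - int i))) * h m)"
    unfolding path_score_def sum_distrib_left using v_pos[of t] by (intro sum.cong refl) simp
  also have "\<dots> = (\<Sum>m<p + q + 1. grad_garch_coeff p q \<theta> 0 m * h m)
     + (\<Sum>m<p + q + 1. (\<Sum>i. lag_coeff_grad p q \<theta> i m * x (t - int i) * h m))"
    using s by (simp add: distrib_right sum.distrib suminf_mult2 del: sum.lessThan_Suc)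
  also have "(\<Sum>m<p + q + 1. (\<Sum>i. lag_coeff_grad p q \<theta> i m * x (t - int i) * h m))
     = (\<Sum>i. \<Sum>m<p + q + 1. lag_coeff_grad p q \<theta> i m * x (t - int i) * h m)"
    using s by (intro suminf_sum[symmetric] summable_mult2) auto
  also have "\<dots> = (\<Sum>i. lag_coeff_dir p q \<theta> h i * x (t - int i))"
    unfolding lag_coeff_dir_def sum_distrib_right by (intro suminf_cong sum.cong refl) (simp only: mult_ac)
  finally show ?thesis .
qed

text \<open>\<open>Y\<close> is the ratio of the estimated to the true conditional variance. Writing \<open>v (Y - 1 - L)\<close> as the Taylor
remainder of \<open>c\<^sub>0\<close> plus one series, the lags up to \<open>n\<close> contribute quadratic Taylor remainders; the lags
beyond \<open>n\<close>, which the truncated variance omits, contribute \<open>\<mu> ^ - n\<close>.\<close>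

lemma linearisation:
  fixes u :: "nat \<Rightarrow> real" and n :: nat
  assumes u: "\<And>m. m \<le> p + q \<Longrightarrow> \<bar>u m - \<theta> m\<bar> \<le> e0 * \<theta> m"
    and e: "0 \<le> e0" "e0 \<le> beta_gap / 2" "1 + e0 \<le> \<mu>"
    and v: "v t = garch_coeff p q \<theta> 0 + (\<Sum>i. lag_coeff p q \<theta> i * x (t - int i))"
  defines "Y \<equiv> (garch_coeff p q u 0 + (\<Sum>i=1..n. lag_coeff p q u i * x (t - int i))) / v t"
    and "L \<equiv> (\<Sum>m<p + q + 1. path_score t m * (u m - \<theta> m))"
  shows "\<bar>Y - 1 - L\<bar> \<le> lin_const \<mu> * (e0\<^sup>2 + (1 / \<mu>) ^ n) * g" (is ?A)
    and "\<bar>L\<bar> \<le> lin_const \<mu> * e0 * g" (is ?B)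
proof -
  define h where "h = (\<lambda>m. u m - \<theta> m)"
  define b where "b = (\<Sum>j=1..q. \<theta> (p + j))"
  define P where "P = poly_weight \<mu>"
  define Z where "Z = 1 / (1 - 1 / \<mu>)"
  have P: "0 < P" using poly_weight[OF mu] by (simp add: P_def)
  have Z: "0 < Z" using mu by (simp add: Z_def)
  have e1: "e0 \<le> 1" using e beta_gap by simp
  have gap: "1 - b = beta_gap" by (simp add: b_def beta_gap_def)
  have t0: "0 < \<theta> 0" by (simp add: theta_pos)
  have th: "0 \<le> \<theta> m" if "m \<le> p + q" for m using theta_pos[OF that] by simp
  have vg: "\<theta> 0 \<le> v t * g"
    using mult_mono[of "\<theta> 0" "v t" 1 g] v_ge[of t] g1 v_nonneg by simp
  have c0: "\<bar>garch_coeff p q u 0 - garch_coeff p q \<theta> 0 - (\<Sum>m<p + q + 1. grad_garch_coeff p q \<theta> 0 m * h m)\<bar>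
      \<le> 2 * \<theta> 0 / beta_gap ^ 3 * e0\<^sup>2"
    "\<bar>\<Sum>m<p + q + 1. grad_garch_coeff p q \<theta> 0 m * h m\<bar> \<le> \<theta> 0 / beta_gap\<^sup>2 * e0"
    using garch_coeff_0_taylor(1,2)[OF theta_pos u b_def] e beta_lt_1 unfolding h_def gap b_def[symmetric] by auto
  have dir: "\<bar>lag_coeff_dir p q \<theta> h i\<bar> \<le> e0 * real i * lag_coeff p q \<theta> i" for i
    using th u e by (intro lag_coeff_dir_bound) (auto simp: h_def)
  have dir_term: "\<bar>lag_coeff_dir p q \<theta> h i * x (t - int i)\<bar> \<le> e0 * P * g * v t * (1 / \<mu>) ^ i" for i
  proof -
    have "\<bar>lag_coeff_dir p q \<theta> h i * x (t - int i)\<bar> \<le> (e0 * real i * lag_coeff p q \<theta> i) * x (t - int i)"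
      using dir x_nonneg by (auto simp: abs_mult intro!: mult_right_mono)
    also have "\<dots> = (e0 * real i) * (lag_coeff p q \<theta> i * x (t - int i))" by simp
    also have "\<dots> \<le> e0 * P * g * v t * (1 / \<mu>) ^ i" unfolding P_def using e by (intro linear_weight_le)
    finally show ?thesis .
  qed
  note dir_sum = series_bound[OF dir_term]
  have L: "v t * L = (\<Sum>m<p + q + 1. grad_garch_coeff p q \<theta> 0 m * h m) + (\<Sum>i. lag_coeff_dir p q \<theta> h i * x (t - int i))"
    unfolding L_def h_def by (rule path_score_dir)
  have "v t * \<bar>L\<bar> = \<bar>v t * L\<bar>" using v_nonneg[of t] by (simp add: abs_mult)
  also have "\<dots> \<le> \<theta> 0 / beta_gap\<^sup>2 * e0 + (e0 * P * g * v t) * Z"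
    unfolding L Z_def by (intro order_trans[OF abs_triangle_ineq] add_mono c0 dir_sum)
  also have "\<theta> 0 / beta_gap\<^sup>2 * e0 \<le> (v t * g) / beta_gap\<^sup>2 * e0"
    using vg e by (intro mult_right_mono divide_right_mono) auto
  also have "(v t * g) / beta_gap\<^sup>2 * e0 + (e0 * P * g * v t) * Z = v t * ((1 / beta_gap\<^sup>2 + P * Z) * e0 * g)"
    by (simp add: algebra_simps)
  also have "\<dots> \<le> v t * (lin_const \<mu> * e0 * g)"
    using v_nonneg e g1 beta_gap unfolding lin_const_def P_def Z_def
    by (intro mult_left_mono mult_right_mono) auto
  finally show ?B using v_pos[of t] by simp
  define a where "a = (\<lambda>i. (if i \<in> {1..n} then lag_coeff p q u i * x (t - int i) else 0)
     - lag_coeff p q \<theta> i * x (t - int i) - lag_coeff_dir p q \<theta> h i * x (t - int i))"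
  have a_bound: "\<bar>a i\<bar> \<le> ((e0\<^sup>2 + (1 / \<mu>) ^ n) * P * g * v t) * (1 / \<mu>) ^ i" for i
  proof (cases "i \<in> {1..n}")
    case True
    have "a i = (lag_coeff p q u i - lag_coeff p q \<theta> i - lag_coeff_dir p q \<theta> h i) * x (t - int i)"
      using True by (simp add: a_def algebra_simps)
    also have "\<bar>\<dots>\<bar> \<le> (e0\<^sup>2 * (real i)\<^sup>2 * \<mu> ^ i * lag_coeff p q \<theta> i) * x (t - int i)"
      unfolding abs_mult h_def using x_nonneg th u e e1
      by (simp add: abs_of_nonneg, intro mult_right_mono lag_coeff_taylor) auto
    also have "\<dots> = (e0\<^sup>2 * \<mu> ^ i) * ((real i)\<^sup>2 * (lag_coeff p q \<theta> i * x (t - int i)))"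
      by (simp only: mult_ac)
    also have "\<dots> \<le> (e0\<^sup>2 * \<mu> ^ i) * (P * g * v t * (1 / \<mu>) ^ (3 * i))"
    proof (rule mult_left_mono)
      have "(real i)\<^sup>2 \<le> (1 + real i)\<^sup>2" by (intro power_mono) auto
      then have "(real i)\<^sup>2 * (lag_coeff p q \<theta> i * x (t - int i)) \<le> (1 + real i)\<^sup>2 * (lag_coeff p q \<theta> i * x (t - int i))"
        by (intro mult_right_mono lag_term_nonneg)
      also note weighted_term_le
      finally show "(real i)\<^sup>2 * (lag_coeff p q \<theta> i * x (t - int i)) \<le> P * g * v t * (1 / \<mu>) ^ (3 * i)" by (simp add: P_def)
    qed (use mu in auto)
    also have "\<dots> = (e0\<^sup>2 * P * g * v t) * (1 / \<mu>) ^ (2 * i)"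
    proof -
      have "(1 / \<mu>) ^ (3 * i) = (1 / \<mu>) ^ i * (1 / \<mu>) ^ (2 * i)" by (simp add: power_add[symmetric])
      then show ?thesis using mu by (simp add: field_simps)
    qed
    also have "\<dots> \<le> ((e0\<^sup>2 + (1 / \<mu>) ^ n) * P * g * v t) * (1 / \<mu>) ^ i"
      using P g1 v_nonneg[of t] mu by (intro mult_mono inverse_power_mono mult_right_mono) auto
    finally show ?thesis .
  next
    case False
    then have i: "i = 0 \<or> n < i" by auto
    show ?thesis
    proof (cases "i = 0")
      case True
      then show ?thesis using P g1 v_nonneg[of t] mu by (simp add: a_def)
    next
      case False
      then have ni: "n < i" using i by auto
      have "a i = - (lag_coeff p q \<theta> i * x (t - int i)) - lag_coeff_dir p q \<theta> h i * x (t - int i)"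
        using ni by (simp add: a_def)
      also have "\<bar>\<dots>\<bar> \<le> lag_coeff p q \<theta> i * x (t - int i) + (e0 * real i * lag_coeff p q \<theta> i) * x (t - int i)"
        using dir[of i] x_nonneg[of "t - int i"] lag_term_nonneg[of i "t - int i"]
        by (intro order_trans[OF abs_triangle_ineq4] add_mono) (auto simp: abs_mult intro!: mult_right_mono)
      also have "\<dots> = (1 + e0 * real i) * (lag_coeff p q \<theta> i * x (t - int i))"
        by (simp add: algebra_simps)
      also have "\<dots> \<le> (1 + real i)\<^sup>2 * (lag_coeff p q \<theta> i * x (t - int i))"
      proof (intro mult_right_mono lag_term_nonneg)
        have "e0 * real i \<le> 1 * real i" using e1 by (intro mult_right_mono) auto
        then have "1 + e0 * real i \<le> (1 + real i) * 1" by simp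
        also have "\<dots> \<le> (1 + real i) * (1 + real i)" by (intro mult_left_mono) auto
        finally show "1 + e0 * real i \<le> (1 + real i)\<^sup>2" by (simp add: power2_eq_square)
      qed
      also note weighted_term_le
      also have "poly_weight \<mu> * g * v t * (1 / \<mu>) ^ (3 * i) \<le> P * g * v t * (1 / \<mu>) ^ (n + i)"
        unfolding P_def using P ni g1 v_nonneg[of t] by (intro mult_left_mono inverse_power_mono) (auto simp: P_def)
      also have "\<dots> = ((1 / \<mu>) ^ n * P * g * v t) * (1 / \<mu>) ^ i"
        by (simp add: power_add)
      also have "\<dots> \<le> ((e0\<^sup>2 + (1 / \<mu>) ^ n) * P * g * v t) * (1 / \<mu>) ^ i"
        using P g1 v_nonneg[of t] mu by (intro mult_right_mono) auto
      finally show ?thesis .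
    qed
  qed
  have "(\<Sum>i. if i \<in> {1..n} then lag_coeff p q u i * x (t - int i) else 0) = (\<Sum>i=1..n. lag_coeff p q u i * x (t - int i))"
    "summable (\<lambda>i. if i \<in> {1..n} then lag_coeff p q u i * x (t - int i) else 0)"
    using sums_If_finite_set[of "{1..n}" "\<lambda>i. lag_coeff p q u i * x (t - int i)"] by (auto simp: sums_iff)
  then have suma: "suminf a = (\<Sum>i=1..n. lag_coeff p q u i * x (t - int i)) - (\<Sum>i. lag_coeff p q \<theta> i * x (t - int i))
     - (\<Sum>i. lag_coeff_dir p q \<theta> h i * x (t - int i))"
    unfolding a_def using lag_summable[of t] dir_sum(1) by (simp add: suminf_diff[symmetric] summable_diff)
  have "v t * Y = garch_coeff p q u 0 + (\<Sum>i=1..n. lag_coeff p q u i * x (t - int i))"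
    using v_pos[of t] by (simp add: Y_def)
  then have "v t * (Y - 1 - L) = (garch_coeff p q u 0 - garch_coeff p q \<theta> 0 - (\<Sum>m<p + q + 1. grad_garch_coeff p q \<theta> 0 m * h m)) + suminf a"
    using v L suma by (simp add: right_diff_distrib)
  then have "v t * \<bar>Y - 1 - L\<bar> = \<bar>(garch_coeff p q u 0 - garch_coeff p q \<theta> 0 - (\<Sum>m<p + q + 1. grad_garch_coeff p q \<theta> 0 m * h m)) + suminf a\<bar>"
    using v_pos[of t] by (metis abs_mult abs_of_pos)
  also have "\<dots> \<le> 2 * \<theta> 0 / beta_gap ^ 3 * e0\<^sup>2 + ((e0\<^sup>2 + (1 / \<mu>) ^ n) * P * g * v t) * Z"
    unfolding Z_def by (intro order_trans[OF abs_triangle_ineq] add_mono c0 series_bound(2) a_bound)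
  also have "2 * \<theta> 0 / beta_gap ^ 3 * e0\<^sup>2 \<le> 2 * (v t * g) / beta_gap ^ 3 * (e0\<^sup>2 + (1 / \<mu>) ^ n)"
    using vg beta_gap mu t0 by (intro mult_mono divide_right_mono) auto
  also have "2 * (v t * g) / beta_gap ^ 3 * (e0\<^sup>2 + (1 / \<mu>) ^ n) + ((e0\<^sup>2 + (1 / \<mu>) ^ n) * P * g * v t) * Z
     = v t * ((2 / beta_gap ^ 3 + P * Z) * (e0\<^sup>2 + (1 / \<mu>) ^ n) * g)"
    by (simp add: algebra_simps)
  also have "\<dots> \<le> v t * (lin_const \<mu> * (e0\<^sup>2 + (1 / \<mu>) ^ n) * g)"
    using v_nonneg e g1 beta_gap mu unfolding lin_const_def P_def Z_def
    by (intro mult_left_mono mult_right_mono) auto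
  finally show ?A using v_pos[of t] by simp
qed

end

end

context garch_param
begin

text \<open>The constant \<open>C\<close> depends on the parameter, \<open>\<mu>\<close> and \<open>k\<close>, but not on the path, the time or the estimate.
The two smallness conditions force \<open>\<bar>Y - 1\<bar> \<le> 1/2\<close>, so that the Taylor expansion of \<open>Y \<mapsto> Y powr (- k / 2)\<close>
applies.\<close>

lemma residual_linearisation:
  assumes mu: "1 < \<mu>"
  shows "\<exists>C\<ge>0. \<forall>x v e t g u e0 n. garch_path p q \<theta> x v e \<longrightarrow> 1 \<le> g \<longrightarrow>
    (\<forall>i. lag_coeff p q \<theta> i * x (t - int i) \<le> v t * (g / \<mu> ^ (4 * i))) \<longrightarrow>
    v t = garch_coeff p q \<theta> 0 + (\<Sum>i. lag_coeff p q \<theta> i * x (t - int i)) \<longrightarrow>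
    (\<forall>m\<le>p + q. \<bar>u m - \<theta> m\<bar> \<le> e0 * \<theta> m) \<longrightarrow> 0 \<le> e0 \<longrightarrow> e0 \<le> beta_gap / 2 \<longrightarrow> 1 + e0 \<le> \<mu> \<longrightarrow>
    e0 * g \<le> 1 / (8 * lin_const \<mu>) \<longrightarrow> (1 / \<mu>) ^ n * g \<le> 1 / (8 * lin_const \<mu>) \<longrightarrow>
    \<bar>(1 / sqrt ((garch_coeff p q u 0 + (\<Sum>i=1..n. lag_coeff p q u i * x (t - int i))) / v t)) ^ k - 1
       + real k / 2 * (\<Sum>m<p + q + 1. garch_path.path_score p q \<theta> x v t m * (u m - \<theta> m))\<bar>
     \<le> C * (e0\<^sup>2 + (1 / \<mu>) ^ n) * g\<^sup>2"
proof -
  obtain C where C: "0 \<le> C" "\<And>Y. \<bar>Y - 1\<bar> \<le> (1/2 :: real) \<Longrightarrow> \<bar>(1 / sqrt Y) ^ k - 1 + real k / 2 * (Y - 1)\<bar> \<le> C * (Y - 1)\<^sup>2"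
    using inverse_sqrt_power_taylor by blast
  define K where "K = lin_const \<mu>"
  have K: "0 < K" using lin_const_pos[OF mu] by (simp add: K_def)
  have "\<bar>(1 / sqrt Y) ^ k - 1 + real k / 2 * L\<bar> \<le> (C * (8 * K\<^sup>2) + real k / 2 * K) * (e0\<^sup>2 + r) * g\<^sup>2"
    if YL: "\<bar>Y - 1 - L\<bar> \<le> K * (e0\<^sup>2 + r) * g" "\<bar>L\<bar> \<le> K * e0 * g" and e0: "0 \<le> e0" "e0 \<le> 1"
      and small: "e0 * g \<le> 1 / (8 * K)" "r * g \<le> 1 / (8 * K)" and r: "0 \<le> r" "r \<le> 1" and g: "1 \<le> g" for Y L e0 r g :: real
  proof -
    have e2: "e0\<^sup>2 \<le> e0" using e0 by (simp add: power2_eq_square mult_left_le)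
    have Y1: "\<bar>Y - 1\<bar> \<le> K * ((2 * e0 + r) * g)"
    proof -
      have "\<bar>Y - 1\<bar> \<le> K * (e0\<^sup>2 + r) * g + K * e0 * g" using YL by linarith
      also have "\<dots> = K * ((e0\<^sup>2 + r + e0) * g)" by (simp add: algebra_simps)
      also have "\<dots> \<le> K * ((2 * e0 + r) * g)" using e2 K g by (intro mult_left_mono mult_right_mono) auto
      finally show ?thesis .
    qed
    have "(2 * e0 + r) * g \<le> 3 * (1 / (8 * K))" using small by (simp add: distrib_right)
    then have "K * ((2 * e0 + r) * g) \<le> K * (3 * (1 / (8 * K)))" using K by (intro mult_left_mono) auto
    also have "\<dots> \<le> 1/2" using K by simp
    finally have half: "\<bar>Y - 1\<bar> \<le> 1/2" using Y1 by linarith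
    have "(Y - 1)\<^sup>2 \<le> (K * ((2 * e0 + r) * g))\<^sup>2"
      using Y1 power_mono[of "\<bar>Y - 1\<bar>" _ 2] by simp
    also have "\<dots> = K\<^sup>2 * (2 * e0 + r)\<^sup>2 * g\<^sup>2" by (simp add: power_mult_distrib)
    also have "(2 * e0 + r)\<^sup>2 \<le> 8 * (e0\<^sup>2 + r)"
    proof -
      have "r\<^sup>2 \<le> r" using r by (simp add: power2_eq_square mult_left_le)
      then have "0 \<le> (2 * e0 - r)\<^sup>2 + 2 * (r - r\<^sup>2) + 6 * r" using r by (intro add_nonneg_nonneg) auto
      also have "\<dots> = 8 * (e0\<^sup>2 + r) - (2 * e0 + r)\<^sup>2" by (simp add: power2_eq_square algebra_simps)
      finally show ?thesis by simp
    qed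
    finally have Y2: "(Y - 1)\<^sup>2 \<le> K\<^sup>2 * (8 * (e0\<^sup>2 + r)) * g\<^sup>2" using K by (simp add: mult_left_mono mult_right_mono)
    have gg: "g \<le> g\<^sup>2" using g by (simp add: power2_eq_square)
    have "real k / 2 * (Y - 1 - L) = real k / 2 * (Y - 1) - real k / 2 * L" by (rule right_diff_distrib)
    then have "(1 / sqrt Y) ^ k - 1 + real k / 2 * L = ((1 / sqrt Y) ^ k - 1 + real k / 2 * (Y - 1)) - real k / 2 * (Y - 1 - L)"
      by linarith
    also have "\<bar>\<dots>\<bar> \<le> \<bar>(1 / sqrt Y) ^ k - 1 + real k / 2 * (Y - 1)\<bar> + real k / 2 * \<bar>Y - 1 - L\<bar>"
      by (intro order_trans[OF abs_triangle_ineq4] add_mono) (auto simp: abs_mult)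
    also have "\<dots> \<le> C * (K\<^sup>2 * (8 * (e0\<^sup>2 + r)) * g\<^sup>2) + real k / 2 * (K * (e0\<^sup>2 + r) * g\<^sup>2)"
    proof (intro add_mono mult_left_mono)
      show "\<bar>(1 / sqrt Y) ^ k - 1 + real k / 2 * (Y - 1)\<bar> \<le> C * (K\<^sup>2 * (8 * (e0\<^sup>2 + r)) * g\<^sup>2)"
        using C(2)[OF half] mult_left_mono[OF Y2 C(1)] by linarith
      have "K * (e0\<^sup>2 + r) * g \<le> K * (e0\<^sup>2 + r) * g\<^sup>2" using gg K r by (intro mult_left_mono) auto
      then show "\<bar>Y - 1 - L\<bar> \<le> K * (e0\<^sup>2 + r) * g\<^sup>2" using YL(1) by linarith
    qed auto
    also have "\<dots> = (C * (8 * K\<^sup>2) + real k / 2 * K) * (e0\<^sup>2 + r) * g\<^sup>2" by (simp add: algebra_simps)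
    finally show ?thesis .
  qed
  note main = this
  show ?thesis
  proof (intro exI[of _ "C * (8 * K\<^sup>2) + real k / 2 * K"] conjI allI impI)
    show "0 \<le> C * (8 * K\<^sup>2) + real k / 2 * K" using C K by simp
    fix x v e :: "int \<Rightarrow> real" and t :: int and g :: real and u :: "nat \<Rightarrow> real" and e0 :: real and n :: nat
    assume path: "garch_path p q \<theta> x v e" and g: "1 \<le> g"
      and terms: "\<forall>i. lag_coeff p q \<theta> i * x (t - int i) \<le> v t * (g / \<mu> ^ (4 * i))"
      and v: "v t = garch_coeff p q \<theta> 0 + (\<Sum>i. lag_coeff p q \<theta> i * x (t - int i))"
      and u: "\<forall>m\<le>p + q. \<bar>u m - \<theta> m\<bar> \<le> e0 * \<theta> m"
      and e0: "0 \<le> e0" "e0 \<le> beta_gap / 2" "1 + e0 \<le> \<mu>"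
      and small: "e0 * g \<le> 1 / (8 * lin_const \<mu>)" "(1 / \<mu>) ^ n * g \<le> 1 / (8 * lin_const \<mu>)"
    interpret garch_path p q \<theta> x v e by fact
    have u': "\<bar>u m - \<theta> m\<bar> \<le> e0 * \<theta> m" if "m \<le> p + q" for m using u that by simp
    have r: "0 \<le> (1 / \<mu>) ^ n" "(1 / \<mu>) ^ n \<le> 1" using mu by (auto intro: power_le_one)
    have "e0 \<le> 1" using e0 beta_gap by simp
    then show "\<bar>(1 / sqrt ((garch_coeff p q u 0 + (\<Sum>i=1..n. lag_coeff p q u i * x (t - int i))) / v t)) ^ k - 1
       + real k / 2 * (\<Sum>m<p + q + 1. path_score t m * (u m - \<theta> m))\<bar>
     \<le> (C * (8 * K\<^sup>2) + real k / 2 * K) * (e0\<^sup>2 + (1 / \<mu>) ^ n) * g\<^sup>2"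
      using linearisation(1)[OF mu g terms[rule_format] u' e0 v, of n] linearisation(2)[OF mu g terms[rule_format] u' e0 v]
        small e0 r g unfolding K_def[symmetric]
      by (intro main) auto
  qed
qed

end

section \<open>The stationary solution as a functional of the innovations\<close>

locale garch_model = garch_noise +
  fixes X \<sigma> :: "int \<Rightarrow> 'a \<Rightarrow> real"
  assumes solution: "garch_solution M p q \<theta> \<epsilon> X \<sigma>"
begin

lemma X_measurable [measurable]: "X t \<in> borel_measurable M"
  and sigma_measurable [measurable]: "\<sigma> t \<in> borel_measurable M"
  using solution by (auto simp: garch_solution_def)

lemma AE_equations:
  "AE \<omega> in M. \<forall>t. 0 \<le> \<sigma> t \<omega> \<and> X t \<omega> = \<sigma> t \<omega> * \<epsilon> t \<omega> \<and>
     (\<sigma> t \<omega>)\<^sup>2 = \<theta> 0 + (\<Sum>i=1..p. \<theta> i * (X (t - int i) \<omega>)\<^sup>2) + (\<Sum>j=1..q. \<theta> (p + j) * (\<sigma> (t - int j) \<omega>)\<^sup>2)"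
  using solution unfolding garch_solution_def AE_all_countable by blast

abbreviation on_path :: "'a \<Rightarrow> bool" where
  "on_path \<omega> \<equiv> garch_path p q \<theta> (\<lambda>t. (X t \<omega>)\<^sup>2) (\<lambda>t. (\<sigma> t \<omega>)\<^sup>2) (\<lambda>t. \<epsilon> t \<omega>)"

lemma AE_path: "AE \<omega> in M. on_path \<omega> \<and> (\<forall>t. 0 < \<sigma> t \<omega> \<and> X t \<omega> = \<sigma> t \<omega> * \<epsilon> t \<omega>)"
  using AE_equations
proof eventually_elim
  case (elim \<omega>)
  have path: "on_path \<omega>"
  proof
    fix t
    show "(\<sigma> t \<omega>)\<^sup>2 = \<theta> 0 + (\<Sum>i=1..p. \<theta> i * (X (t - int i) \<omega>)\<^sup>2) + (\<Sum>j=1..q. \<theta> (p + j) * (\<sigma> (t - int j) \<omega>)\<^sup>2)"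
      using elim by blast
    have "X t \<omega> = \<sigma> t \<omega> * \<epsilon> t \<omega>" using elim by blast
    then show "(X t \<omega>)\<^sup>2 = (\<sigma> t \<omega>)\<^sup>2 * (\<epsilon> t \<omega>)\<^sup>2" by (simp only: power_mult_distrib)
    show "0 \<le> (\<sigma> t \<omega>)\<^sup>2" by simp
  qed
  then interpret garch_path p q \<theta> "\<lambda>t. (X t \<omega>)\<^sup>2" "\<lambda>t. (\<sigma> t \<omega>)\<^sup>2" "\<lambda>t. \<epsilon> t \<omega>" .
  have "0 < \<sigma> t \<omega>" for t
  proof -
    have "\<sigma> t \<omega> \<noteq> 0" using v_pos[of t] by auto
    moreover have "0 \<le> \<sigma> t \<omega>" using elim by blast
    ultimately show ?thesis by simp
  qed
  then show ?case using path elim by blast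
qed

text \<open>The map for \<open>t = 0\<close> serves all times: since \<open>\<epsilon> = X / \<sigma>\<close>, the identity \<open>\<sigma>\<^sub>0 = f(\<epsilon>\<^bsub>-1\<^esub>, \<epsilon>\<^bsub>-2\<^esub>, \<dots>)\<close> is an event
of the process \<open>(X, \<sigma>)\<close>, which is strictly stationary.\<close>

lemma sigma_functional:
  "\<exists>f\<in>borel_measurable (Pi\<^sub>M UNIV (\<lambda>_. borel)). \<forall>t. AE \<omega> in M. \<sigma> t \<omega> = f (past (t - 1) \<omega>)"
proof -
  obtain f where f [measurable]: "f \<in> borel_measurable (Pi\<^sub>M (UNIV :: nat set) (\<lambda>_. borel :: real measure))"
    and f0: "AE \<omega> in M. \<sigma> 0 \<omega> = f (\<lambda>i. \<epsilon> (0 - 1 - int i) \<omega>)"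
    using solution unfolding garch_solution_def by blast
  let ?PZ = "Pi\<^sub>M (UNIV :: int set) (\<lambda>_. borel :: (real \<times> real) measure)"
  define Z where "Z = (\<lambda>h \<omega> t. (X (t + h) \<omega>, \<sigma> (t + h) \<omega>))"
  have Zm [measurable]: "Z h \<in> measurable M ?PZ" for h
  proof -
    have "(\<lambda>\<omega>. (X (t + h) \<omega>, \<sigma> (t + h) \<omega>)) \<in> measurable M borel" for t
      by (simp add: borel_prod[symmetric])
    then show ?thesis unfolding Z_def by (intro measurable_PiM_single') auto
  qed
  have stat: "distr M ?PZ (Z h) = distr M ?PZ (Z 0)" for h
    using solution unfolding garch_solution_def strictly_stationary_def Z_def by simp
  define P where "P = (\<lambda>z :: int \<Rightarrow> real \<times> real. snd (z 0) = f (\<lambda>i. fst (z (- 1 - int i)) / snd (z (- 1 - int i))))"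
  have fst_m: "(\<lambda>z. fst (z i)) \<in> borel_measurable ?PZ" and snd_m: "(\<lambda>z. snd (z i)) \<in> borel_measurable ?PZ" for i
  proof -
    have c: "(\<lambda>z. z i) \<in> measurable ?PZ (borel :: (real \<times> real) measure)" by simp
    have "(fst :: real \<times> real \<Rightarrow> real) \<in> borel_measurable borel" "(snd :: real \<times> real \<Rightarrow> real) \<in> borel_measurable borel"
      by (auto intro!: borel_measurable_continuous_onI continuous_intros)
    from measurable_compose[OF c this(1)] measurable_compose[OF c this(2)]
    show "(\<lambda>z. fst (z i)) \<in> borel_measurable ?PZ" "(\<lambda>z. snd (z i)) \<in> borel_measurable ?PZ" by auto
  qed
  have "(\<lambda>z i. fst (z (- 1 - int i)) / snd (z (- 1 - int i))) \<in> measurable ?PZ (Pi\<^sub>M (UNIV :: nat set) (\<lambda>_. borel))"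
    using fst_m snd_m by (intro measurable_PiM_single' borel_measurable_divide) auto
  from measurable_compose[OF this f]
  have fm: "(\<lambda>z. f (\<lambda>i. fst (z (- 1 - int i)) / snd (z (- 1 - int i)))) \<in> borel_measurable ?PZ" .
  have Pm: "Measurable.pred ?PZ P"
    unfolding P_def pred_def by (rule measurable_equality_set[OF snd_m fm])
  have iff: "(AE \<omega> in M. P (Z h \<omega>)) \<longleftrightarrow> (AE z in distr M ?PZ (Z h). P z)" for h
    using Pm by (subst AE_distr_iff) (auto simp: pred_def)
  have PZ: "P (Z h \<omega>) \<longleftrightarrow> \<sigma> h \<omega> = f (past (h - 1) \<omega>)" if "\<forall>t. 0 < \<sigma> t \<omega> \<and> X t \<omega> = \<sigma> t \<omega> * \<epsilon> t \<omega>" for h \<omega>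
  proof -
    have "X t \<omega> / \<sigma> t \<omega> = \<epsilon> t \<omega>" for t
    proof -
      have "X t \<omega> = \<sigma> t \<omega> * \<epsilon> t \<omega>" "0 < \<sigma> t \<omega>" using that by blast+
      then show ?thesis by simp
    qed
    then have "(\<lambda>i. fst (Z h \<omega> (- 1 - int i)) / snd (Z h \<omega> (- 1 - int i))) = past (h - 1) \<omega>"
      by (simp add: Z_def past_def algebra_simps)
    then show ?thesis by (simp add: P_def) (simp add: Z_def)
  qed
  have "AE \<omega> in M. P (Z 0 \<omega>)"
    using AE_path f0
  proof eventually_elim
    case (elim \<omega>)
    then show ?case using PZ[of \<omega> 0] by (simp add: past_def)
  qed
  then have "AE \<omega> in M. P (Z h \<omega>)" for h
    unfolding iff stat[of h] .
  then have "AE \<omega> in M. \<sigma> h \<omega> = f (past (h - 1) \<omega>)" for h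
    using AE_path by (rule AE_mp[OF AE_conjI]) (auto simp: PZ intro!: AE_I2)
  then show ?thesis using f by blast
qed

definition sigma_map :: "(nat \<Rightarrow> real) \<Rightarrow> real" where
  "sigma_map = (SOME f. f \<in> borel_measurable (Pi\<^sub>M UNIV (\<lambda>_. borel)) \<and> (\<forall>t. AE \<omega> in M. \<sigma> t \<omega> = f (past (t - 1) \<omega>)))"

lemma sigma_map_measurable [measurable]: "sigma_map \<in> borel_measurable (Pi\<^sub>M UNIV (\<lambda>_. borel))"
  and AE_sigma_map: "AE \<omega> in M. \<sigma> t \<omega> = sigma_map (past (t - 1) \<omega>)"
  using someI_ex[of "\<lambda>f. f \<in> borel_measurable (Pi\<^sub>M UNIV (\<lambda>_. borel)) \<and> (\<forall>t. AE \<omega> in M. \<sigma> t \<omega> = f (past (t - 1) \<omega>))"]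
    sigma_functional unfolding sigma_map_def[symmetric] by blast+

text \<open>\<open>X\<^bsub>t-1-i\<^esub>\<close> and \<open>\<partial> log \<sigma>\<^sub>t\<^sup>2(\<theta>)\<close> as functions of the past \<open>y = (\<epsilon>\<^bsub>t-1\<^esub>, \<epsilon>\<^bsub>t-2\<^esub>, \<dots>)\<close>.\<close>

definition X_map :: "nat \<Rightarrow> (nat \<Rightarrow> real) \<Rightarrow> real" where
  "X_map i y = sigma_map (\<lambda>j. y (Suc i + j)) * y i"

lemma X_map_measurable [measurable]: "X_map i \<in> borel_measurable (Pi\<^sub>M UNIV (\<lambda>_. borel))"
proof -
  have "(\<lambda>y j. y (Suc i + j)) \<in> measurable (Pi\<^sub>M UNIV (\<lambda>_. borel :: real measure)) (Pi\<^sub>M UNIV (\<lambda>_. borel))"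
    by (intro measurable_PiM_single') auto
  from measurable_compose[OF this sigma_map_measurable]
  have "(\<lambda>y. sigma_map (\<lambda>j. y (Suc i + j))) \<in> borel_measurable (Pi\<^sub>M UNIV (\<lambda>_. borel))" .
  moreover have "(\<lambda>y :: nat \<Rightarrow> real. y i) \<in> borel_measurable (Pi\<^sub>M UNIV (\<lambda>_. borel))" by simp
  ultimately show ?thesis unfolding X_map_def by (rule borel_measurable_times)
qed

definition score_map :: "nat \<Rightarrow> (nat \<Rightarrow> real) \<Rightarrow> real" where
  "score_map m y = (grad_garch_coeff p q \<theta> 0 m + (\<Sum>i. grad_garch_coeff p q \<theta> (Suc i) m * (X_map i y)\<^sup>2))
     / (garch_coeff p q \<theta> 0 + (\<Sum>i. garch_coeff p q \<theta> (Suc i) * (X_map i y)\<^sup>2))"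

lemma score_map_measurable [measurable]: "score_map m \<in> borel_measurable (Pi\<^sub>M UNIV (\<lambda>_. borel))"
  unfolding score_map_def by measurable

lemma AE_score_map: "AE \<omega> in M. \<forall>t m. grad_log_sigma2 p q X t \<theta> \<omega> m = score_map m (past (t - 1) \<omega>)"
proof -
  have "AE \<omega> in M. \<forall>t. \<sigma> t \<omega> = sigma_map (past (t - 1) \<omega>)"
    unfolding AE_all_countable using AE_sigma_map by blast
  then show ?thesis using AE_path
  proof eventually_elim
    case (elim \<omega>)
    have X: "X s \<omega> = \<sigma> s \<omega> * \<epsilon> s \<omega>" and S: "\<sigma> s \<omega> = sigma_map (past (s - 1) \<omega>)" for s
      using elim by blast+
    have XM: "X (t - int (Suc i)) \<omega> = X_map i (past (t - 1) \<omega>)" for t i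
    proof -
      have "past (t - int (Suc i) - 1) \<omega> = (\<lambda>j. past (t - 1) \<omega> (Suc i + j))"
        by (auto simp: past_def fun_eq_iff algebra_simps)
      moreover have "X (t - int (Suc i)) \<omega> = sigma_map (past (t - int (Suc i) - 1) \<omega>) * \<epsilon> (t - int (Suc i)) \<omega>"
        by (simp only: X S)
      moreover have "\<epsilon> (t - int (Suc i)) \<omega> = past (t - 1) \<omega> i" by (simp add: past_def algebra_simps)
      ultimately show ?thesis by (simp add: X_map_def)
    qed
    show ?case unfolding grad_log_sigma2_def score_map_def XM by simp
  qed
qed

end

section \<open>Events of high probability\<close>

context prob_space
begin

text \<open>Outside an event of probability at most \<open>\<delta>\<close>, for all large \<open>n\<close>. Stating it through an exceptional event, which may
depend on \<open>n\<close>, avoids questions of measurability for \<open>P\<close>.\<close>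

definition whp :: "real \<Rightarrow> (nat \<Rightarrow> 'a \<Rightarrow> bool) \<Rightarrow> bool" where
  "whp \<delta> P \<longleftrightarrow> (\<forall>\<^sub>F n in sequentially. \<exists>A\<in>events. prob A \<le> \<delta> \<and> (\<forall>\<omega>\<in>space M - A. P n \<omega>))"

lemma whp_conj:
  assumes "whp a P" "whp b Q"
  shows "whp (a + b) (\<lambda>n \<omega>. P n \<omega> \<and> Q n \<omega>)"
  using assms unfolding whp_def
proof eventually_elim
  case (elim n)
  then obtain A B where "A \<in> events" "prob A \<le> a" "\<forall>\<omega>\<in>space M - A. P n \<omega>" "B \<in> events" "prob B \<le> b" "\<forall>\<omega>\<in>space M - B. Q n \<omega>"
    by blast
  then show ?case
    using measure_Un_le[of A M B] by (intro bexI[of _ "A \<union> B"]) auto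
qed

lemma whp_mono:
  assumes "whp a P" "\<forall>\<^sub>F n in sequentially. \<forall>\<omega>\<in>space M. P n \<omega> \<longrightarrow> Q n \<omega>" "a \<le> b"
  shows "whp b Q"
  using assms(1,2) unfolding whp_def
proof eventually_elim
  case (elim n)
  then obtain A where "A \<in> events" "prob A \<le> a" "\<forall>\<omega>\<in>space M - A. P n \<omega>" by blast
  then show ?case using elim(2) assms(3) by (intro bexI[of _ A]) auto
qed

lemma whp_AE:
  assumes "AE \<omega> in M. P \<omega>" "0 \<le> a"
  shows "whp a (\<lambda>n. P)"
proof -
  obtain N where "{\<omega> \<in> space M. \<not> P \<omega>} \<subseteq> N" "emeasure M N = 0" "N \<in> events"
    using assms(1) by (rule AE_E)
  then show ?thesis
    unfolding whp_def using assms(2) by (intro always_eventually allI bexI[of _ N]) (auto simp: measure_def)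
qed

lemma whp_ball:
  assumes "finite I" "\<And>i. i \<in> I \<Longrightarrow> whp a (P i)"
  shows "whp (real (card I) * a) (\<lambda>n \<omega>. \<forall>i\<in>I. P i n \<omega>)"
  using assms
proof (induction I rule: finite_induct)
  case empty
  show ?case unfolding whp_def by (intro always_eventually allI bexI[of _ "{}"]) auto
next
  case (insert i I)
  have "whp (a + real (card I) * a) (\<lambda>n \<omega>. P i n \<omega> \<and> (\<forall>i\<in>I. P i n \<omega>))"
    using insert by (intro whp_conj) auto
  then show ?case using insert by (simp add: algebra_simps)
qed

lemma whp_markov:
  assumes "\<forall>\<^sub>F n in sequentially. finite (I n) \<and> (\<Sum>i\<in>I n. expectation (Y n i) / a n i) \<le> \<delta> \<and>
     (\<forall>i\<in>I n. integrable M (Y n i) \<and> (AE \<omega> in M. 0 \<le> Y n i \<omega>) \<and> 0 < a n i)"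
  shows "whp \<delta> (\<lambda>n \<omega>. \<forall>i\<in>I n. Y n i \<omega> < (a n i :: real))"
  using assms unfolding whp_def
proof eventually_elim
  case (elim n)
  define A where "A = (\<Union>i\<in>I n. {\<omega> \<in> space M. a n i \<le> Y n i \<omega>})"
  have ev: "{\<omega> \<in> space M. a n i \<le> Y n i \<omega>} \<in> events" if "i \<in> I n" for i
  proof -
    have [measurable]: "Y n i \<in> borel_measurable M" using elim that by auto
    show ?thesis by measurable
  qed
  then have A: "A \<in> events" unfolding A_def using elim by (intro sets.finite_UN) auto
  have "prob A \<le> (\<Sum>i\<in>I n. prob {\<omega> \<in> space M. a n i \<le> Y n i \<omega>})"
    unfolding A_def using elim ev by (intro finite_measure_subadditive_finite) auto
  also have "\<dots> \<le> (\<Sum>i\<in>I n. expectation (Y n i) / a n i)"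
    using elim by (intro sum_mono integral_Markov_inequality_measure[where A="{}"]) auto
  finally have "prob A \<le> \<delta>" using elim by simp
  then show ?case using A by (intro bexI[of _ A]) (auto simp: A_def not_le)
qed

lemma tight_single:
  fixes Y :: "'a \<Rightarrow> real"
  assumes [measurable]: "Y \<in> borel_measurable M" and \<delta>: "0 < \<delta>"
  shows "\<exists>K>0. whp \<delta> (\<lambda>n \<omega>. Y \<omega> \<le> K)"
proof -
  define A where "A = (\<lambda>K::nat. {\<omega> \<in> space M. real K < Y \<omega>})"
  have Am: "A K \<in> events" for K unfolding A_def by measurable
  have "(\<lambda>K. prob (A K)) \<longlonglongrightarrow> prob (\<Inter>K. A K)"
    by (intro finite_Lim_measure_decseq) (auto simp: Am A_def decseq_def)
  moreover have "(\<Inter>K. A K) = {}"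
  proof -
    have "\<omega> \<notin> (\<Inter>K. A K)" for \<omega>
    proof
      assume "\<omega> \<in> (\<Inter>K. A K)"
      then have "real K < Y \<omega>" for K by (auto simp: A_def)
      then show False using real_arch_simple[of "Y \<omega>"] by (meson not_le)
    qed
    then show ?thesis by blast
  qed
  ultimately have "(\<lambda>K. prob (A K)) \<longlonglongrightarrow> 0" by simp
  then have "\<forall>\<^sub>F K in sequentially. prob (A K) < \<delta>" using \<delta> by (rule order_tendstoD)
  then have "\<forall>\<^sub>F K in sequentially. prob (A K) < \<delta> \<and> 0 < K" using eventually_gt_at_top[of 0] by eventually_elim auto
  then obtain K where K: "prob (A K) < \<delta>" "0 < K" using eventually_happens'[of sequentially] by auto
  then show ?thesis unfolding whp_def
    using Am by (intro exI[of _ "real K"] conjI always_eventually allI bexI[of _ "A K"]) (auto simp: A_def not_less)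
qed

end

section \<open>Stochastic bounds along the sample\<close>

locale garch_envelope = garch_model +
  fixes \<mu> :: real and k :: nat
  assumes mu: "1 < \<mu>"
    and envelope_summable: "\<And>t. AE \<omega> in M. summable (\<lambda>i. \<mu> ^ (12 * i) * decay i (past t \<omega>))"
    and envelope_integrable: "\<And>t. integrable M (\<lambda>\<omega>. envelope \<mu> (past t \<omega>))"
    and noise_moment: "integrable M (\<lambda>\<omega>. \<bar>\<epsilon> 0 \<omega>\<bar> ^ k)"
begin

definition env :: "int \<Rightarrow> 'a \<Rightarrow> real" where "env t \<omega> = envelope \<mu> (past (t - 1) \<omega>)"

lemma env_measurable [measurable]: "env t \<in> borel_measurable M"
  unfolding env_def by measurable

definition env_mean :: real where "env_mean = expectation (\<lambda>\<omega>. envelope \<mu> (past 0 \<omega>))"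

lemma env_expectation: "integrable M (env t)" "expectation (env t) = env_mean"
  unfolding env_def env_mean_def using envelope_integrable[of "t - 1"]
  by (auto intro: expectation_past_shift)

text \<open>The almost sure event on which the remaining argument is carried out path by path.\<close>

definition good :: "'a \<Rightarrow> bool" where
  "good \<omega> \<longleftrightarrow> on_path \<omega> \<and> (\<forall>t. 0 < \<sigma> t \<omega> \<and> X t \<omega> = \<sigma> t \<omega> * \<epsilon> t \<omega>)
    \<and> (\<forall>t. 1 \<le> env t \<omega>)
    \<and> (\<forall>t i. lag_coeff p q \<theta> i * (X (t - int i) \<omega>)\<^sup>2 \<le> (\<sigma> t \<omega>)\<^sup>2 * (root 3 (env t \<omega>) / \<mu> ^ (4 * i)))
    \<and> (\<forall>t. (\<sigma> t \<omega>)\<^sup>2 = garch_coeff p q \<theta> 0 + (\<Sum>i. lag_coeff p q \<theta> i * (X (t - int i) \<omega>)\<^sup>2))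
    \<and> (\<forall>t m. m \<le> p + q \<longrightarrow> score_map m (past (t - 1) \<omega>)
          = garch_path.path_score p q \<theta> (\<lambda>t. (X t \<omega>)\<^sup>2) (\<lambda>t. (\<sigma> t \<omega>)\<^sup>2) t m)"

lemma goodD:
  assumes "good \<omega>"
  shows "on_path \<omega>" "0 < \<sigma> t \<omega>" "X t \<omega> = \<sigma> t \<omega> * \<epsilon> t \<omega>" "1 \<le> env t \<omega>"
    "lag_coeff p q \<theta> i * (X (t - int i) \<omega>)\<^sup>2 \<le> (\<sigma> t \<omega>)\<^sup>2 * (root 3 (env t \<omega>) / \<mu> ^ (4 * i))"
    "(\<sigma> t \<omega>)\<^sup>2 = garch_coeff p q \<theta> 0 + (\<Sum>i. lag_coeff p q \<theta> i * (X (t - int i) \<omega>)\<^sup>2)"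
    "m \<le> p + q \<Longrightarrow> score_map m (past (t - 1) \<omega>) = garch_path.path_score p q \<theta> (\<lambda>t. (X t \<omega>)\<^sup>2) (\<lambda>t. (\<sigma> t \<omega>)\<^sup>2) t m"
  using assms unfolding good_def by blast+

lemma root_env:
  assumes "1 \<le> env t \<omega>"
  shows "1 \<le> root 3 (env t \<omega>)" "(root 3 (env t \<omega>))\<^sup>2 \<le> env t \<omega>" "root 3 (env t \<omega>) \<le> env t \<omega>"
    "root 3 (env t \<omega>) ^ 3 = env t \<omega>"
proof -
  define g where "g = root 3 (env t \<omega>)"
  have g: "1 \<le> g" "g ^ 3 = env t \<omega>" using assms by (auto simp: g_def)
  have "g ^ 2 \<le> g ^ 3" "g ^ 1 \<le> g ^ 3" using g by (intro power_increasing; simp)+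
  then show "1 \<le> root 3 (env t \<omega>)" "(root 3 (env t \<omega>))\<^sup>2 \<le> env t \<omega>" "root 3 (env t \<omega>) \<le> env t \<omega>"
    "root 3 (env t \<omega>) ^ 3 = env t \<omega>"
    using g unfolding g_def[symmetric] by auto
qed

lemma AE_good: "AE \<omega> in M. good \<omega>"
proof -
  have "AE \<omega> in M. \<forall>t. summable (\<lambda>i. \<mu> ^ (12 * i) * decay i (past t \<omega>))"
    unfolding AE_all_countable using envelope_summable by blast
  then show ?thesis using AE_path AE_score_map
  proof eventually_elim
    case (elim \<omega>)
    interpret path: garch_path p q \<theta> "\<lambda>t. (X t \<omega>)\<^sup>2" "\<lambda>t. (\<sigma> t \<omega>)\<^sup>2" "\<lambda>t. \<epsilon> t \<omega>"
      using elim by blast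
    note D = decay_le_envelope[OF mu elim(1)[rule_format]]
    have past: "past (t - 1) \<omega> = (\<lambda>l. \<epsilon> (t - 1 - int l) \<omega>)" for t by (simp add: past_def)
    have e1: "1 \<le> env t \<omega>" for t unfolding env_def by (rule D)
    have term_le: "lag_coeff p q \<theta> i * (X (t - int i) \<omega>)\<^sup>2 \<le> (\<sigma> t \<omega>)\<^sup>2 * (root 3 (env t \<omega>) / \<mu> ^ (4 * i))" for t i
    proof -
      have "lag_coeff p q \<theta> i * (X (t - int i) \<omega>)\<^sup>2 \<le> (\<sigma> t \<omega>)\<^sup>2 * decay i (past (t - 1) \<omega>)"
        unfolding past by (rule path.lag_term_le)
      also have "decay i (past (t - 1) \<omega>) \<le> root 3 (env t \<omega>) / \<mu> ^ (4 * i)"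
        using D(2)[of i "t - 1"] mu by (simp add: env_def field_simps)
      finally show ?thesis by (simp add: mult_left_mono)
    qed
    have expansion: "(\<sigma> t \<omega>)\<^sup>2 = garch_coeff p q \<theta> 0 + (\<Sum>i. lag_coeff p q \<theta> i * (X (t - int i) \<omega>)\<^sup>2)" for t
      using D(3)[of "t - 1"] unfolding past by (rule path.v_expansion)
    have score: "score_map m (past (t - 1) \<omega>) = path.path_score t m" if m: "m \<le> p + q" for t m
    proof -
      have s: "summable (\<lambda>i. lag_coeff_grad p q \<theta> i m * (X (t - int i) \<omega>)\<^sup>2)"
        by (rule path.grad_series(1)[OF mu root_env(1)[OF e1] term_le m order_refl theta_pos[OF m]])
      have 1: "(\<Sum>i. grad_garch_coeff p q \<theta> (Suc i) m * (X (t - int (Suc i)) \<omega>)\<^sup>2)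
        = (\<Sum>i. lag_coeff_grad p q \<theta> i m * (X (t - int i) \<omega>)\<^sup>2)"
        using suminf_split_head[OF s] by (simp add: grad_garch_coeff_pos)
      have 2: "(\<Sum>i. garch_coeff p q \<theta> (Suc i) * (X (t - int (Suc i)) \<omega>)\<^sup>2)
        = (\<Sum>i. lag_coeff p q \<theta> i * (X (t - int i) \<omega>)\<^sup>2)"
        using suminf_split_head[OF path.lag_summable[of t]] by (simp add: garch_coeff_pos)
      have "score_map m (past (t - 1) \<omega>) = grad_log_sigma2 p q X t \<theta> \<omega> m" using elim(3) by simp
      also have "\<dots> = path.path_score t m"
        unfolding grad_log_sigma2_def path.path_score_def 1 2 expansion[of t] ..
      finally show ?thesis .
    qed
    show ?case unfolding good_def using elim(2) e1 term_le expansion score by blast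
  qed
qed

lemma score_integrable: "integrable M (\<lambda>\<omega>. score_map m (past t \<omega>))" if "m \<le> p + q"
proof (rule Bochner_Integration.integrable_bound)
  show "integrable M (\<lambda>\<omega>. score_const \<mu> (\<theta> m) * env (t + 1) \<omega>)"
    using env_expectation by simp
  show "AE \<omega> in M. norm (score_map m (past t \<omega>)) \<le> norm (score_const \<mu> (\<theta> m) * env (t + 1) \<omega>)"
    using AE_good
  proof eventually_elim
    case (elim \<omega>)
    interpret path: garch_path p q \<theta> "\<lambda>t. (X t \<omega>)\<^sup>2" "\<lambda>t. (\<sigma> t \<omega>)\<^sup>2" "\<lambda>t. \<epsilon> t \<omega>"
      by (rule goodD[OF elim])
    note r = root_env[OF goodD(4)[OF elim]]
    have "\<bar>path.path_score (t + 1) m\<bar> \<le> score_const \<mu> (\<theta> m) * root 3 (env (t + 1) \<omega>)"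
      by (rule path.path_score_bound[OF mu r(1) goodD(5)[OF elim] that order_refl theta_pos[OF that]])
    also have "\<dots> \<le> \<bar>score_const \<mu> (\<theta> m)\<bar> * env (t + 1) \<omega>"
      using r[of "t + 1"] by (intro mult_mono) auto
    finally show ?case using goodD(7)[OF elim that, of "t + 1"] goodD(4)[OF elim, of "t + 1"] by (simp add: abs_mult)
  qed
qed measurable

definition noise_k :: real where "noise_k = expectation (\<lambda>\<omega>. \<epsilon> 0 \<omega> ^ k)"

lemma psi_eq: "garch_psi M p q X \<theta> m = expectation (\<lambda>\<omega>. score_map m (past (- 1) \<omega>))"
  unfolding garch_psi_def
proof (rule integral_cong_AE)
  show ae: "AE \<omega> in M. grad_log_sigma2 p q X 0 \<theta> \<omega> m = score_map m (past (- 1) \<omega>)"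
    using AE_score_map by eventually_elim (metis diff_0)
  show "(\<lambda>\<omega>. grad_log_sigma2 p q X 0 \<theta> \<omega> m) \<in> borel_measurable M"
    unfolding grad_log_sigma2_def by measurable
qed measurable

lemma noise_power_integrable: "integrable M (\<lambda>\<omega>. \<epsilon> 0 \<omega> ^ k)"
  using noise_moment by (rule Bochner_Integration.integrable_bound) (auto simp: power_abs)

text \<open>The score is a function of the past and thus independent of the current innovation, so the mean of
\<open>\<epsilon>\<^sub>t\<^sup>k\<close> times the score factorises.\<close>

lemma score_LLN:
  assumes m: "m \<le> p + q" and \<eta>: "0 < \<eta>" and \<delta>: "0 < \<delta>"
  shows "whp \<delta> (\<lambda>n \<omega>. \<forall>j\<le>n. \<bar>(\<Sum>t=1..j. \<epsilon> (int t) \<omega> ^ k * score_map m (past (int t - 1) \<omega>))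
    - real j * (noise_k * garch_psi M p q X \<theta> m)\<bar> \<le> \<eta> * real n)"
proof -
  define \<Phi> where "\<Phi> = (\<lambda>y :: nat \<Rightarrow> real. y 0 ^ k * score_map m (\<lambda>i. y (Suc i)))"
  have \<Phi>: "\<Phi> (past t \<omega>) = \<epsilon> t \<omega> ^ k * score_map m (past (t - 1) \<omega>)" for t \<omega>
  proof -
    have "(\<lambda>i. past t \<omega> (Suc i)) = past (t - 1) \<omega>" by (simp add: past_def fun_eq_iff algebra_simps)
    then show ?thesis by (simp add: \<Phi>_def) (simp add: past_def)
  qed
  have "(\<lambda>y i. y (Suc i)) \<in> measurable (Pi\<^sub>M UNIV (\<lambda>_. borel :: real measure)) (Pi\<^sub>M UNIV (\<lambda>_. borel))"
    by (intro measurable_PiM_single') auto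
  from measurable_compose[OF this score_map_measurable]
  have sm: "(\<lambda>y. score_map m (\<lambda>i. y (Suc i))) \<in> borel_measurable (Pi\<^sub>M UNIV (\<lambda>_. borel))" .
  have \<Phi>m: "\<Phi> \<in> borel_measurable (Pi\<^sub>M UNIV (\<lambda>_. borel))"
    unfolding \<Phi>_def by (intro borel_measurable_times borel_measurable_power sm) simp
  have pr: "integrable M (\<lambda>\<omega>. \<epsilon> 0 \<omega> ^ k * score_map m (past (0 - 1) \<omega>))"
    "expectation (\<lambda>\<omega>. \<epsilon> 0 \<omega> ^ k * score_map m (past (0 - 1) \<omega>)) = noise_k * expectation (\<lambda>\<omega>. score_map m (past (- 1) \<omega>))"
    unfolding noise_k_def
    using noise_past_product[where f="\<lambda>y. y ^ k" and h="score_map m" and s="-1" and t=0, OF _ score_map_measurable noise_power_integrable score_integrable[OF m]]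
    by simp_all
  have "integrable M (\<lambda>\<omega>. \<Phi> (past 0 \<omega>))" unfolding \<Phi> by (rule pr)
  from uniform_LLN[OF \<Phi>m this \<eta> \<delta>] show ?thesis
    unfolding whp_def \<Phi> pr psi_eq .
qed

definition weight_mean :: real where
  "weight_mean = expectation (\<lambda>\<omega>. \<bar>\<epsilon> 0 \<omega>\<bar> ^ k) * env_mean"

lemma weight_expectation:
  "integrable M (\<lambda>\<omega>. \<bar>\<epsilon> t \<omega>\<bar> ^ k * env t \<omega>)" "expectation (\<lambda>\<omega>. \<bar>\<epsilon> t \<omega>\<bar> ^ k * env t \<omega>) = weight_mean"
  unfolding env_def weight_mean_def env_mean_def
  using noise_past_product[where f="\<lambda>y. \<bar>y\<bar> ^ k" and h="envelope \<mu>" and s=0 and t=t, OF _ envelope_measurable noise_moment envelope_integrable]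
  by simp_all

lemma AE_env_nonneg: "AE \<omega> in M. 0 \<le> env t \<omega>"
  using AE_good
proof eventually_elim
  case (elim \<omega>)
  then show ?case using goodD(4)[OF elim, of t] by linarith
qed

lemma env_mean_nonneg: "0 \<le> env_mean"
  using AE_env_nonneg[of 0] env_expectation(2)[of 0] by (metis integral_nonneg_AE)

lemma weight_mean_nonneg: "0 \<le> weight_mean"
  unfolding weight_mean_def by (intro mult_nonneg_nonneg env_mean_nonneg integral_nonneg) auto

lemma AE_weight_nonneg: "AE \<omega> in M. 0 \<le> \<bar>\<epsilon> t \<omega>\<bar> ^ k * env t \<omega>"
  using AE_env_nonneg[of t] by eventually_elim auto

text \<open>Only the mean of \<open>env\<close> is available, but \<open>env\<close> is compared with \<open>n powr (3/2)\<close>, which is of larger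
order than the number of terms in the union bound.\<close>

lemma env_maximum:
  assumes \<kappa>: "0 < \<kappa>" and \<delta>: "0 < \<delta>"
  shows "whp \<delta> (\<lambda>n \<omega>. \<forall>t\<in>{1..n}. env (int t) \<omega> < (\<kappa> * sqrt (real n)) ^ 3)"
proof (rule whp_markov)
  have "(\<lambda>n. env_mean / \<kappa> ^ 3 / sqrt (real n)) \<longlonglongrightarrow> 0"
    by (intro real_tendsto_divide_at_top[OF tendsto_const] filterlim_compose[OF sqrt_at_top filterlim_real_sequentially])
  then have "\<forall>\<^sub>F n in sequentially. env_mean / \<kappa> ^ 3 / sqrt (real n) < \<delta>"
    using \<delta> by (rule order_tendstoD)
  then show "\<forall>\<^sub>F n in sequentially. finite {1..n} \<and> (\<Sum>t\<in>{1..n}. expectation (env (int t)) / (\<kappa> * sqrt (real n)) ^ 3) \<le> \<delta> \<and>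
     (\<forall>t\<in>{1..n}. integrable M (env (int t)) \<and> (AE \<omega> in M. 0 \<le> env (int t) \<omega>) \<and> 0 < (\<kappa> * sqrt (real n)) ^ 3)"
    using eventually_gt_at_top[of 0]
  proof eventually_elim
    case (elim n)
    have "(\<Sum>t\<in>{1..n}. expectation (env (int t)) / (\<kappa> * sqrt (real n)) ^ 3) = real n * (env_mean / (\<kappa> * sqrt (real n)) ^ 3)"
      by (simp add: env_expectation)
    also have "\<dots> = env_mean / \<kappa> ^ 3 / sqrt (real n)"
      using elim \<kappa> by (simp add: power_mult_distrib power3_eq_cube field_simps)
    finally show ?case using elim \<kappa> env_expectation AE_env_nonneg by auto
  qed
qed

lemma env_tail:
  assumes \<kappa>: "0 < \<kappa>" and \<delta>: "0 < \<delta>"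
  shows "\<exists>T. whp \<delta> (\<lambda>n \<omega>. \<forall>t\<in>{T..n}. env (int t) \<omega> < \<kappa> * \<mu> ^ t)"
proof -
  have s: "summable (\<lambda>t. (1 / \<mu>) ^ t)" using mu by (intro summable_geometric) auto
  have "(\<lambda>T. env_mean / \<kappa> * (\<Sum>t. (1 / \<mu>) ^ (t + T))) \<longlonglongrightarrow> env_mean / \<kappa> * 0"
    by (intro tendsto_intros suminf_exist_split2 s)
  then have "\<forall>\<^sub>F T in sequentially. env_mean / \<kappa> * (\<Sum>t. (1 / \<mu>) ^ (t + T)) < \<delta>"
    using \<delta> by (intro order_tendstoD) auto
  then obtain T where T: "env_mean / \<kappa> * (\<Sum>t. (1 / \<mu>) ^ (t + T)) < \<delta>"
    using eventually_happens'[of sequentially] by auto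
  have "whp \<delta> (\<lambda>n \<omega>. \<forall>t\<in>{T..n}. env (int t) \<omega> < \<kappa> * \<mu> ^ t)"
  proof (rule whp_markov, rule always_eventually, intro allI conjI ballI)
    fix n
    have "(\<Sum>t\<in>{T..n}. expectation (env (int t)) / (\<kappa> * \<mu> ^ t)) = env_mean / \<kappa> * (\<Sum>t\<in>{T..n}. (1 / \<mu>) ^ t)"
      by (simp add: env_expectation sum_distrib_left power_one_over field_simps)
    also have "(\<Sum>t\<in>{T..n}. (1 / \<mu>) ^ t) = (\<Sum>t\<in>{..<Suc n - T}. (1 / \<mu>) ^ (t + T))"
      by (rule sum.reindex_bij_witness[of _ "\<lambda>t. t + T" "\<lambda>t. t - T"]) auto
    also have "\<dots> \<le> (\<Sum>t. (1 / \<mu>) ^ (t + T))"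
      using mu by (intro sum_le_suminf summable_ignore_initial_segment s) auto
    finally have "(\<Sum>t\<in>{T..n}. expectation (env (int t)) / (\<kappa> * \<mu> ^ t)) \<le> env_mean / \<kappa> * (\<Sum>t. (1 / \<mu>) ^ (t + T))"
      using env_mean_nonneg \<kappa> by (simp add: divide_right_mono mult_left_mono)
    then show "(\<Sum>t\<in>{T..n}. expectation (env (int t)) / (\<kappa> * \<mu> ^ t)) \<le> \<delta>"
      using T by linarith
    show "finite {T..n}" by simp
    fix t
    show "integrable M (env (int t))" by (rule env_expectation)
    show "AE \<omega> in M. 0 \<le> env (int t) \<omega>" by (rule AE_env_nonneg)
    show "0 < \<kappa> * \<mu> ^ t" using \<kappa> mu by simp
  qed
  then show ?thesis by blast
qed

lemma weight_average:
  assumes \<delta>: "0 < \<delta>"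
  shows "whp \<delta> (\<lambda>n \<omega>. (\<Sum>t=1..n. \<bar>\<epsilon> (int t) \<omega>\<bar> ^ k * env (int t) \<omega>) \<le> (weight_mean / \<delta> + 1) * real n)"
proof -
  have pos: "0 < weight_mean / \<delta> + 1" using weight_mean_nonneg \<delta> by (simp add: add_nonneg_pos)
  have "whp \<delta> (\<lambda>n \<omega>. \<forall>i\<in>{()}. (\<Sum>t=1..n. \<bar>\<epsilon> (int t) \<omega>\<bar> ^ k * env (int t) \<omega>) < (weight_mean / \<delta> + 1) * real n)"
  proof (rule whp_markov, rule eventually_mono[OF eventually_gt_at_top[of 0]])
    fix n :: nat assume n: "0 < n"
    have e: "expectation (\<lambda>\<omega>. \<Sum>t=1..n. \<bar>\<epsilon> (int t) \<omega>\<bar> ^ k * env (int t) \<omega>) = real n * weight_mean"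
      using weight_expectation by (subst Bochner_Integration.integral_sum) auto
    have "weight_mean \<le> \<delta> * (weight_mean / \<delta> + 1)" using \<delta> by (simp add: distrib_left)
    then have "weight_mean / (weight_mean / \<delta> + 1) \<le> \<delta>" using pos by (simp add: pos_divide_le_eq)
    moreover have "real n * weight_mean / ((weight_mean / \<delta> + 1) * real n) = weight_mean / (weight_mean / \<delta> + 1)"
      using n by simp
    moreover have "AE \<omega> in M. 0 \<le> (\<Sum>t=1..n. \<bar>\<epsilon> (int t) \<omega>\<bar> ^ k * env (int t) \<omega>)"
    proof -
      have "AE \<omega> in M. \<forall>t. 0 \<le> \<bar>\<epsilon> t \<omega>\<bar> ^ k * env t \<omega>" unfolding AE_all_countable using AE_weight_nonneg by blast
      then show ?thesis by eventually_elim (auto intro!: sum_nonneg)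
    qed
    ultimately show "finite {()} \<and> (\<Sum>i\<in>{()}. expectation (\<lambda>\<omega>. \<Sum>t=1..n. \<bar>\<epsilon> (int t) \<omega>\<bar> ^ k * env (int t) \<omega>) / ((weight_mean / \<delta> + 1) * real n)) \<le> \<delta> \<and>
     (\<forall>i\<in>{()}. integrable M (\<lambda>\<omega>. \<Sum>t=1..n. \<bar>\<epsilon> (int t) \<omega>\<bar> ^ k * env (int t) \<omega>) \<and>
        (AE \<omega> in M. 0 \<le> (\<Sum>t=1..n. \<bar>\<epsilon> (int t) \<omega>\<bar> ^ k * env (int t) \<omega>)) \<and> 0 < (weight_mean / \<delta> + 1) * real n)"
      using n pos e weight_expectation by auto
  qed
  then show ?thesis by (rule whp_mono) auto
qed

lemma weight_discounted:
  assumes \<delta>: "0 < \<delta>"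
  shows "\<exists>K\<ge>0. whp \<delta> (\<lambda>n \<omega>. (\<Sum>t=1..n. (1 / \<mu>) ^ t * (\<bar>\<epsilon> (int t) \<omega>\<bar> ^ k * env (int t) \<omega>)) \<le> K)"
proof -
  define Z where "Z = 1 / (1 - 1 / \<mu>)"
  have Z: "0 < Z" using mu by (simp add: Z_def)
  define K where "K = weight_mean * Z / \<delta> + 1"
  have K: "0 < K" using weight_mean_nonneg \<delta> Z by (simp add: K_def add_nonneg_pos)
  have "whp \<delta> (\<lambda>n \<omega>. \<forall>i\<in>{()}. (\<Sum>t=1..n. (1 / \<mu>) ^ t * (\<bar>\<epsilon> (int t) \<omega>\<bar> ^ k * env (int t) \<omega>)) < K)"
  proof (rule whp_markov, intro always_eventually allI)
    fix n :: nat
    have "expectation (\<lambda>\<omega>. \<Sum>t=1..n. (1 / \<mu>) ^ t * (\<bar>\<epsilon> (int t) \<omega>\<bar> ^ k * env (int t) \<omega>)) = (\<Sum>t=1..n. (1 / \<mu>) ^ t * weight_mean)"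
      using weight_expectation by (subst Bochner_Integration.integral_sum) auto
    also have "\<dots> = (\<Sum>t=1..n. (1 / \<mu>) ^ t) * weight_mean" by (simp add: sum_distrib_right)
    also have "(\<Sum>t=1..n. (1 / \<mu>) ^ t) \<le> Z"
    proof -
      have "(\<Sum>t=1..n. (1 / \<mu>) ^ t) \<le> (\<Sum>t. (1 / \<mu>) ^ t)"
        using mu by (intro sum_le_suminf summable_geometric) auto
      also have "\<dots> = Z" using mu by (subst suminf_geometric) (auto simp: Z_def)
      finally show ?thesis .
    qed
    finally have e: "expectation (\<lambda>\<omega>. \<Sum>t=1..n. (1 / \<mu>) ^ t * (\<bar>\<epsilon> (int t) \<omega>\<bar> ^ k * env (int t) \<omega>)) \<le> Z * weight_mean"
      using weight_mean_nonneg by (simp add: mult_right_mono)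
    also have "\<dots> \<le> \<delta> * K" using \<delta> by (simp add: K_def distrib_left mult.commute)
    finally have "expectation (\<lambda>\<omega>. \<Sum>t=1..n. (1 / \<mu>) ^ t * (\<bar>\<epsilon> (int t) \<omega>\<bar> ^ k * env (int t) \<omega>)) / K \<le> \<delta>"
      using K by (simp add: pos_divide_le_eq)
    moreover have "AE \<omega> in M. 0 \<le> (\<Sum>t=1..n. (1 / \<mu>) ^ t * (\<bar>\<epsilon> (int t) \<omega>\<bar> ^ k * env (int t) \<omega>))"
    proof -
      have "AE \<omega> in M. \<forall>t. 0 \<le> \<bar>\<epsilon> t \<omega>\<bar> ^ k * env t \<omega>" unfolding AE_all_countable using AE_weight_nonneg by blast
      then show ?thesis by eventually_elim (use mu in \<open>auto intro!: sum_nonneg mult_nonneg_nonneg[of "(1 / \<mu>) ^ t" for t]\<close>)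
    qed
    ultimately show "finite {()} \<and> (\<Sum>i\<in>{()}. expectation (\<lambda>\<omega>. \<Sum>t=1..n. (1 / \<mu>) ^ t * (\<bar>\<epsilon> (int t) \<omega>\<bar> ^ k * env (int t) \<omega>)) / K) \<le> \<delta> \<and>
     (\<forall>i\<in>{()}. integrable M (\<lambda>\<omega>. \<Sum>t=1..n. (1 / \<mu>) ^ t * (\<bar>\<epsilon> (int t) \<omega>\<bar> ^ k * env (int t) \<omega>)) \<and>
        (AE \<omega> in M. 0 \<le> (\<Sum>t=1..n. (1 / \<mu>) ^ t * (\<bar>\<epsilon> (int t) \<omega>\<bar> ^ k * env (int t) \<omega>))) \<and> 0 < K)"
      using K weight_expectation by auto
  qed
  then have "whp \<delta> (\<lambda>n \<omega>. (\<Sum>t=1..n. (1 / \<mu>) ^ t * (\<bar>\<epsilon> (int t) \<omega>\<bar> ^ k * env (int t) \<omega>)) \<le> K)"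
    by (rule whp_mono) auto
  then show ?thesis using K by (intro exI[of _ K]) auto
qed

end

section \<open>Expansion of the residual sums\<close>

context garch_envelope
begin

text \<open>What remains of \<open>\<epsilon>hat\<^sub>t\<^sup>k - \<epsilon>\<^sub>t\<^sup>k\<close> after subtraction of its linear part.\<close>

definition residual_error :: "(nat \<Rightarrow> 'a \<Rightarrow> nat \<Rightarrow> real) \<Rightarrow> nat \<Rightarrow> nat \<Rightarrow> 'a \<Rightarrow> real" where
  "residual_error \<theta>hat n t \<omega> = residual p q X \<theta>hat n t \<omega> ^ k - \<epsilon> (int t) \<omega> ^ k
     + real k / 2 * \<epsilon> (int t) \<omega> ^ k * (\<Sum>m<p + q + 1. score_map m (past (int t - 1) \<omega>) * (\<theta>hat n \<omega> m - \<theta> m))"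

lemma sigma2_hat_eq:
  "sigma2_hat p q X \<theta>hat n t \<omega> = garch_coeff p q (\<theta>hat n \<omega>) 0
     + (\<Sum>i=1..t. lag_coeff p q (\<theta>hat n \<omega>) i * (X (int t - int i) \<omega>)\<^sup>2)"
  unfolding sigma2_hat_def by (intro arg_cong2[where f="(+)"] sum.cong refl) (simp add: garch_coeff_pos)

lemma residual_eq:
  assumes "good \<omega>"
  shows "residual p q X \<theta>hat n t \<omega> = \<epsilon> (int t) \<omega> * (1 / sqrt (sigma2_hat p q X \<theta>hat n t \<omega> / (\<sigma> (int t) \<omega>)\<^sup>2))"
  using goodD(2)[OF assms, of "int t"] goodD(3)[OF assms, of "int t"]
  by (simp add: residual_def real_sqrt_divide)

lemma score_dir_path:
  assumes "good \<omega>"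
  shows "(\<Sum>m<p + q + 1. score_map m (past (t - 1) \<omega>) * h m) =
    (\<Sum>m<p + q + 1. garch_path.path_score p q \<theta> (\<lambda>t. (X t \<omega>)\<^sup>2) (\<lambda>t. (\<sigma> t \<omega>)\<^sup>2) t m * h m)"
  by (intro sum.cong refl) (simp add: goodD(7)[OF assms])

lemma residual_error_small:
  "\<exists>C\<ge>0. \<forall>\<theta>hat n t \<omega> e0. good \<omega> \<longrightarrow> (\<forall>m\<le>p + q. \<bar>\<theta>hat n \<omega> m - \<theta> m\<bar> \<le> e0 * \<theta> m) \<longrightarrow>
    0 \<le> e0 \<longrightarrow> e0 \<le> beta_gap / 2 \<longrightarrow> 1 + e0 \<le> \<mu> \<longrightarrow>
    e0 * root 3 (env (int t) \<omega>) \<le> 1 / (8 * lin_const \<mu>) \<longrightarrow> (1 / \<mu>) ^ t * root 3 (env (int t) \<omega>) \<le> 1 / (8 * lin_const \<mu>) \<longrightarrow>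
    \<bar>residual_error \<theta>hat n t \<omega>\<bar> \<le> C * (e0\<^sup>2 + (1 / \<mu>) ^ t) * (\<bar>\<epsilon> (int t) \<omega>\<bar> ^ k * env (int t) \<omega>)"
proof -
  obtain C where C: "0 \<le> C" and lin: "\<And>x v e t g u e0 n. garch_path p q \<theta> x v e \<Longrightarrow> 1 \<le> g \<Longrightarrow>
    (\<forall>i. lag_coeff p q \<theta> i * x (t - int i) \<le> v t * (g / \<mu> ^ (4 * i))) \<Longrightarrow>
    v t = garch_coeff p q \<theta> 0 + (\<Sum>i. lag_coeff p q \<theta> i * x (t - int i)) \<Longrightarrow>
    (\<forall>m\<le>p + q. \<bar>u m - \<theta> m\<bar> \<le> e0 * \<theta> m) \<Longrightarrow> 0 \<le> e0 \<Longrightarrow> e0 \<le> beta_gap / 2 \<Longrightarrow> 1 + e0 \<le> \<mu> \<Longrightarrow>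
    e0 * g \<le> 1 / (8 * lin_const \<mu>) \<Longrightarrow> (1 / \<mu>) ^ n * g \<le> 1 / (8 * lin_const \<mu>) \<Longrightarrow>
    \<bar>(1 / sqrt ((garch_coeff p q u 0 + (\<Sum>i=1..n. lag_coeff p q u i * x (t - int i))) / v t)) ^ k - 1
       + real k / 2 * (\<Sum>m<p + q + 1. garch_path.path_score p q \<theta> x v t m * (u m - \<theta> m))\<bar>
     \<le> C * (e0\<^sup>2 + (1 / \<mu>) ^ n) * g\<^sup>2"
    using residual_linearisation[OF mu, of k] by blast
  show ?thesis
  proof (intro exI[of _ C] conjI allI impI C)
    fix \<theta>hat :: "nat \<Rightarrow> 'a \<Rightarrow> nat \<Rightarrow> real" and n t :: nat and \<omega> e0
    assume good: "good \<omega>" and u: "\<forall>m\<le>p + q. \<bar>\<theta>hat n \<omega> m - \<theta> m\<bar> \<le> e0 * \<theta> m"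
      and e0: "0 \<le> e0" "e0 \<le> beta_gap / 2" "1 + e0 \<le> \<mu>"
      and small: "e0 * root 3 (env (int t) \<omega>) \<le> 1 / (8 * lin_const \<mu>)" "(1 / \<mu>) ^ t * root 3 (env (int t) \<omega>) \<le> 1 / (8 * lin_const \<mu>)"
    note r = root_env[OF goodD(4)[OF good]]
    define D where "D = (1 / sqrt (sigma2_hat p q X \<theta>hat n t \<omega> / (\<sigma> (int t) \<omega>)\<^sup>2)) ^ k - 1
      + real k / 2 * (\<Sum>m<p + q + 1. score_map m (past (int t - 1) \<omega>) * (\<theta>hat n \<omega> m - \<theta> m))"
    have "\<bar>D\<bar> \<le> C * (e0\<^sup>2 + (1 / \<mu>) ^ t) * (root 3 (env (int t) \<omega>))\<^sup>2"
      unfolding D_def sigma2_hat_eq score_dir_path[OF good]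
      by (rule lin[OF goodD(1)[OF good] r(1) _ goodD(6)[OF good] u e0 small]) (use goodD(5)[OF good] in blast)
    also have "\<dots> \<le> C * (e0\<^sup>2 + (1 / \<mu>) ^ t) * env (int t) \<omega>"
      using C mu r by (intro mult_left_mono) auto
    finally have D: "\<bar>D\<bar> \<le> C * (e0\<^sup>2 + (1 / \<mu>) ^ t) * env (int t) \<omega>" .
    have "residual_error \<theta>hat n t \<omega> = \<epsilon> (int t) \<omega> ^ k * D"
      unfolding residual_error_def residual_eq[OF good] D_def power_mult_distrib by (simp add: algebra_simps)
    then have "\<bar>residual_error \<theta>hat n t \<omega>\<bar> = \<bar>\<epsilon> (int t) \<omega>\<bar> ^ k * \<bar>D\<bar>" by (simp add: abs_mult power_abs)
    also have "\<dots> \<le> \<bar>\<epsilon> (int t) \<omega>\<bar> ^ k * (C * (e0\<^sup>2 + (1 / \<mu>) ^ t) * env (int t) \<omega>)"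
      by (intro mult_left_mono D) auto
    finally show "\<bar>residual_error \<theta>hat n t \<omega>\<bar> \<le> C * (e0\<^sup>2 + (1 / \<mu>) ^ t) * (\<bar>\<epsilon> (int t) \<omega>\<bar> ^ k * env (int t) \<omega>)"
      by (simp only: mult_ac)
  qed
qed

text \<open>For the finitely many early observations, where the truncation is not yet negligible, a bound that does
not depend on \<open>n\<close> suffices: it disappears after division by \<open>sqrt n\<close>.\<close>

definition crude_bound :: "nat \<Rightarrow> 'a \<Rightarrow> real" where
  "crude_bound t \<omega> = (\<bar>X (int t) \<omega>\<bar> / sqrt (\<theta> 0 / 2)) ^ k + \<bar>\<epsilon> (int t) \<omega>\<bar> ^ k
     + real k / 2 * \<bar>\<epsilon> (int t) \<omega>\<bar> ^ k * (lin_const \<mu> * env (int t) \<omega>)"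

lemma crude_bound_measurable [measurable]: "crude_bound t \<in> borel_measurable M"
  unfolding crude_bound_def by measurable

lemma residual_error_crude:
  assumes good: "good \<omega>" and u: "\<forall>m\<le>p + q. \<bar>\<theta>hat n \<omega> m - \<theta> m\<bar> \<le> e0 * \<theta> m"
    and e0: "0 \<le> e0" "e0 \<le> beta_gap / 2" "1 + e0 \<le> \<mu>"
  shows "\<bar>residual_error \<theta>hat n t \<omega>\<bar> \<le> crude_bound t \<omega>"
proof -
  note r = root_env[OF goodD(4)[OF good]]
  interpret path: garch_path p q \<theta> "\<lambda>t. (X t \<omega>)\<^sup>2" "\<lambda>t. (\<sigma> t \<omega>)\<^sup>2" "\<lambda>t. \<epsilon> t \<omega>"
    by (rule goodD(1)[OF good])
  have e1: "e0 \<le> 1" using e0 beta_gap by simp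
  have u': "\<bar>\<theta>hat n \<omega> m - \<theta> m\<bar> \<le> e0 * \<theta> m" if "m \<le> p + q" for m using u that by simp
  have unn: "0 \<le> \<theta>hat n \<omega> m" if "m \<le> p + q" for m
  proof -
    have "e0 * \<theta> m \<le> 1 * \<theta> m" using e1 theta_pos[OF that] by (intro mult_right_mono) auto
    then show ?thesis using u'[OF that] by (simp add: abs_le_iff)
  qed
  have "\<theta> 0 / 2 \<le> garch_coeff p q (\<theta>hat n \<omega>) 0"
    using garch_coeff_0_taylor(3)[OF theta_pos u' refl beta_lt_1 e0(1)] e0(2) by (simp add: beta_gap_def)
  also have "\<dots> \<le> sigma2_hat p q X \<theta>hat n t \<omega>"
    unfolding sigma2_hat_eq using unn by (auto intro!: sum_nonneg mult_nonneg_nonneg lag_coeff_nonneg)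
  finally have S: "\<theta> 0 / 2 \<le> sigma2_hat p q X \<theta>hat n t \<omega>" .
  have t0: "0 < \<theta> 0" by (simp add: theta_pos)
  have "\<bar>residual p q X \<theta>hat n t \<omega>\<bar> \<le> \<bar>X (int t) \<omega>\<bar> / sqrt (\<theta> 0 / 2)"
    unfolding residual_def abs_divide using S t0 by (intro divide_left_mono) auto
  then have 1: "\<bar>residual p q X \<theta>hat n t \<omega> ^ k\<bar> \<le> (\<bar>X (int t) \<omega>\<bar> / sqrt (\<theta> 0 / 2)) ^ k"
    unfolding power_abs by (intro power_mono) auto
  have "\<bar>\<Sum>m<p + q + 1. score_map m (past (int t - 1) \<omega>) * (\<theta>hat n \<omega> m - \<theta> m)\<bar> \<le> lin_const \<mu> * e0 * root 3 (env (int t) \<omega>)"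
    unfolding score_dir_path[OF good]
    by (rule path.linearisation(2)[OF mu r(1) goodD(5)[OF good] u' e0 goodD(6)[OF good]])
  also have "\<dots> \<le> lin_const \<mu> * 1 * env (int t) \<omega>"
    using lin_const_pos[OF mu] e0 e1 r[of "int t"] goodD(4)[OF good, of "int t"] by (intro mult_mono) auto
  finally have 2: "\<bar>\<Sum>m<p + q + 1. score_map m (past (int t - 1) \<omega>) * (\<theta>hat n \<omega> m - \<theta> m)\<bar> \<le> lin_const \<mu> * env (int t) \<omega>" by simp
  have "\<bar>real k / 2 * \<epsilon> (int t) \<omega> ^ k * (\<Sum>m<p + q + 1. score_map m (past (int t - 1) \<omega>) * (\<theta>hat n \<omega> m - \<theta> m))\<bar>
     \<le> real k / 2 * \<bar>\<epsilon> (int t) \<omega>\<bar> ^ k * (lin_const \<mu> * env (int t) \<omega>)"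
    using 2 by (auto simp: abs_mult power_abs intro!: mult_left_mono)
  then show ?thesis
    using 1 unfolding residual_error_def crude_bound_def power_abs[symmetric] by linarith
qed

lemma crude_bound_nonneg: "good \<omega> \<Longrightarrow> 0 \<le> crude_bound t \<omega>"
  unfolding crude_bound_def using goodD(4)[of \<omega> "int t"] lin_const_pos[OF mu] theta_pos[of 0]
  by (intro add_nonneg_nonneg mult_nonneg_nonneg zero_le_power divide_nonneg_nonneg) auto

definition process :: "(nat \<Rightarrow> 'a \<Rightarrow> nat \<Rightarrow> real) \<Rightarrow> nat \<Rightarrow> real \<Rightarrow> 'a \<Rightarrow> real" where
  "process \<theta>hat n u \<omega> = 1 / sqrt (real n)
       * (residual_partial_sum p q X \<theta>hat k n u \<omega> - innovation_partial_sum \<epsilon> k n u \<omega>)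
     + real k * u * noise_k / 2 * inner_prod (p + q + 1) (garch_psi M p q X \<theta>)
          (\<lambda>i. sqrt (real n) * (\<theta>hat n \<omega> i - \<theta> i))"

text \<open>The linear part of the residuals sums to an inner product of \<open>sqrt n (\<theta>hat - \<theta>)\<close> with averages of
\<open>\<epsilon>\<^sub>t\<^sup>k\<close> times the score. The summand \<open>\<bar>noise_k * \<psi>\<^sub>m\<bar> / n\<close> is the effect of replacing \<open>u\<close> by
\<open>\<lfloor>n u\<rfloor> / n\<close>.\<close>

lemma process_bound:
  assumes n: "0 < n" and u: "0 \<le> u" "u \<le> 1"
    and hat: "\<And>m. m \<le> p + q \<Longrightarrow> \<bar>sqrt (real n) * (\<theta>hat n \<omega> m - \<theta> m)\<bar> \<le> K"
    and LLN: "\<And>m j. m \<le> p + q \<Longrightarrow> j \<le> n \<Longrightarrow>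
      \<bar>(\<Sum>t=1..j. \<epsilon> (int t) \<omega> ^ k * score_map m (past (int t - 1) \<omega>)) - real j * (noise_k * garch_psi M p q X \<theta> m)\<bar> \<le> \<eta> * real n"
    and err: "(\<Sum>t=1..n. \<bar>residual_error \<theta>hat n t \<omega>\<bar>) \<le> B"
  shows "\<bar>process \<theta>hat n u \<omega>\<bar> \<le> B / sqrt (real n)
    + real k / 2 * K * (\<Sum>m<p + q + 1. \<eta> + \<bar>noise_k * garch_psi M p q X \<theta> m\<bar> / real n)"
proof -
  define j where "j = nat \<lfloor>real n * u\<rfloor>"
  have nu: "0 \<le> real n * u" "real n * u \<le> real n" using u by (auto simp: mult_left_le)
  have j: "real j \<le> real n * u" "real n * u < real j + 1" using nu unfolding j_def by linarith+
  have jn: "j \<le> n" using j nu by linarith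
  define h where "h = (\<lambda>m. sqrt (real n) * (\<theta>hat n \<omega> m - \<theta> m))"
  define c where "c = (\<lambda>m. noise_k * garch_psi M p q X \<theta> m)"
  define A where "A = (\<lambda>m. \<Sum>t=1..j. \<epsilon> (int t) \<omega> ^ k * score_map m (past (int t - 1) \<omega>))"
  define R where "R = (\<Sum>t=1..j. residual_error \<theta>hat n t \<omega>)"
  have sq: "sqrt (real n) * sqrt (real n) = real n" "0 < sqrt (real n)" using n by auto
  have hn: "\<theta>hat n \<omega> m - \<theta> m = h m / sqrt (real n)" for m using n by (simp add: h_def)
  have K: "0 \<le> K" using hat[of 0] by linarith
  have "R = (\<Sum>t=1..j. residual p q X \<theta>hat n t \<omega> ^ k - \<epsilon> (int t) \<omega> ^ k)
     + (\<Sum>t=1..j. real k / 2 * \<epsilon> (int t) \<omega> ^ k * (\<Sum>m<p + q + 1. score_map m (past (int t - 1) \<omega>) * (\<theta>hat n \<omega> m - \<theta> m)))"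
    unfolding R_def residual_error_def by (rule sum.distrib)
  also have "(\<Sum>t=1..j. residual p q X \<theta>hat n t \<omega> ^ k - \<epsilon> (int t) \<omega> ^ k)
     = residual_partial_sum p q X \<theta>hat k n u \<omega> - innovation_partial_sum \<epsilon> k n u \<omega>"
    by (simp add: residual_partial_sum_def innovation_partial_sum_def j_def sum_subtractf)
  also have "(\<Sum>t=1..j. real k / 2 * \<epsilon> (int t) \<omega> ^ k * (\<Sum>m<p + q + 1. score_map m (past (int t - 1) \<omega>) * (\<theta>hat n \<omega> m - \<theta> m)))
     = (\<Sum>t=1..j. \<Sum>m<p + q + 1. real k / 2 * (h m / sqrt (real n)) * (\<epsilon> (int t) \<omega> ^ k * score_map m (past (int t - 1) \<omega>)))"
    unfolding sum_distrib_left hn by (intro sum.cong refl) (simp only: mult_ac)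
  also have "\<dots> = (\<Sum>m<p + q + 1. real k / 2 * (h m / sqrt (real n)) * A m)"
    unfolding A_def sum_distrib_left by (rule sum.swap)
  finally have diff: "residual_partial_sum p q X \<theta>hat k n u \<omega> - innovation_partial_sum \<epsilon> k n u \<omega>
     = R - (\<Sum>m<p + q + 1. real k / 2 * (h m / sqrt (real n)) * A m)" by linarith
  have drift: "1 / sqrt (real n) * (\<Sum>m<p + q + 1. real k / 2 * (h m / sqrt (real n)) * A m)
    = (\<Sum>m<p + q + 1. real k / 2 * h m * (A m / real n))"
    unfolding sum_distrib_left
  proof (intro sum.cong refl)
    fix m
    have "1 / sqrt (real n) * (real k / 2 * (h m / sqrt (real n)) * A m) = real k / 2 * h m * A m / (sqrt (real n) * sqrt (real n))"
      by simp
    then show "1 / sqrt (real n) * (real k / 2 * (h m / sqrt (real n)) * A m) = real k / 2 * h m * (A m / real n)"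
      unfolding sq by simp
  qed
  have inner: "real k * u * noise_k / 2 * inner_prod (p + q + 1) (garch_psi M p q X \<theta>) h
     = (\<Sum>m<p + q + 1. real k / 2 * h m * (u * c m))"
    unfolding inner_prod_def sum_distrib_left c_def by (intro sum.cong refl) simp
  have "process \<theta>hat n u \<omega> = R / sqrt (real n) - (\<Sum>m<p + q + 1. real k / 2 * h m * (A m / real n))
      + (\<Sum>m<p + q + 1. real k / 2 * h m * (u * c m))"
  proof -
    have "process \<theta>hat n u \<omega> = 1 / sqrt (real n) * (R - (\<Sum>m<p + q + 1. real k / 2 * (h m / sqrt (real n)) * A m))
      + real k * u * noise_k / 2 * inner_prod (p + q + 1) (garch_psi M p q X \<theta>) h"
      unfolding process_def diff h_def ..
    then show ?thesis unfolding inner right_diff_distrib drift by simp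
  qed
  also have "\<dots> = R / sqrt (real n) + (\<Sum>m<p + q + 1. real k / 2 * h m * (u * c m - A m / real n))"
    unfolding right_diff_distrib sum_subtractf by simp
  also have "\<bar>\<dots>\<bar> \<le> \<bar>R / sqrt (real n)\<bar> + (\<Sum>m<p + q + 1. \<bar>real k / 2 * h m * (u * c m - A m / real n)\<bar>)"
    by (intro order_trans[OF abs_triangle_ineq] add_mono sum_abs order_refl)
  also have "\<dots> \<le> B / sqrt (real n) + (\<Sum>m<p + q + 1. real k / 2 * K * (\<eta> + \<bar>c m\<bar> / real n))"
  proof (intro add_mono sum_mono)
    have "\<bar>R\<bar> \<le> (\<Sum>t=1..n. \<bar>residual_error \<theta>hat n t \<omega>\<bar>)"
      unfolding R_def using jn by (intro order_trans[OF sum_abs] sum_mono2) auto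
    then have "\<bar>R\<bar> \<le> B" using err by linarith
    then show "\<bar>R / sqrt (real n)\<bar> \<le> B / sqrt (real n)"
      using sq by (simp add: divide_right_mono)
  next
    fix m assume "m \<in> {..<p + q + 1}"
    then have m: "m \<le> p + q" by auto
    have "u * c m - A m / real n = (real n * u - real j) * c m / real n - (A m - real j * c m) / real n"
      using n by (simp add: field_simps)
    also have "\<bar>\<dots>\<bar> \<le> \<bar>(real n * u - real j) * c m / real n\<bar> + \<bar>(A m - real j * c m) / real n\<bar>"
      by (rule abs_triangle_ineq4)
    also have "\<dots> \<le> \<bar>c m\<bar> / real n + \<eta>"
    proof (intro add_mono)
      have "\<bar>(real n * u - real j) * c m\<bar> \<le> 1 * \<bar>c m\<bar>"
        unfolding abs_mult using j by (intro mult_right_mono) auto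
      then show "\<bar>(real n * u - real j) * c m / real n\<bar> \<le> \<bar>c m\<bar> / real n"
        by (simp add: divide_right_mono)
      have "\<bar>A m - real j * c m\<bar> \<le> \<eta> * real n" using LLN[OF m jn] by (simp add: A_def c_def)
      then show "\<bar>(A m - real j * c m) / real n\<bar> \<le> \<eta>" using n by (simp add: pos_divide_le_eq)
    qed
    finally have "\<bar>u * c m - A m / real n\<bar> \<le> \<eta> + \<bar>c m\<bar> / real n" by simp
    moreover have "\<bar>real k / 2 * h m\<bar> \<le> real k / 2 * K"
      using hat[OF m] by (simp add: abs_mult h_def mult_left_mono)
    ultimately show "\<bar>real k / 2 * h m * (u * c m - A m / real n)\<bar> \<le> real k / 2 * K * (\<eta> + \<bar>c m\<bar> / real n)"
      unfolding abs_mult[of "real k / 2 * h m"] using K by (intro mult_mono) auto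
  qed
  also have "(\<Sum>m<p + q + 1. real k / 2 * K * (\<eta> + \<bar>c m\<bar> / real n)) = real k / 2 * K * (\<Sum>m<p + q + 1. \<eta> + \<bar>c m\<bar> / real n)"
    by (simp only: sum_distrib_left)
  finally show ?thesis by (simp only: c_def)
qed

text \<open>The budget \<open>\<delta>\<close> is divided among \<open>p + q + 8\<close> exceptional events: one for each component of the score in the
law of large numbers, and seven for the other bounds.\<close>

lemma process_whp:
  assumes hat: "\<And>\<delta>. 0 < \<delta> \<Longrightarrow> \<exists>K. whp \<delta> (\<lambda>n \<omega>. \<forall>m\<le>p + q. \<bar>sqrt (real n) * (\<theta>hat n \<omega> m - \<theta> m)\<bar> \<le> K)"
    and \<eta>: "0 < \<eta>" and \<delta>: "0 < \<delta>"
  shows "whp \<delta> (\<lambda>n \<omega>. \<forall>u\<in>{0..1}. \<bar>process \<theta>hat n u \<omega>\<bar> \<le> \<eta>)"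
proof -
  define d where "d = \<delta> / (real (p + q + 1) + 7)"
  have d: "0 < d" using \<delta> by (simp add: d_def)
  obtain K0 where K0: "whp d (\<lambda>n \<omega>. \<forall>m\<le>p + q. \<bar>sqrt (real n) * (\<theta>hat n \<omega> m - \<theta> m)\<bar> \<le> K0)"
    using hat[OF d] by blast
  define K where "K = max K0 1"
  have K: "0 < K" "K0 \<le> K" by (auto simp: K_def)
  define lo where "lo = Min (\<theta> ` {..p + q})"
  have lo: "0 < lo" "lo \<le> \<theta> m" if "m \<le> p + q" for m
    using that theta_pos by (auto simp: lo_def Min_gr_iff)
  have lo0: "0 < lo" using lo(1)[of 0] by simp
  define L where "L = lin_const \<mu>"
  have L: "0 < L" using lin_const_pos[OF mu] by (simp add: L_def)
  \<comment> \<open>With the relative error \<open>e0 = K / (lo sqrt n)\<close> of the estimate, \<open>root 3 env \<le> \<kappa> sqrt n\<close> means \<open>e0 root 3 env \<le> 1 / (8 L)\<close>.\<close>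
  define \<kappa> where "\<kappa> = lo / (8 * L * K)"
  have \<kappa>: "0 < \<kappa>" using lo0 L K by (simp add: \<kappa>_def)
  obtain C where C: "0 \<le> C" and small: "\<And>n t \<omega> e0. good \<omega> \<Longrightarrow> (\<forall>m\<le>p + q. \<bar>\<theta>hat n \<omega> m - \<theta> m\<bar> \<le> e0 * \<theta> m) \<Longrightarrow>
    0 \<le> e0 \<Longrightarrow> e0 \<le> beta_gap / 2 \<Longrightarrow> 1 + e0 \<le> \<mu> \<Longrightarrow>
    e0 * root 3 (env (int t) \<omega>) \<le> 1 / (8 * L) \<Longrightarrow> (1 / \<mu>) ^ t * root 3 (env (int t) \<omega>) \<le> 1 / (8 * L) \<Longrightarrow>
    \<bar>residual_error \<theta>hat n t \<omega>\<bar> \<le> C * (e0\<^sup>2 + (1 / \<mu>) ^ t) * (\<bar>\<epsilon> (int t) \<omega>\<bar> ^ k * env (int t) \<omega>)"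
    using residual_error_small unfolding L_def by blast
  obtain T where T: "whp d (\<lambda>n \<omega>. \<forall>t\<in>{T..n}. env (int t) \<omega> < 1 / (8 * L) * \<mu> ^ t)"
    using env_tail[of "1 / (8 * L)" d] L d by auto
  obtain K1 where K1: "0 \<le> K1" "whp d (\<lambda>n \<omega>. (\<Sum>t=1..n. (1 / \<mu>) ^ t * (\<bar>\<epsilon> (int t) \<omega>\<bar> ^ k * env (int t) \<omega>)) \<le> K1)"
    using weight_discounted[OF d] by blast
  obtain B where B: "0 < B" "whp d (\<lambda>n \<omega>. (\<Sum>t<T. crude_bound t \<omega>) \<le> B)"
    using tight_single[of "\<lambda>\<omega>. \<Sum>t<T. crude_bound t \<omega>" d] d by auto
  define K2 where "K2 = weight_mean / d + 1"
  have avg: "whp d (\<lambda>n \<omega>. (\<Sum>t=1..n. \<bar>\<epsilon> (int t) \<omega>\<bar> ^ k * env (int t) \<omega>) \<le> K2 * real n)"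
    unfolding K2_def by (rule weight_average[OF d])
  define W where "W = real k / 2 * K"
  have W: "0 \<le> W" using K by (simp add: W_def)
  \<comment> \<open>Chosen so that the contribution \<open>W (p + q + 1) \<eta>'\<close> of the law of large numbers stays below \<open>\<eta> / 4\<close>.\<close>
  define \<eta>' where "\<eta>' = \<eta> / (4 * (W * real (p + q + 1) + 1))"
  have \<eta>': "0 < \<eta>'" using \<eta> W by (simp add: \<eta>'_def add_nonneg_pos)
  have "whp (real (card {..p + q}) * d) (\<lambda>n \<omega>. \<forall>m\<in>{..p + q}. \<forall>j\<le>n. \<bar>(\<Sum>t=1..j. \<epsilon> (int t) \<omega> ^ k * score_map m (past (int t - 1) \<omega>))
    - real j * (noise_k * garch_psi M p q X \<theta> m)\<bar> \<le> \<eta>' * real n)"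
    using \<eta>' d by (intro whp_ball score_LLN) auto
  then have LLN: "whp (real (p + q + 1) * d) (\<lambda>n \<omega>. \<forall>m\<in>{..p + q}. \<forall>j\<le>n. \<bar>(\<Sum>t=1..j. \<epsilon> (int t) \<omega> ^ k * score_map m (past (int t - 1) \<omega>))
    - real j * (noise_k * garch_psi M p q X \<theta> m)\<bar> \<le> \<eta>' * real n)"
    by simp
  note all = whp_conj[OF whp_AE[OF AE_good less_imp_le[OF d]] whp_conj[OF K0 whp_conj[OF env_maximum[OF \<kappa> d]
     whp_conj[OF T whp_conj[OF avg whp_conj[OF K1(2) whp_conj[OF B(2) LLN]]]]]]]
  define S where "S = (\<Sum>m<p + q + 1. \<bar>noise_k * garch_psi M p q X \<theta> m\<bar>)"
  define B' where "B' = B + C * ((K / lo)\<^sup>2 * K2 + K1)"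
  have sq: "filterlim (\<lambda>n. sqrt (real n)) at_top sequentially"
    by (rule filterlim_compose[OF sqrt_at_top filterlim_real_sequentially])
  have ev1: "\<forall>\<^sub>F n in sequentially. K / lo / sqrt (real n) < min (beta_gap / 2) (\<mu> - 1)"
    using beta_gap mu by (intro order_tendstoD(2)[OF real_tendsto_divide_at_top[OF tendsto_const sq]]) auto
  have ev2: "\<forall>\<^sub>F n in sequentially. B' / sqrt (real n) < \<eta> / 2"
    using \<eta> by (intro order_tendstoD(2)[OF real_tendsto_divide_at_top[OF tendsto_const sq]]) auto
  have ev3: "\<forall>\<^sub>F n in sequentially. W * S / real n < \<eta> / 4"
    using \<eta> by (intro order_tendstoD(2)[OF real_tendsto_divide_at_top[OF tendsto_const filterlim_real_sequentially]]) auto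
  show ?thesis
  proof (rule whp_mono[OF all])
    show "d + (d + (d + (d + (d + (d + (d + real (p + q + 1) * d)))))) \<le> \<delta>"
    proof -
      have "d + (d + (d + (d + (d + (d + (d + real (p + q + 1) * d)))))) = (real (p + q + 1) + 7) * d"
        by (simp add: algebra_simps)
      also have "\<dots> = \<delta>" by (simp add: d_def)
      finally show ?thesis by simp
    qed
    show "\<forall>\<^sub>F n in sequentially. \<forall>\<omega>\<in>space M.
      good \<omega> \<and> (\<forall>m\<le>p + q. \<bar>sqrt (real n) * (\<theta>hat n \<omega> m - \<theta> m)\<bar> \<le> K0) \<and>
      (\<forall>t\<in>{1..n}. env (int t) \<omega> < (\<kappa> * sqrt (real n)) ^ 3) \<and> (\<forall>t\<in>{T..n}. env (int t) \<omega> < 1 / (8 * L) * \<mu> ^ t) \<and>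
      (\<Sum>t=1..n. \<bar>\<epsilon> (int t) \<omega>\<bar> ^ k * env (int t) \<omega>) \<le> K2 * real n \<and>
      (\<Sum>t=1..n. (1 / \<mu>) ^ t * (\<bar>\<epsilon> (int t) \<omega>\<bar> ^ k * env (int t) \<omega>)) \<le> K1 \<and>
      (\<Sum>t<T. crude_bound t \<omega>) \<le> B \<and>
      (\<forall>m\<in>{..p + q}. \<forall>j\<le>n. \<bar>(\<Sum>t=1..j. \<epsilon> (int t) \<omega> ^ k * score_map m (past (int t - 1) \<omega>))
         - real j * (noise_k * garch_psi M p q X \<theta> m)\<bar> \<le> \<eta>' * real n) \<longrightarrow>
      (\<forall>u\<in>{0..1}. \<bar>process \<theta>hat n u \<omega>\<bar> \<le> \<eta>)"
      using ev1 ev2 ev3 eventually_gt_at_top[of 0]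
    proof (eventually_elim, intro ballI impI, elim conjE)
      fix n :: nat and \<omega> u
      assume n: "K / lo / sqrt (real n) < min (beta_gap / 2) (\<mu> - 1)" "B' / sqrt (real n) < \<eta> / 2" "W * S / real n < \<eta> / 4" "0 < n"
        and u: "u \<in> {0..1::real}" and good: "good \<omega>"
        and hat: "\<forall>m\<le>p + q. \<bar>sqrt (real n) * (\<theta>hat n \<omega> m - \<theta> m)\<bar> \<le> K0"
        and env_max: "\<forall>t\<in>{1..n}. env (int t) \<omega> < (\<kappa> * sqrt (real n)) ^ 3"
        and env_T: "\<forall>t\<in>{T..n}. env (int t) \<omega> < 1 / (8 * L) * \<mu> ^ t"
        and avg: "(\<Sum>t=1..n. \<bar>\<epsilon> (int t) \<omega>\<bar> ^ k * env (int t) \<omega>) \<le> K2 * real n"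
        and disc: "(\<Sum>t=1..n. (1 / \<mu>) ^ t * (\<bar>\<epsilon> (int t) \<omega>\<bar> ^ k * env (int t) \<omega>)) \<le> K1"
        and crude: "(\<Sum>t<T. crude_bound t \<omega>) \<le> B"
        and LLN: "\<forall>m\<in>{..p + q}. \<forall>j\<le>n. \<bar>(\<Sum>t=1..j. \<epsilon> (int t) \<omega> ^ k * score_map m (past (int t - 1) \<omega>))
         - real j * (noise_k * garch_psi M p q X \<theta> m)\<bar> \<le> \<eta>' * real n"
      define e0 where "e0 = K / lo / sqrt (real n)"
      have sn: "0 < sqrt (real n)" using n by simp
      have e0: "0 \<le> e0" "e0 \<le> beta_gap / 2" "1 + e0 \<le> \<mu>"
        using n(1) K lo0 by (auto simp: e0_def)
      have hatK: "\<bar>sqrt (real n) * (\<theta>hat n \<omega> m - \<theta> m)\<bar> \<le> K" if "m \<le> p + q" for m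
        using hat that K(2) by fastforce
      have close: "\<forall>m\<le>p + q. \<bar>\<theta>hat n \<omega> m - \<theta> m\<bar> \<le> e0 * \<theta> m"
      proof (intro allI impI)
        fix m assume m: "m \<le> p + q"
        have "sqrt (real n) * \<bar>\<theta>hat n \<omega> m - \<theta> m\<bar> \<le> K" using hatK[OF m] by (simp add: abs_mult)
        then have "\<bar>\<theta>hat n \<omega> m - \<theta> m\<bar> \<le> K / sqrt (real n)" using sn by (simp add: field_simps)
        also have "\<dots> = e0 * lo" using lo0 by (simp add: e0_def)
        also have "\<dots> \<le> e0 * \<theta> m" using e0 lo(2)[OF m] by (intro mult_left_mono)
        finally show "\<bar>\<theta>hat n \<omega> m - \<theta> m\<bar> \<le> e0 * \<theta> m" .
      qed
      let ?w = "\<lambda>t. \<bar>\<epsilon> (int t) \<omega>\<bar> ^ k * env (int t) \<omega>"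
      have w0: "0 \<le> ?w t" for t using goodD(4)[OF good, of "int t"] by (intro mult_nonneg_nonneg) auto
      have err_t: "\<bar>residual_error \<theta>hat n t \<omega>\<bar> \<le> (if t < T then crude_bound t \<omega> else 0) + C * (e0\<^sup>2 + (1 / \<mu>) ^ t) * ?w t"
        if t: "t \<in> {1..n}" for t
      proof (cases "t < T")
        case True
        have "\<bar>residual_error \<theta>hat n t \<omega>\<bar> \<le> crude_bound t \<omega>"
          by (rule residual_error_crude[where \<theta>hat=\<theta>hat and n=n, OF good close e0])
        moreover have "0 \<le> C * (e0\<^sup>2 + (1 / \<mu>) ^ t)" using C mu by simp
        then have "0 \<le> C * (e0\<^sup>2 + (1 / \<mu>) ^ t) * ?w t" by (rule mult_nonneg_nonneg[OF _ w0])
        ultimately show ?thesis using True by simp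
      next
        case False
        note r = root_env[OF goodD(4)[OF good, of "int t"]]
        have "root 3 (env (int t) \<omega>) \<le> root 3 ((\<kappa> * sqrt (real n)) ^ 3)"
          using env_max t by (intro real_root_le_mono less_imp_le) auto
        also have "\<dots> = \<kappa> * sqrt (real n)" by (simp add: odd_real_root_power_cancel)
        finally have "e0 * root 3 (env (int t) \<omega>) \<le> e0 * (\<kappa> * sqrt (real n))" using e0 by (intro mult_left_mono)
        also have "\<dots> = 1 / (8 * L)" using sn lo0 K by (simp add: e0_def \<kappa>_def)
        finally have s1: "e0 * root 3 (env (int t) \<omega>) \<le> 1 / (8 * L)" .
        have "t \<in> {T..n}" using t False by simp
        with env_T have "env (int t) \<omega> < 1 / (8 * L) * \<mu> ^ t" by blast
        then have "root 3 (env (int t) \<omega>) \<le> 1 / (8 * L) * \<mu> ^ t" by (rule order_trans[OF r(3) less_imp_le])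
        then have s2: "(1 / \<mu>) ^ t * root 3 (env (int t) \<omega>) \<le> 1 / (8 * L)"
          using mu by (simp add: power_one_over field_simps)
        show ?thesis using small[OF good close e0 s1 s2] False by simp
      qed
      have "(\<Sum>t=1..n. \<bar>residual_error \<theta>hat n t \<omega>\<bar>)
         \<le> (\<Sum>t=1..n. (if t < T then crude_bound t \<omega> else 0) + C * (e0\<^sup>2 + (1 / \<mu>) ^ t) * ?w t)"
        by (intro sum_mono err_t)
      also have "\<dots> = (\<Sum>t=1..n. if t < T then crude_bound t \<omega> else 0)
          + C * (e0\<^sup>2 * (\<Sum>t=1..n. ?w t) + (\<Sum>t=1..n. (1 / \<mu>) ^ t * ?w t))"
        by (simp only: sum.distrib sum_distrib_left distrib_left distrib_right mult.assoc)
      also have "\<dots> \<le> B + C * (e0\<^sup>2 * (K2 * real n) + K1)"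
      proof (intro add_mono mult_left_mono avg disc C)
        have "(\<Sum>t=1..n. if t < T then crude_bound t \<omega> else 0) = (\<Sum>t\<in>{1..n} \<inter> {..<T}. crude_bound t \<omega>)"
          by (intro sum.mono_neutral_cong_right) auto
        also have "\<dots> \<le> (\<Sum>t<T. crude_bound t \<omega>)"
          using crude_bound_nonneg[OF good] by (intro sum_mono2) auto
        finally show "(\<Sum>t=1..n. if t < T then crude_bound t \<omega> else 0) \<le> B" using crude by linarith
      qed auto
      also have "\<dots> = B'"
      proof -
        have "e0\<^sup>2 = (K / lo)\<^sup>2 / (sqrt (real n))\<^sup>2" unfolding e0_def by (rule power_divide)
        then have "e0\<^sup>2 * real n = (K / lo)\<^sup>2" using n(4) by (simp del: power_divide)
        then have "e0\<^sup>2 * (K2 * real n) = (K / lo)\<^sup>2 * K2" by (metis mult.assoc mult.commute)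
        then show ?thesis by (simp only: B'_def)
      qed
      finally have err: "(\<Sum>t=1..n. \<bar>residual_error \<theta>hat n t \<omega>\<bar>) \<le> B'" .
      have "\<bar>process \<theta>hat n u \<omega>\<bar> \<le> B' / sqrt (real n)
        + real k / 2 * K * (\<Sum>m<p + q + 1. \<eta>' + \<bar>noise_k * garch_psi M p q X \<theta> m\<bar> / real n)"
        using u LLN by (intro process_bound n(4) hatK err) auto
      also have "real k / 2 * K * (\<Sum>m<p + q + 1. \<eta>' + \<bar>noise_k * garch_psi M p q X \<theta> m\<bar> / real n)
        = W * real (p + q + 1) * \<eta>' + W * S / real n"
        unfolding W_def[symmetric] S_def sum.distrib sum_divide_distrib[symmetric] by (simp add: distrib_left)
      also have "W * real (p + q + 1) * \<eta>' \<le> \<eta> / 4"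
      proof -
        define w where "w = W * real (p + q + 1)"
        have w: "0 \<le> w" using W by (simp add: w_def)
        have "w * \<eta> / (4 * (w + 1)) \<le> \<eta> / 4"
          using w \<eta> by (simp add: pos_divide_le_eq distrib_left)
        then show ?thesis unfolding \<eta>'_def w_def[symmetric] by simp
      qed
      finally show "\<bar>process \<theta>hat n u \<omega>\<bar> \<le> \<eta>" using n(2,3) by linarith
    qed
  qed
qed

lemma process_eq:
  "process \<theta>hat n u \<omega> =
     (\<Sum>t=1..nat \<lfloor>real n * u\<rfloor>. 1 / sqrt (real n) * (residual p q X \<theta>hat n t \<omega> ^ k - \<epsilon> (int t) \<omega> ^ k))
     + u * (real k * noise_k / 2 * inner_prod (p + q + 1) (garch_psi M p q X \<theta>) (\<lambda>i. sqrt (real n) * (\<theta>hat n \<omega> i - \<theta> i)))"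
  by (simp add: process_def residual_partial_sum_def innovation_partial_sum_def sum_subtractf sum_distrib_left right_diff_distrib)

end

section \<open>Measurability of the supremum\<close>

lemma garch_coeff_measurable:
  assumes u: "\<And>m. m < p + q + 1 \<Longrightarrow> (\<lambda>\<omega>. u \<omega> m) \<in> borel_measurable M"
  shows "(\<lambda>\<omega>. garch_coeff p q (u \<omega>) i) \<in> borel_measurable M"
proof (cases "i = 0")
  case True
  have "(\<lambda>\<omega>. u \<omega> 0 / (1 - (\<Sum>j=1..q. u \<omega> (p + j)))) \<in> borel_measurable M"
    using u by (intro borel_measurable_divide borel_measurable_diff borel_measurable_sum borel_measurable_const) auto
  then show ?thesis using True by (simp add: garch_coeff_0)
next
  case False
  have "(\<lambda>\<omega>. lag_coeff p q (u \<omega>) i) \<in> borel_measurable M"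
  proof (induction i rule: less_induct)
    case (less i)
    show ?case
    proof (cases "i = 0")
      case False
      then have i: "i > 0" by simp
      have "(\<lambda>\<omega>. if i \<le> p then u \<omega> i else 0) \<in> borel_measurable M"
        using u[of i] by (cases "i \<le> p") auto
      then show ?thesis
        unfolding lag_coeff_rec[OF i] using u less i
        by (intro borel_measurable_add borel_measurable_sum borel_measurable_times) auto
    qed simp
  qed
  then show ?thesis using False by (simp add: garch_coeff_pos)
qed

lemma estimator_measurable:
  assumes est: "garch_estimator M p q X \<theta>hat" and X: "\<And>t. X t \<in> borel_measurable M" and m: "m < p + q + 1"
  shows "(\<lambda>\<omega>. \<theta>hat n \<omega> m) \<in> borel_measurable M"
proof -
  obtain T where T: "\<And>i. i < p + q + 1 \<Longrightarrow> (\<lambda>x. T x i) \<in> borel_measurable (Pi\<^sub>M {0..n} (\<lambda>_. borel :: real measure))"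
    "\<And>\<omega>. \<omega> \<in> space M \<Longrightarrow> \<theta>hat n \<omega> = T (\<lambda>t\<in>{0..n}. X (int t) \<omega>)"
    using est unfolding garch_estimator_def by metis
  have "(\<lambda>\<omega>. \<lambda>t\<in>{0..n}. X (int t) \<omega>) \<in> measurable M (Pi\<^sub>M {0..n} (\<lambda>_. borel))"
    using X by (intro measurable_restrict) auto
  from measurable_compose[OF this T(1)[OF m]]
  have "(\<lambda>\<omega>. T (\<lambda>t\<in>{0..n}. X (int t) \<omega>) m) \<in> borel_measurable M" .
  then show ?thesis using T(2) by (simp cong: measurable_cong)
qed

text \<open>Step functions that are constant on \<open>[j / n, (j + 1) / n)\<close>, plus a linear drift, are right-continuous,
  so their supremum over \<open>[0, 1]\<close> is the supremum over the rationals, a countable one.\<close>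

definition step_drift :: "(nat \<Rightarrow> real) \<Rightarrow> real \<Rightarrow> nat \<Rightarrow> real \<Rightarrow> real" where
  "step_drift a b n u = \<bar>(\<Sum>t=1..nat \<lfloor>real n * u\<rfloor>. a t) + u * b\<bar>"

lemma step_drift_bounded:
  assumes "u \<in> {0..1}"
  shows "step_drift a b n u \<le> (\<Sum>t=1..n. \<bar>a t\<bar>) + \<bar>b\<bar>"
proof -
  have "real n * u \<le> real n" using assms by (auto simp: mult_left_le)
  then have "nat \<lfloor>real n * u\<rfloor> \<le> n" by linarith
  then have "(\<Sum>t=1..nat \<lfloor>real n * u\<rfloor>. \<bar>a t\<bar>) \<le> (\<Sum>t=1..n. \<bar>a t\<bar>)"
    by (intro sum_mono2) auto
  moreover have "\<bar>u * b\<bar> \<le> 1 * \<bar>b\<bar>" unfolding abs_mult using assms by (intro mult_right_mono) auto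
  moreover have "step_drift a b n u \<le> (\<Sum>t=1..nat \<lfloor>real n * u\<rfloor>. \<bar>a t\<bar>) + \<bar>u * b\<bar>"
    unfolding step_drift_def by (intro order_trans[OF abs_triangle_ineq] add_mono sum_abs) auto
  ultimately show ?thesis by linarith
qed

lemma step_drift_bdd: "A \<subseteq> {0..1} \<Longrightarrow> bdd_above (step_drift a b n ` A)"
  by (rule bdd_aboveI2[where M="(\<Sum>t=1..n. \<bar>a t\<bar>) + \<bar>b\<bar>"], rule step_drift_bounded) auto

lemma step_drift_SUP: "(SUP u\<in>{0..1}. step_drift a b n u) = (SUP u\<in>{0..1} \<inter> \<rat>. step_drift a b n u)"
proof (rule antisym)
  have ne: "{0..1::real} \<inter> \<rat> \<noteq> {}" using Rats_0 by force
  show "(SUP u\<in>{0..1} \<inter> \<rat>. step_drift a b n u) \<le> (SUP u\<in>{0..1}. step_drift a b n u)"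
    by (intro cSUP_subset_mono step_drift_bdd ne) auto
  show "(SUP u\<in>{0..1}. step_drift a b n u) \<le> (SUP u\<in>{0..1} \<inter> \<rat>. step_drift a b n u)"
  proof (rule cSUP_least)
    fix u :: real assume u: "u \<in> {0..1}"
    show "step_drift a b n u \<le> (SUP u\<in>{0..1} \<inter> \<rat>. step_drift a b n u)"
    proof (cases "u = 1")
      case True
      then show ?thesis by (intro cSUP_upper step_drift_bdd) auto
    next
      case False
      show ?thesis
      proof (rule field_le_epsilon)
        fix \<epsilon> :: real assume e: "0 < \<epsilon>"
        define gap where "gap = (real_of_int \<lfloor>real n * u\<rfloor> + 1 - real n * u) / (real n + 1)"
        have gap: "0 < gap" unfolding gap_def by (intro divide_pos_pos) linarith+
        define top where "top = min 1 (min (u + gap) (u + \<epsilon> / (\<bar>b\<bar> + 1)))"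
        have "u < top" using u False gap e by (simp add: top_def)
        then obtain r where r: "r \<in> \<rat>" "u < r" "r < top" using Rats_dense_in_real by blast
        have "real n * r \<le> real n * (u + gap)" using r by (intro mult_left_mono) (auto simp: top_def)
        then have "real n * r \<le> real n * u + real n * gap" by (simp only: distrib_left)
        also have "real n * gap < real_of_int \<lfloor>real n * u\<rfloor> + 1 - real n * u"
        proof -
          have "real n * gap < (real n + 1) * gap" using gap by simp
          also have "\<dots> = real_of_int \<lfloor>real n * u\<rfloor> + 1 - real n * u" by (simp add: gap_def)
          finally show ?thesis .
        qed
        finally have "real n * r < real_of_int \<lfloor>real n * u\<rfloor> + 1" by simp
        moreover have "real n * u \<le> real n * r" using r by (simp add: mult_left_mono)
        ultimately have "\<lfloor>real n * r\<rfloor> = \<lfloor>real n * u\<rfloor>" by linarith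
        then have "step_drift a b n u \<le> step_drift a b n r + \<bar>(u - r) * b\<bar>"
          unfolding step_drift_def by (simp add: left_diff_distrib)
        also have "step_drift a b n r \<le> (SUP u\<in>{0..1} \<inter> \<rat>. step_drift a b n u)"
          using r u by (intro cSUP_upper step_drift_bdd) (auto simp: top_def)
        also have "\<bar>(u - r) * b\<bar> \<le> \<epsilon>"
        proof -
          have "r - u < \<epsilon> / (\<bar>b\<bar> + 1)" using r by (simp add: top_def)
          then have "(r - u) * (\<bar>b\<bar> + 1) < \<epsilon>" by (simp add: pos_less_divide_eq)
          moreover have "\<bar>(u - r) * b\<bar> = (r - u) * \<bar>b\<bar>" using r by (simp add: abs_mult)
          ultimately show ?thesis using r by (simp add: distrib_left)
        qed
        finally show "step_drift a b n u \<le> (SUP u\<in>{0..1} \<inter> \<rat>. step_drift a b n u) + \<epsilon>" by simp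
      qed
    qed
  qed simp
qed

lemma step_drift_SUP_measurable:
  assumes a: "\<And>t. (\<lambda>\<omega>. a \<omega> t) \<in> borel_measurable M" and b: "b \<in> borel_measurable M"
  shows "(\<lambda>\<omega>. SUP u\<in>{0..1}. step_drift (a \<omega>) (b \<omega>) n u) \<in> borel_measurable M"
  unfolding step_drift_SUP
proof (rule borel_measurable_cSUP)
  show "countable ({0..1} \<inter> \<rat> :: real set)" using countable_rat by blast
  show "(\<lambda>\<omega>. step_drift (a \<omega>) (b \<omega>) n u) \<in> borel_measurable M" for u
    unfolding step_drift_def using a b
    by (intro borel_measurable_abs borel_measurable_add borel_measurable_sum borel_measurable_times borel_measurable_const)
  show "bdd_above ((\<lambda>u. step_drift (a \<omega>) (b \<omega>) n u) ` ({0..1} \<inter> \<rat>))" for \<omega>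
    by (rule step_drift_bdd) auto
qed

section \<open>The asymptotic representation\<close>

theorem theorem1p1:
  fixes M :: "'a measure"
    and p q k :: nat
    and \<theta> :: "nat \<Rightarrow> real"
    and \<epsilon> X \<sigma> :: "int \<Rightarrow> 'a \<Rightarrow> real"
    and \<theta>hat :: "nat \<Rightarrow> 'a \<Rightarrow> nat \<Rightarrow> real"
    and u_lo u_hi \<rho>\<^sub>0 :: real
  assumes "prob_space M"
    and "p \<ge> 1" and "q \<ge> 1"
    and "garch_parameter p q \<theta>"
    and "iid_innovations M \<epsilon>"
    and "bougerol_picard M p q \<theta> \<epsilon>"
    and "garch_solution M p q \<theta> \<epsilon> X \<sigma>"
    and "0 < u_lo" and "u_lo < u_hi"
    and "0 < \<rho>\<^sub>0" and "\<rho>\<^sub>0 < 1" and "real q * u_lo < \<rho>\<^sub>0"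
    and "k \<ge> 1"
    and "\<theta> \<in> Euclidean_space (p + q + 1) interior_of param_space p q u_lo u_hi \<rho>\<^sub>0"
    and "garch_estimator M p q X \<theta>hat"
    and "bounded_in_prob M (\<lambda>n \<omega>. sqrt (real n) * max_norm (p + q + 1) (\<lambda>i. \<theta>hat n \<omega> i - \<theta> i))"
    and "\<exists>\<zeta>>0. ((\<lambda>x. x powr (- \<zeta>) * \<P>(\<omega> in M. \<bar>\<epsilon> 0 \<omega>\<bar> \<le> x)) \<longlongrightarrow> 0) (at_right 0)"
    and "integrable M (\<lambda>\<omega>. \<bar>\<epsilon> 0 \<omega>\<bar> ^ k)"
  shows "negligible_in_prob M (\<lambda>n \<omega>.
           SUP u\<in>{0..1::real}.
             \<bar>1 / sqrt (real n)
                * (residual_partial_sum p q X \<theta>hat k n u \<omega> - innovation_partial_sum \<epsilon> k n u \<omega>)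
              + real k * u * (\<integral>\<omega>'. \<epsilon> 0 \<omega>' ^ k \<partial>M) / 2
                * inner_prod (p + q + 1) (garch_psi M p q X \<theta>)
                    (\<lambda>i. sqrt (real n) * (\<theta>hat n \<omega> i - \<theta> i))\<bar>)"
proof -
  interpret prob_space M by fact
  have "\<theta> \<in> param_space p q u_lo u_hi \<rho>\<^sub>0"
    by (rule subsetD[OF interior_of_subset assms(14)])
  then have \<theta>: "(\<Sum>j=1..q. \<theta> (p + j)) \<le> \<rho>\<^sub>0" "\<And>i. i < p + q + 1 \<Longrightarrow> u_lo \<le> \<theta> i"
    unfolding param_space_def by auto
  interpret garch_noise p q \<theta> M \<epsilon>
  proof
    show "1 \<le> p" "1 \<le> q" by fact+
    show "0 < \<theta> m" if "m \<le> p + q" for m using \<theta>(2)[of m] that assms(8) by simp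
    show "(\<Sum>j=1..q. \<theta> (p + j)) < 1" using \<theta>(1) assms(11) by simp
  qed (use assms(5) in \<open>auto simp: iid_innovations_def\<close>)
  interpret garch_model p q \<theta> M \<epsilon> X \<sigma> by unfold_locales fact
  obtain \<mu> where \<mu>: "1 < \<mu>" "\<And>t. AE \<omega> in M. summable (\<lambda>i. \<mu> ^ (12 * i) * decay i (past t \<omega>))"
    "\<And>t. integrable M (\<lambda>\<omega>. envelope \<mu> (past t \<omega>))"
    using envelope_exists by blast
  interpret garch_envelope p q \<theta> M \<epsilon> X \<sigma> \<mu> k
    by unfold_locales (use \<mu> assms(18) in auto)
  have hat_meas: "(\<lambda>\<omega>. \<theta>hat n \<omega> m) \<in> borel_measurable M" if "m < p + q + 1" for n m
    by (rule estimator_measurable[OF assms(15) X_measurable that])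
  have hat: "\<exists>K. whp \<delta> (\<lambda>n \<omega>. \<forall>m\<le>p + q. \<bar>sqrt (real n) * (\<theta>hat n \<omega> m - \<theta> m)\<bar> \<le> K)" if \<delta>: "0 < \<delta>" for \<delta>
  proof -
    define Y where "Y = (\<lambda>n \<omega>. sqrt (real n) * max_norm (p + q + 1) (\<lambda>i. \<theta>hat n \<omega> i - \<theta> i))"
    have Ym [measurable]: "Y n \<in> borel_measurable M" for n
      unfolding Y_def max_norm_def using hat_meas
      by (intro borel_measurable_times borel_measurable_const borel_measurable_Max borel_measurable_abs borel_measurable_diff) auto
    obtain K where K: "\<forall>\<^sub>F n in sequentially. prob {\<omega> \<in> space M. K < \<bar>Y n \<omega>\<bar>} \<le> \<delta>"
      using assms(16) \<delta> unfolding bounded_in_prob_def Y_def by blast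
    have "\<bar>sqrt (real n) * (\<theta>hat n \<omega> m - \<theta> m)\<bar> \<le> K" if "\<bar>Y n \<omega>\<bar> \<le> K" "m \<le> p + q" for n \<omega> m
    proof -
      have "\<bar>\<theta>hat n \<omega> m - \<theta> m\<bar> \<le> max_norm (p + q + 1) (\<lambda>i. \<theta>hat n \<omega> i - \<theta> i)"
        unfolding max_norm_def using that(2) by (intro Max_ge) auto
      then have "\<bar>sqrt (real n) * (\<theta>hat n \<omega> m - \<theta> m)\<bar> \<le> Y n \<omega>"
        unfolding Y_def abs_mult by (simp add: mult_left_mono)
      then show ?thesis using that(1) by linarith
    qed
    moreover have "whp \<delta> (\<lambda>n \<omega>. \<bar>Y n \<omega>\<bar> \<le> K)"
      unfolding whp_def using K
    proof eventually_elim
      case (elim n)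
      have "{\<omega> \<in> space M. K < \<bar>Y n \<omega>\<bar>} \<in> events" by measurable
      then show ?case using elim by (intro bexI[of _ "{\<omega> \<in> space M. K < \<bar>Y n \<omega>\<bar>}"]) auto
    qed
    ultimately have "whp \<delta> (\<lambda>n \<omega>. \<forall>m\<le>p + q. \<bar>sqrt (real n) * (\<theta>hat n \<omega> m - \<theta> m)\<bar> \<le> K)"
      by (elim whp_mono) auto
    then show ?thesis by blast
  qed
  define a where "a = (\<lambda>n \<omega> t. 1 / sqrt (real n) * (residual p q X \<theta>hat n t \<omega> ^ k - \<epsilon> (int t) \<omega> ^ k))"
  define b where "b = (\<lambda>n \<omega>. real k * noise_k / 2 * inner_prod (p + q + 1) (garch_psi M p q X \<theta>)
    (\<lambda>i. sqrt (real n) * (\<theta>hat n \<omega> i - \<theta> i)))"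
  have proc: "\<bar>process \<theta>hat n u \<omega>\<bar> = step_drift (a n \<omega>) (b n \<omega>) n u" for n u \<omega>
    by (simp only: process_eq step_drift_def a_def b_def)
  have "negligible_in_prob M (\<lambda>n \<omega>. SUP u\<in>{0..1}. \<bar>process \<theta>hat n u \<omega>\<bar>)"
    unfolding negligible_in_prob_def
  proof (intro conjI allI impI)
    fix n
    have c: "(\<lambda>\<omega>. garch_coeff p q (\<theta>hat n \<omega>) i) \<in> borel_measurable M" for i
      by (rule garch_coeff_measurable[OF hat_meas])
    have s: "sigma2_hat p q X \<theta>hat n t \<in> borel_measurable M" for t
      unfolding sigma2_hat_def using c
      by (intro borel_measurable_add borel_measurable_sum borel_measurable_times borel_measurable_power X_measurable)
    have "(\<lambda>\<omega>. a n \<omega> t) \<in> borel_measurable M" for t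
      unfolding a_def residual_def using s[of t] by measurable
    moreover have "b n \<in> borel_measurable M"
      unfolding b_def inner_prod_def using hat_meas
      by (intro borel_measurable_times borel_measurable_sum borel_measurable_diff borel_measurable_const) auto
    ultimately show "(\<lambda>\<omega>. SUP u\<in>{0..1}. \<bar>process \<theta>hat n u \<omega>\<bar>) \<in> borel_measurable M"
      unfolding proc by (rule step_drift_SUP_measurable)
  next
    fix \<eta> :: real assume \<eta>: "0 < \<eta>"
    show "(\<lambda>n. prob {\<omega> \<in> space M. \<eta> < \<bar>SUP u\<in>{0..1}. \<bar>process \<theta>hat n u \<omega>\<bar>\<bar>}) \<longlonglongrightarrow> 0"
    proof (rule order_tendstoI)
      fix \<delta> :: real assume \<delta>: "0 < \<delta>"
      then have "whp (\<delta> / 2) (\<lambda>n \<omega>. \<forall>u\<in>{0..1}. \<bar>process \<theta>hat n u \<omega>\<bar> \<le> \<eta>)"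
        using hat \<eta> by (intro process_whp) auto
      then show "\<forall>\<^sub>F n in sequentially. prob {\<omega> \<in> space M. \<eta> < \<bar>SUP u\<in>{0..1}. \<bar>process \<theta>hat n u \<omega>\<bar>\<bar>} < \<delta>"
        unfolding whp_def
      proof eventually_elim
        case (elim n)
        then obtain A where A: "A \<in> events" "prob A \<le> \<delta> / 2"
          "\<And>\<omega> u. \<omega> \<in> space M - A \<Longrightarrow> u \<in> {0..1} \<Longrightarrow> \<bar>process \<theta>hat n u \<omega>\<bar> \<le> \<eta>" by blast
        have "\<bar>SUP u\<in>{0..1}. \<bar>process \<theta>hat n u \<omega>\<bar>\<bar> \<le> \<eta>" if \<omega>: "\<omega> \<in> space M - A" for \<omega>
        proof -
          have bdd: "bdd_above ((\<lambda>u. \<bar>process \<theta>hat n u \<omega>\<bar>) ` {0..1})"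
            using A(3)[OF \<omega>] by (intro bdd_aboveI2)
          have "0 \<le> \<bar>process \<theta>hat n 0 \<omega>\<bar>" by simp
          also have "\<dots> \<le> (SUP u\<in>{0..1}. \<bar>process \<theta>hat n u \<omega>\<bar>)"
            by (intro cSUP_upper bdd) auto
          finally have "0 \<le> (SUP u\<in>{0..1}. \<bar>process \<theta>hat n u \<omega>\<bar>)" .
          moreover have "(SUP u\<in>{0..1}. \<bar>process \<theta>hat n u \<omega>\<bar>) \<le> \<eta>"
            by (intro cSUP_least A(3)[OF \<omega>]) auto
          ultimately show ?thesis by simp
        qed
        then have "{\<omega> \<in> space M. \<eta> < \<bar>SUP u\<in>{0..1}. \<bar>process \<theta>hat n u \<omega>\<bar>\<bar>} \<subseteq> A"
          by (force simp: not_le[symmetric])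
        then have "prob {\<omega> \<in> space M. \<eta> < \<bar>SUP u\<in>{0..1}. \<bar>process \<theta>hat n u \<omega>\<bar>\<bar>} \<le> prob A"
          using A(1) by (rule finite_measure_mono)
        then show ?case using A(2) \<delta> by simp
      qed
    next
      fix c :: real assume "c < 0"
      then show "\<forall>\<^sub>F n in sequentially. c < prob {\<omega> \<in> space M. \<eta> < \<bar>SUP u\<in>{0..1}. \<bar>process \<theta>hat n u \<omega>\<bar>\<bar>}"
        by (intro always_eventually allI) (rule less_le_trans[OF _ measure_nonneg])
    qed
  qed
  then show ?thesis unfolding process_def noise_k_def .
qed

end
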